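(* Let $a,N$ be real parameters and let $F,G$ be finite (possibly empty) sets of positive integers, with cardinals $k_1=|F|$ and $k_3=|G|$. Let $U=I(F)$, $V=I(G)$, $m_1=|U|$, $m_3=|V|$, $m=2(m_1+m_3)$. Let $\Omega$, $\Omega_1$, $H$, $R$, $S(x)=\sigma_{x-\frac{m-1}{2}}R(x)/\Omega(x)$ and $M_1,\ldots,M_m$ be as defined in the context. Then: (i) $S(x)\Omega(x)$ is a polynomial in $x$. (ii) There exist polynomials $\tilde M_1,\ldots,\tilde M_m$ such that $M_h(x)=\sigma_{x+1}\tilde M_h(\theta_x)$ for $h=1,\ldots,m$. (iii) There exists a polynomial $P_S$ such that $P_S(\theta_x)-P_S(\theta_{x-1})=S(x)\Omega(x)+S(x+m)\Omega(x+m)$. Moreover, the order of the associated difference operator $$D_{S}=\frac{1}{2}P_S(D_H)+\sum_{h=1}^{m_1}\tilde M_h(D_H)\left(\mathcal D_1+\mathcal D_2\right) Y_{u_h}(D_H)+\sum_{h=1}^{m_3}\tilde M_{2m_1+h}(D_H)\left(\mathcal D_3+\mathcal D_4\right) Z_{v_h}(D_H)$$ is $$2\left(\sum_{f\in F}f+\sum_{f\in G}f-\binom{k_1}{2}-\binom{k_3}{2}+1\right).$$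
   Context: Involution on sets: for a nonempty finite set $F$ of positive integers with maximum $f_k=\max F$, $I(F)=\{1,2,\ldots,f_k\}\setminus\{f_k-f: f\in F\}$; $I(\emptyset)=\emptyset$. Write $U=\{u_1<\dots<u_{m_1}\}$, $V=\{v_1<\dots<v_{m_3}\}$. Basic functions (the Hahn parameters are $a=b$): $\theta_x=x(x+2a+1)$, $\sigma_x=\theta_{x-3/2}-\theta_{x-1/2}=-(2x+2a-1)$. With $(c)_j=c(c+1)\cdots(c+j-1)$, for integers $j\ge 0$, $$N_{x,j}=(x-j-N)_j,\quad D_{x,j}=(-1)^j(x-j+2a+N+2)_j,$$ $$\xi^1_{x,j}=\frac{N_{x,j}}{D_{x,j}},\quad \xi^2_{x,j}=(-1)^j\xi^1_{x,j},\quad \xi^3_{x,j}=1,\quad \xi^4_{x,j}=(-1)^j.$$ Dual Hahn polynomials: $R_n^{\alpha,\beta,M}(x)=\sum_{j=0}^n\frac{(-1)^j(-n)_j}{(\alpha+1)_j(-M)_j\,j!}\prod_{i=0}^{j-1}\big(x-i(\alpha+\beta+1+i)\big)$. Set $$Y_u(x)=R_u^{-a,-a,2a+N}(x+2a)\ (u\in U),\qquad Z_u(x)=R_u^{-a,-a,-2-N}(x+2a)\ (u\in V).$$ Determinants: $\Omega(x)$ is the $m\times m$ determinant whose columns are indexed by $j=1,\ldots,m$ and whose rows are, in this order: $\xi^1_{x-j,m-j}Y_u(\theta_{x-j})$ for $u\in U$; $(-1)^j\xi^1_{x-j,m-j}Y_u(\theta_{x-j})$ for $u\in U$; $\xi^3_{x-j,m-j}Z_u(\theta_{x-j})$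 for $u\in V$; $(-1)^j\xi^3_{x-j,m-j}Z_u(\theta_{x-j})$ for $u\in V$ (elements of $U$ and of $V$ taken in increasing order). $\Omega_1(x)$ is the $(m_1+m_3)\times(m_1+m_3)$ determinant with columns $j=1,\ldots,m_1+m_3$ and rows: $\xi^1_{x-2j+1,m-2j+1}Y_u(\theta_{x-2j+1})$ for $u\in U$, then $\xi^3_{x-2j+1,m-2j+1}Z_u(\theta_{x-2j+1})$ for $u\in V$. For a determinant, $(\cdot)_{h,j}$ denotes the minor obtained by deleting the $h$-th row and the $j$-th column of the corresponding matrix. (Empty determinants and empty products equal 1.) The functions $H$ and $R$: let $$p(x)=\prod_{j=1}^{m_1-1}D_{x-1,2j}N_{x-m+2j+1,2j},\qquad q(x)=\prod_{i=1}^{\lfloor (m_1+m_3)/2\rfloor}\ \prod_{j=1}^{m-4i+1}\sigma_{x-m+2i+j},$$ $$H(x)=\frac{\sigma_{x-m_1-m_3+1}\,(D_{x-1,m-1})^{m_1}}{p(x)q(x)\,(N_{x-m+1,1})^{m_1}}.$$ $H(x)\Omega_1(x)$ is a polynomial, and the polynomial $R$ is defined as the (monic) solution of the difference equation $$\sigma_{x-\frac{m-1}{2}}R(x)+\sigma_{x+1-\frac{m-1}{2}}R(x+1)=H(x)\Omega_1(x).$$ The functions $M_h$: for $h=1,\ldots,m$, $$M_h(x)=\sum_{j=1}^{m}(-1)^{h+j}\,\xi_{x,m-j}^{i(h)}\,S(x+j)\,\left(\Omega(x+j)\right)_{h,j},$$ where $i(h)=1$ for $1\le h\le m_1$, $i(h)=2$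 for $m_1+1\le h\le 2m_1$, $i(h)=3$ for $2m_1+1\le h\le 2m_1+m_3$, and $i(h)=4$ for $2m_1+m_3+1\le h\le m$. Operators (acting on polynomials in $x$): $\mathfrak s_l f(x)=f(x+l)$, $\Delta f(x)=f(x+1)-f(x)$, $\nabla f(x)=f(x)-f(x-1)$, $\mathrm{Id}$ the identity. $D_H$ is the second-order difference operator of the Hahn polynomials with parameters $a,a,N$ (eigenvalues $\theta_n=n(n+2a+1)$): $$D_H=(x+a+1)(x-N)\mathfrak s_1-\big[(x+a+1)(x-N)+x(x-a-N-1)\big]\mathfrak s_0+x(x-a-N-1)\mathfrak s_{-1}.$$ Also $$\mathcal D_1=\tfrac{2a+1}{2}\mathrm{Id}+x\nabla,\quad \mathcal D_2=\tfrac{2a+1}{2}\mathrm{Id}+(x-N)\Delta,$$ $$\mathcal D_3=\tfrac{2a+1}{2}\mathrm{Id}+(x+a+1)\Delta,\quad \mathcal D_4=\tfrac{2a+1}{2}\mathrm{Id}+(x-a-N-1)\nabla.$$ The order of a difference operator $\sum_{l=s}^{r}h_l\mathfrak s_l$ with polynomial coefficients and $h_r,h_s\ne0$ is $r-s$. *)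

theory Defs
  imports
    "HOL-Computational_Algebra.Polynomial"
    "HOL-Library.Infinite_Set"
    "Jordan_Normal_Form.Determinant"
begin

text \<open>
  Rational functions of \<open>x\<close> are represented by real functions. At the finitely many poles
  the value is the one given by \<open>x / 0 = 0\<close>, so an identity of rational functions is
  stated for all but finitely many real \<open>x\<close> (\<open>MOST x. _\<close>).
\<close>

definition involution :: "nat set \<Rightarrow> nat set" where
  "involution F = (if F = {} then {} else {1..Max F} - (\<lambda>f. Max F - f) ` F)"

definition dual_hahn :: "nat \<Rightarrow> real \<Rightarrow> real \<Rightarrow> real \<Rightarrow> real poly" where
  "dual_hahn n \<alpha> \<beta> M =
     (\<Sum>j\<le>n. smult ((-1) ^ j * pochhammer (- real n) j
                  / (pochhammer (\<alpha> + 1) j * pochhammer (- M) j * fact j))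
            (\<Prod>i<j. [:- (real i * (\<alpha> + \<beta> + 1 + real i)), 1:]))"

text \<open>No denominator vanishes in the sum defining the dual Hahn polynomial.\<close>
definition dual_hahn_defined :: "nat \<Rightarrow> real \<Rightarrow> real \<Rightarrow> bool" where
  "dual_hahn_defined n \<alpha> M \<longleftrightarrow>
     (\<forall>j\<le>n. pochhammer (\<alpha> + 1) j \<noteq> 0 \<and> pochhammer (- M) j \<noteq> 0)"

definition shift_op :: "int \<Rightarrow> real poly \<Rightarrow> real poly" where
  "shift_op l f = pcompose f [:of_int l, 1:]"

definition Delta_op :: "real poly \<Rightarrow> real poly" where
  "Delta_op f = shift_op 1 f - f"

definition Nabla_op :: "real poly \<Rightarrow> real poly" where
  "Nabla_op f = f - shift_op (-1) f"

definition poly_op :: "real poly \<Rightarrow> (real poly \<Rightarrow> real poly) \<Rightarrow> real poly \<Rightarrow> real poly" where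
  "poly_op p T f = (\<Sum>i\<le>degree p. smult (coeff p i) ((T ^^ i) f))"

text \<open>
  The operators \<open>shift_op l\<close> are linearly independent over the polynomials, so the
  representation, and with it the order, is unique.
\<close>
definition diffop_has_order :: "(real poly \<Rightarrow> real poly) \<Rightarrow> int \<Rightarrow> bool" where
  "diffop_has_order T d \<longleftrightarrow>
     (\<exists>(h :: int \<Rightarrow> real poly) s r. s \<le> r \<and> h r \<noteq> 0 \<and> h s \<noteq> 0
        \<and> (\<forall>f. T f = (\<Sum>l\<in>{s..r}. h l * shift_op l f)) \<and> d = r - s)"

context
  fixes a N :: real and U V :: "nat set"
begin

definition theta :: "real \<Rightarrow> real" where
  "theta x = x * (x + 2 * a + 1)"

definition sigma :: "real \<Rightarrow> real" where
  "sigma x = theta (x - 3 / 2) - theta (x - 1 / 2)"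

definition Nfun :: "real \<Rightarrow> nat \<Rightarrow> real" where
  "Nfun x j = pochhammer (x - real j - N) j"

definition Dfun :: "real \<Rightarrow> nat \<Rightarrow> real" where
  "Dfun x j = (-1) ^ j * pochhammer (x - real j + 2 * a + N + 2) j"

definition xi :: "nat \<Rightarrow> real \<Rightarrow> nat \<Rightarrow> real" where
  "xi i x j =
     (if i = 1 then Nfun x j / Dfun x j
      else if i = 2 then (-1) ^ j * (Nfun x j / Dfun x j)
      else if i = 3 then 1
      else (-1) ^ j)"

definition Ypol :: "nat \<Rightarrow> real poly" where
  "Ypol u = pcompose (dual_hahn u (- a) (- a) (2 * a + N)) [:2 * a, 1:]"

definition Zpol :: "nat \<Rightarrow> real poly" where
  "Zpol v = pcompose (dual_hahn v (- a) (- a) (- 2 - N)) [:2 * a, 1:]"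

private abbreviation (input) m1 :: nat where "m1 \<equiv> card U"
private abbreviation (input) m3 :: nat where "m3 \<equiv> card V"
private abbreviation (input) m :: nat where "m \<equiv> 2 * (m1 + m3)"

text \<open>\<open>u i\<close> and \<open>v i\<close> are the \<open>i\<close>-th smallest elements, counted from \<open>0\<close>.\<close>
private abbreviation (input) u :: "nat \<Rightarrow> nat" where "u i \<equiv> sorted_list_of_set U ! i"
private abbreviation (input) v :: "nat \<Rightarrow> nat" where "v i \<equiv> sorted_list_of_set V ! i"

text \<open>
  Matrix indices start at \<open>0\<close>: the entry \<open>(h, k)\<close> belongs to row \<open>h + 1\<close> and column
  \<open>j = k + 1\<close> in the numbering from \<open>1\<close>.
\<close>
definition Omega_mat :: "real \<Rightarrow> real mat" where
  "Omega_mat x = mat m m (\<lambda>(h, k).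
     let j = k + 1; y = x - real j in
     if h < m1 then
       xi 1 y (m - j) * poly (Ypol (u h)) (theta y)
     else if h < 2 * m1 then
       (-1) ^ j * xi 1 y (m - j) * poly (Ypol (u (h - m1))) (theta y)
     else if h < 2 * m1 + m3 then
       xi 3 y (m - j) * poly (Zpol (v (h - 2 * m1))) (theta y)
     else
       (-1) ^ j * xi 3 y (m - j) * poly (Zpol (v (h - 2 * m1 - m3))) (theta y))"

definition Omega :: "real \<Rightarrow> real" where
  "Omega x = det (Omega_mat x)"

definition Omega1 :: "real \<Rightarrow> real" where
  "Omega1 x = det (mat (m1 + m3) (m1 + m3) (\<lambda>(h, k).
     let j = k + 1; y = x - 2 * real j + 1 in
     if h < m1 then xi 1 y (m - 2 * j + 1) * poly (Ypol (u h)) (theta y)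
     else xi 3 y (m - 2 * j + 1) * poly (Zpol (v (h - m1))) (theta y)))"

definition pfun :: "real \<Rightarrow> real" where
  "pfun x = (\<Prod>j = 1..m1 - 1.
     Dfun (x - 1) (2 * j) * Nfun (x - real m + 2 * real j + 1) (2 * j))"

text \<open>No subtraction on natural numbers is truncated here, since \<open>4 * i \<le> m\<close>.\<close>
definition qfun :: "real \<Rightarrow> real" where
  "qfun x = (\<Prod>i = 1..(m1 + m3) div 2. \<Prod>j = 1..m - 4 * i + 1.
     sigma (x - real m + 2 * real i + real j))"

definition Hfun :: "real \<Rightarrow> real" where
  "Hfun x = sigma (x - real m1 - real m3 + 1) * Dfun (x - 1) (m - 1) ^ m1
     / (pfun x * qfun x * Nfun (x - real m + 1) 1 ^ m1)"

text \<open>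
  \<open>c = 1\<close> is the displayed difference equation. Its solution is in general not monic;
  the monic normalisation is the solution for another nonzero value of \<open>c\<close>.
\<close>
definition is_R :: "real \<Rightarrow> real poly \<Rightarrow> bool" where
  "is_R c R \<longleftrightarrow>
     (MOST x. sigma (x - (real m - 1) / 2) * poly R x
            + sigma (x + 1 - (real m - 1) / 2) * poly R (x + 1) = c * (Hfun x * Omega1 x))"

definition Sfun :: "real poly \<Rightarrow> real \<Rightarrow> real" where
  "Sfun R x = sigma (x - (real m - 1) / 2) * poly R x / Omega x"

definition block :: "nat \<Rightarrow> nat" where
  "block h = (if h \<le> m1 then 1 else if h \<le> 2 * m1 then 2
              else if h \<le> 2 * m1 + m3 then 3 else 4)"

definition Mfun :: "real poly \<Rightarrow> nat \<Rightarrow> real \<Rightarrow> real" where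
  "Mfun R h x = (\<Sum>j = 1..m. (-1) ^ (h + j) * xi (block h) x (m - j) * Sfun R (x + real j)
     * det (mat_delete (Omega_mat (x + real j)) (h - 1) (j - 1)))"

definition hahn_op :: "real poly \<Rightarrow> real poly" where
  "hahn_op f =
     ([:a + 1, 1:] * [:- N, 1:]) * shift_op 1 f
     - ([:a + 1, 1:] * [:- N, 1:] + [:0, 1:] * [:- a - N - 1, 1:]) * shift_op 0 f
     + ([:0, 1:] * [:- a - N - 1, 1:]) * shift_op (-1) f"

definition D1_op :: "real poly \<Rightarrow> real poly" where
  "D1_op f = smult ((2 * a + 1) / 2) f + [:0, 1:] * Nabla_op f"

definition D2_op :: "real poly \<Rightarrow> real poly" where
  "D2_op f = smult ((2 * a + 1) / 2) f + [:- N, 1:] * Delta_op f"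

definition D3_op :: "real poly \<Rightarrow> real poly" where
  "D3_op f = smult ((2 * a + 1) / 2) f + [:a + 1, 1:] * Delta_op f"

definition D4_op :: "real poly \<Rightarrow> real poly" where
  "D4_op f = smult ((2 * a + 1) / 2) f + [:- a - N - 1, 1:] * Nabla_op f"

definition is_Mtilde :: "real poly \<Rightarrow> (nat \<Rightarrow> real poly) \<Rightarrow> bool" where
  "is_Mtilde R Mt \<longleftrightarrow>
     (\<forall>h\<in>{1..m}. MOST x. Mfun R h x = sigma (x + 1) * poly (Mt h) (theta x))"

definition is_PS :: "real poly \<Rightarrow> real poly \<Rightarrow> bool" where
  "is_PS R P \<longleftrightarrow>
     (MOST x. poly P (theta x) - poly P (theta (x - 1))
            = Sfun R x * Omega x + Sfun R (x + real m) * Omega (x + real m))"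

definition DS_op :: "(nat \<Rightarrow> real poly) \<Rightarrow> real poly \<Rightarrow> real poly \<Rightarrow> real poly" where
  "DS_op Mt P f =
     smult (1 / 2) (poly_op P hahn_op f)
     + (\<Sum>h = 1..m1. poly_op (Mt h) hahn_op
          ((\<lambda>g. D1_op g + D2_op g) (poly_op (Ypol (u (h - 1))) hahn_op f)))
     + (\<Sum>h = 1..m3. poly_op (Mt (2 * m1 + h)) hahn_op
          ((\<lambda>g. D3_op g + D4_op g) (poly_op (Zpol (v (h - 1))) hahn_op f)))"

end

end

theory Submission
  imports Defs
begin

text \<open>
  Put \<open>n = m\<^sub>1 + m\<^sub>3\<close>, \<open>b = a + N + 1/2\<close> and \<open>t = x - n + a + 1/2\<close>. The points \<open>\<theta>\<close> occurring in
  \<open>\<Omega>\<^sub>1(x)\<close> are \<open>(t + d\<^sub>l)\<^sup>2 - (a + 1/2)\<^sup>2\<close> with \<open>d\<^sub>l = n - 1 - 2 l\<close>, and \<open>H \<Omega>\<^sub>1\<close> is a constant multiple of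
  \<open>t E(t) / (p q)\<close> for a determinant \<open>E\<close> whose rows are even polynomials evaluated at the \<open>t + d\<^sub>l\<close>, those
  belonging to \<open>U\<close> with weights \<open>w\<^sub>l(t)\<close>. Iterating twisted averages
  \<open>A(t) f(t + 1) + A(- t) f(t - 1)\<close> and differences \<open>(A(t) f(t + 1) - A(- t) f(t - 1)) / 4t\<close>, which
  preserve even polynomials, gives a column transformation, independent of the weights, from the columns of
  \<open>E\<close> to even polynomials; comparison with a Vandermonde determinant shows that it divides \<open>E\<close> by \<open>q\<close>.
  The factor \<open>p\<close> divides every term of the Leibniz expansion of \<open>E\<close>. Since \<open>p\<close> and \<open>q\<close> are
  coprime for generic \<open>b\<close>, their product divides \<open>E\<close> for all \<open>b\<close>, and the quotient \<open>W\<close> is even. Its leading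
  coefficient is a Vandermonde determinant in the numbers \<open>u - a - N - 1\<close> and \<open>v\<close>; if two of
  these coincide, the symmetry of the continuous dual Hahn polynomials in their parameters makes two rows
  proportional, so that \<open>\<Omega> = 0\<close>.

  The block structure of \<open>\<Omega>\<close> reduces \<open>M\<^sub>h\<close> to \<open>\<Sum>l. T\<^sub>l(s - d\<^sub>l)\<close> with \<open>s = x + a + 1/2\<close>, where
  \<open>f \<mapsto> \<Sum>l. T\<^sub>l(t) f(t + d\<^sub>l)\<close> maps even polynomials \<open>f\<close> to \<open>t W\<close> with the \<open>h\<close>-th row replaced by \<open>f\<close>.
  So this operator is a combination with odd polynomial coefficients of iterated averages and differences, and
  its formal adjoint, which maps \<open>1\<close> to \<open>M\<^sub>h\<close>, maps odd polynomials to odd polynomials and lowers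
  degrees. This gives \<open>M\<^sub>h\<close> as well as the bound on its degree which prevents
  the terms with \<open>M\<^sub>h\<close> from contributing to the extreme coefficients of \<open>D\<^sub>S\<close>.
\<close>

section \<open>Leading terms\<close>

text \<open>For odd \<open>j\<close> the columns \<open>j\<close> and \<open>j + 1\<close> of
  \<Omega> carry, up to scaling, the same column of \<open>E\<close>, taken at \<open>x\<close> and
  at \<open>x - 1\<close>; plain and alternating rows are two signed combinations of these blocks.
  So the inverse of the matrix of \<Omega> is explicit in terms of those of \<open>E\<close>. In
  \<open>M_h\<close> both columns meet \<open>E\<close> at the same argument, hence their factors S
  \<Omega> add up to the left side of the equation for \<open>R\<close>. Thus \<open>R\<close>
  disappears, and the right side, a multiple of t W, cancels the factor \<open>W\<close> of det E;
  only p q stays in the denominators.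

  The obstacle in dividing by p q is that for special parameters the two share roots. Therefore
  \<open>b\<close> is made an indeterminate while the row polynomials stay fixed, although in the
  application they depend on the same parameters.

  Weighted differences keep the degree of an even polynomial, plain ones lower it by two. The
  leading factors are falling factorials in both cases, with the shift b + 1/2 = a + N + 1 produced
  by the weights; so one Vandermonde determinant governs the leading coefficient of
  \<open>W\<close>.\<close>

definition lead :: "'a::idom poly \<Rightarrow> int \<Rightarrow> 'a \<Rightarrow> bool" where
  "lead f e c \<longleftrightarrow> (\<forall>i. e \<le> int i \<longrightarrow> coeff f i = (if int i = e then c else 0)) \<and> (e < 0 \<longrightarrow> c = 0)"

lemma lead_nat: "lead f (int d) c \<longleftrightarrow> degree f \<le> d \<and> coeff f d = c"
proof
  assume *: "lead f (int d) c"
  have "degree f \<le> d"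
    by (rule degree_le) (use * in \<open>auto simp: lead_def\<close>)
  with * show "degree f \<le> d \<and> coeff f d = c" by (auto simp: lead_def)
next
  assume *: "degree f \<le> d \<and> coeff f d = c"
  then show "lead f (int d) c" by (auto simp: lead_def coeff_eq_0)
qed

text \<open>Exponents are integers because differences push formal degrees below zero. There the
  definition forces \<open>f = 0\<close> and \<open>c = 0\<close>, so degree counts need no case
  distinction.\<close>

lemma lead_neg: "lead f e c \<Longrightarrow> e < 0 \<Longrightarrow> f = 0 \<and> c = 0"
  by (auto simp: lead_def poly_eq_iff)

lemma lead_0 [simp]: "lead 0 e 0"
  by (auto simp: lead_def)

lemma lead_monom: "lead (monom c d) (int d) c"
  by (simp add: lead_nat degree_monom_le)

lemma lead_add: "lead f e c \<Longrightarrow> lead g e c' \<Longrightarrow> lead (f + g) e (c + c')"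
  by (auto simp: lead_def)

lemma lead_smult: "lead f e c \<Longrightarrow> lead (smult a f) e (a * c)"
  by (auto simp: lead_def)

lemma lead_sum: "(\<And>i. i \<in> I \<Longrightarrow> lead (f i) e (c i)) \<Longrightarrow> lead (\<Sum>i\<in>I. f i) e (\<Sum>i\<in>I. c i)"
  by (induction I rule: infinite_finite_induct) (auto intro: lead_add)

lemma lead_mono: "lead f e c \<Longrightarrow> e < e' \<Longrightarrow> lead f e' 0"
  by (auto simp: lead_def)

lemma lead_mult:
  assumes f: "lead f e c" and g: "lead g e' c'"
  shows "lead (f * g) (e + e') (c * c')"
proof (cases "e < 0 \<or> e' < 0")
  case True
  then show ?thesis using lead_neg[OF f] lead_neg[OF g] by auto
next
  case False
  then obtain d d' where d: "e = int d" "e' = int d'"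
    by (metis linorder_not_less nat_eq_iff2 nonneg_int_cases)
  have deg: "degree f \<le> d" "degree g \<le> d'" "coeff f d = c" "coeff g d' = c'"
    using f g by (auto simp: d lead_nat)
  have "coeff (f * g) (d + d') = (\<Sum>i\<le>d + d'. coeff f i * coeff g (d + d' - i))"
    by (simp add: coeff_mult)
  also have "\<dots> = (\<Sum>i\<in>{d}. coeff f i * coeff g (d + d' - i))"
  proof (rule sum.mono_neutral_right)
    show "\<forall>i\<in>{..d + d'} - {d}. coeff f i * coeff g (d + d' - i) = 0"
    proof
      fix i assume i: "i \<in> {..d + d'} - {d}"
      then consider "i > d" | "d + d' - i > d'" by force
      then show "coeff f i * coeff g (d + d' - i) = 0"
        using deg by cases (auto intro: coeff_eq_0)
    qed
  qed auto
  finally have "coeff (f * g) (d + d') = c * c'" using deg by simp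
  moreover have "degree (f * g) \<le> d + d'"
    using degree_mult_le[of f g] deg by linarith
  ultimately have "lead (f * g) (int (d + d')) (c * c')" by (simp only: lead_nat)
  then show ?thesis by (simp add: d)
qed

lemma lead_prod:
  "finite I \<Longrightarrow> (\<And>i. i \<in> I \<Longrightarrow> lead (f i) (e i) (c i)) \<Longrightarrow> lead (\<Prod>i\<in>I. f i) (\<Sum>i\<in>I. e i) (\<Prod>i\<in>I. c i)"
proof (induction I rule: finite_induct)
  case empty
  show ?case using lead_nat[of 1 0 1] by simp
next
  case (insert x F)
  then show ?case by (simp add: lead_mult)
qed

lemma lead_degree:
  assumes "lead f e c" "c \<noteq> 0"
  shows "int (degree f) = e" "lead_coeff f = c"
proof -
  have "e \<ge> 0" using assms lead_neg[of f e c] by force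
  then obtain d where d: "e = int d" by (metis nonneg_int_cases)
  have "degree f \<le> d" "coeff f d = c" using assms by (auto simp: d lead_nat)
  moreover from this assms have "d \<le> degree f" by (intro le_degree) auto
  ultimately show "int (degree f) = e" "lead_coeff f = c" by (auto simp: d)
qed

text \<open>Row and column degrees add up to the same total along every permutation, so all Leibniz
  terms contribute in one degree and their leading coefficients form a determinant again.\<close>

lemma lead_det:
  fixes A :: "'a::idom poly mat"
  assumes A: "A \<in> carrier_mat n n"
    and L: "\<And>i j. i < n \<Longrightarrow> j < n \<Longrightarrow> lead (A $$ (i, j)) (e i + d j) (c i j)"
  shows "lead (det A) ((\<Sum>i<n. e i) + (\<Sum>j<n. d j)) (det (mat n n (\<lambda>(i, j). c i j)))"
proof -
  let ?C = "mat n n (\<lambda>(i, j). c i j)"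
  have detC: "det ?C = (\<Sum>p\<in>{p. p permutes {0..<n}}. signof p * (\<Prod>i = 0..<n. c i (p i)))"
    by (subst det_def'[of _ n]) (auto intro!: sum.cong prod.cong arg_cong2[of _ _ _ _ "(*)"]
        simp: permutes_in_image dest: permutes_nat_less)
  show ?thesis
    unfolding det_def'[OF A] detC
  proof (rule lead_sum)
    fix p assume "p \<in> {p. p permutes {0..<n}}"
    then have p: "p permutes {0..<n}" by simp
    have pn: "p i < n" if "i < n" for i using permutes_in_image[OF p, of i] that by simp
    have "lead (\<Prod>i = 0..<n. A $$ (i, p i)) (\<Sum>i = 0..<n. e i + d (p i)) (\<Prod>i = 0..<n. c i (p i))"
      by (rule lead_prod) (use L pn in auto)
    moreover have "(\<Sum>i = 0..<n. d (p i)) = (\<Sum>i = 0..<n. d i)"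
      using sum.permute[OF p, of d] by (simp add: o_def)
    ultimately have "lead (\<Prod>i = 0..<n. A $$ (i, p i)) ((\<Sum>i<n. e i) + (\<Sum>j<n. d j)) (\<Prod>i = 0..<n. c i (p i))"
      by (simp add: sum.distrib atLeast0LessThan)
    moreover have "lead (signof p :: 'a poly) 0 (signof p)"
      using lead_nat[of 1 0 1] lead_nat[of "-1" 0 "-1"] by (auto simp: sign_def)
    ultimately show "lead (signof p * (\<Prod>i = 0..<n. A $$ (i, p i))) ((\<Sum>i<n. e i) + (\<Sum>j<n. d j))
         (signof p * (\<Prod>i = 0..<n. c i (p i)))"
      using lead_mult by fastforce
  qed
qed

text \<open>Reads off the leading term of a quotient by a monic divisor. As \<open>c = 0\<close> is
  allowed, the true degree of \<open>f\<close> may lie below \<open>e'\<close>.\<close>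

lemma lead_cancel:
  assumes "lead (p * f) (e + e') c" "lead p e 1"
  shows "lead f e' c"
proof (cases "f = 0")
  case True
  have "c = 0"
  proof (cases "e + e' < 0")
    case False
    then show ?thesis using assms(1) True by (auto simp: lead_def dest: spec[of _ "nat (e + e')"])
  qed (use assms in \<open>auto simp: lead_def\<close>)
  with True show ?thesis by simp
next
  case False
  have e: "int (degree p) = e" "lead_coeff p = 1" using lead_degree[OF assms(2)] by auto
  have deg: "degree (p * f) = degree p + degree f"
    using False e by (intro degree_mult_eq) auto
  have lc: "lead_coeff (p * f) = lead_coeff f" using e by (simp add: lead_coeff_mult)
  have L: "lead f (int (degree f)) (lead_coeff f)" by (simp add: lead_nat)
  show ?thesis
  proof (cases "int (degree f) = e'")
    case True
    then have ee: "e + e' = int (degree (p * f))" by (simp add: deg e)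
    have "coeff (p * f) (degree (p * f)) = c" using assms(1) unfolding ee lead_nat by simp
    with lc True L show ?thesis by auto
  next
    case ne: False
    have "int (degree (p * f)) < e + e'"
    proof (rule ccontr)
      assume "\<not> ?thesis"
      then have "e + e' < int (degree (p * f))" using ne e deg by auto
      then have "coeff (p * f) (degree (p * f)) = 0" using assms(1) by (auto simp: lead_def)
      then show False using lc False by simp
    qed
    then have lt: "int (degree f) < e'" using deg e by simp
    then have "lead (p * f) (e + e') 0" using lead_nat[of "p * f" "degree (p * f)"]
      using \<open>int (degree (p * f)) < e + e'\<close> lead_mono by blast
    with assms(1) have "c = 0"
      using \<open>int (degree (p * f)) < e + e'\<close> by (auto simp: lead_def dest: spec[of _ "nat (e + e')"])
    with lead_mono[OF L lt] show ?thesis by simp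
  qed
qed

section \<open>Symmetric difference operators on even polynomials\<close>

definition evenp :: "real poly \<Rightarrow> bool" where "evenp f \<longleftrightarrow> (\<forall>i. odd i \<longrightarrow> coeff f i = 0)"
definition oddp :: "real poly \<Rightarrow> bool" where "oddp f \<longleftrightarrow> (\<forall>i. even i \<longrightarrow> coeff f i = 0)"

lemma coeff_reflect: "coeff (pcompose f [:0, - 1:]) i = (-1) ^ i * coeff f (i::nat)" for f :: "real poly"
proof (induction f arbitrary: i)
  case (pCons a f)
  then show ?case
    by (cases i) (auto simp: pcompose_pCons)
qed auto

lemma poly_inf_eq:
  fixes f g :: "real poly"
  assumes "MOST x. poly f x = poly g x"
  shows "f = g"
proof (rule ccontr)
  assume "f \<noteq> g"
  then have "finite {x. poly (f - g) x = 0}" by (intro poly_roots_finite) auto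
  moreover have "finite {x. poly f x \<noteq> poly g x}" using assms by (simp add: MOST_iff_cofinite)
  ultimately have "finite ({x. poly (f - g) x = 0} \<union> {x. poly f x \<noteq> poly g x})" by blast
  also have "{x. poly (f - g) x = 0} \<union> {x. poly f x \<noteq> poly g x} = UNIV" by auto
  finally have "finite (UNIV :: real set)" .
  then show False using infinite_UNIV_char_0 by blast
qed

lemma evenp_iff: "evenp f \<longleftrightarrow> (\<forall>x. poly f (- x) = poly f x)"
proof
  assume "evenp f"
  then have "pcompose f [:0, - 1:] = f"
    by (auto simp: poly_eq_iff coeff_reflect evenp_def) (metis even_power minus_one_power_iff mult_minus1 mult_1 neg_equal_zero)
  then show "\<forall>x. poly f (- x) = poly f x"
    by (metis poly_pcompose poly_pCons poly_0 mult_minus1_right add.left_neutral add.right_neutral mult_zero_right)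
next
  assume *: "\<forall>x. poly f (- x) = poly f x"
  have "poly (pcompose f [:0, - 1:]) x = poly f x" for x using * by (simp add: poly_pcompose)
  then have "pcompose f [:0, - 1:] = f" by (auto intro!: poly_ext)
  then show "evenp f" unfolding evenp_def
    by (metis coeff_reflect minus_one_power_iff mult_minus1 neg_equal_zero)
qed


lemma oddp_iff: "oddp f \<longleftrightarrow> (\<forall>x. poly f (- x) = - poly f x)"
proof
  assume "oddp f"
  then have "pcompose f [:0, - 1:] = - f"
    by (auto simp: poly_eq_iff coeff_reflect oddp_def minus_one_power_iff)
  then show "\<forall>x. poly f (- x) = - poly f x"
    by (metis poly_pcompose poly_pCons poly_0 poly_minus mult_minus1_right add.left_neutral add.right_neutral mult_zero_right)
next
  assume *: "\<forall>x. poly f (- x) = - poly f x"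
  have "poly (pcompose f [:0, - 1:]) x = poly (- f) x" for x using * by (simp add: poly_pcompose)
  then have "pcompose f [:0, - 1:] = - f" by (auto intro!: poly_ext)
  then have *: "(-1) ^ i * coeff f i = - coeff f i" for i using coeff_reflect[of f i] by simp
  have "coeff f i = 0" if "even i" for i using *[of i] that by simp
  then show "oddp f" unfolding oddp_def by blast
qed

lemma evenp_minus: "evenp f \<Longrightarrow> y = - x \<Longrightarrow> poly f y = poly f x"
  by (simp add: evenp_iff)

lemma oddp_minus: "oddp f \<Longrightarrow> y = - x \<Longrightarrow> poly f y = - poly f x"
  by (simp add: oddp_iff)

definition sh :: "real \<Rightarrow> real poly \<Rightarrow> real poly" where "sh h f = pcompose f [:h, 1:]"

lemma poly_sh [simp]: "poly (sh h f) x = poly f (x + h)"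
  by (simp add: sh_def poly_pcompose add.commute)

lemma degree_sh [simp]: "degree (sh h f) = degree f"
  by (simp add: sh_def degree_pcompose)

lemma sh_pCons: "sh h (pCons a f) = [:a:] + [:h, 1:] * sh h f"
  by (simp add: sh_def pcompose_pCons)

text \<open>The coefficient below the top is needed since differences of shifts cancel the top one;
  its change is the first-order Taylor term.\<close>

lemma coeff_sh_top:
  "degree f \<le> Suc d \<Longrightarrow> coeff (sh h f) (Suc d) = coeff f (Suc d) \<and>
    coeff (sh h f) d = coeff f d + real (Suc d) * h * coeff f (Suc d)"
proof (induction f arbitrary: d)
  case 0
  then show ?case by (simp add: sh_def)
next
  case (pCons a f)
  show ?case
  proof (cases d)
    case 0
    then have "degree f = 0" using pCons.prems pCons.hyps by (auto split: if_splits)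
    then obtain c where "f = [:c:]" by (metis degree_eq_zeroE)
    then show ?thesis using 0 by (simp add: sh_def pcompose_pCons)
  next
    case (Suc e)
    have deg: "degree f \<le> Suc e" using pCons.prems pCons.hyps Suc by (auto split: if_splits)
    have z: "coeff (sh h f) (Suc (Suc e)) = 0" using deg by (auto intro!: coeff_eq_0)
    show ?thesis using pCons.IH[OF deg] z Suc
      by (simp add: sh_pCons algebra_simps)
  qed
qed

definition sym_part :: "real poly \<Rightarrow> real poly" where
  "sym_part g = g + pcompose g [:0, -1:]"

text \<open>Division of the odd part by \<open>t\<close> is \<open>poly_shift 1\<close>, which drops
  a vanishing constant coefficient. The 4 comes from (t + 1)^2 - (t - 1)^2 = 4 t, making
  \<open>del 1\<close> a divided difference with respect to t^2.\<close>

definition skew_part :: "real poly \<Rightarrow> real poly" where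
  "skew_part g = smult (1/4) (poly_shift 1 (g - pcompose g [:0, -1:]))"

lemma coeff_sym_part: "coeff (sym_part g) i = (if even i then 2 * coeff g i else 0)"
  by (simp add: sym_part_def coeff_reflect)

lemma coeff_skew_part: "coeff (skew_part g) i = (if even i then coeff g (Suc i) / 2 else 0)"
  by (simp add: skew_part_def coeff_poly_shift coeff_reflect)

lemma evenp_sym_part [simp]: "evenp (sym_part g)"
  by (simp add: evenp_def coeff_sym_part)

lemma evenp_skew_part [simp]: "evenp (skew_part g)"
  by (simp add: evenp_def coeff_skew_part)

lemma poly_sym_part: "poly (sym_part g) t = poly g t + poly g (- t)"
  by (simp add: sym_part_def poly_pcompose)

lemma poly_skew_part: "4 * t * poly (skew_part g) t = poly g t - poly g (- t)"
proof -
  have "[:0, 4:] * skew_part g = g - pcompose g [:0, -1:]"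
  proof (rule poly_eqI)
    fix n show "coeff ([:0, 4:] * skew_part g) n = coeff (g - pcompose g [:0, - 1:]) n"
      by (cases n) (auto simp: coeff_skew_part coeff_reflect poly_0_coeff_0)
  qed
  then have "poly ([:0, 4:] * skew_part g) t = poly (g - pcompose g [:0, -1:]) t" by simp
  then show ?thesis by (simp add: poly_pcompose algebra_simps)
qed

lemma lead_sym_part:
  assumes "lead g (2 * k) c"
  shows "lead (sym_part g) (2 * k) (2 * c)"
proof -
  have "even i" if "int i = 2 * k" for i using that by presburger
  then show ?thesis using assms by (auto simp: lead_def coeff_sym_part)
qed

lemma lead_skew_part:
  assumes g: "lead g (2 * k) c" and c': "\<And>i. 2 * k - 1 = int i \<Longrightarrow> coeff g i = 2 * c'"
    and neg: "k < 1 \<Longrightarrow> c' = 0"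
  shows "lead (skew_part g) (2 * k - 2) c'"
proof -
  have "coeff g (Suc i) = 2 * c'" if "int i = 2 * k - 2" for i using c'[of "Suc i"] that by simp
  moreover have "coeff g (Suc i) = 0" if "int i > 2 * k - 2" "even i" for i
  proof -
    have "int i \<ge> 2 * k" using that by presburger
    then show ?thesis using g by (auto simp: lead_def)
  qed
  moreover have "even i" if "int i = 2 * k - 2" for i using that by presburger
  ultimately show ?thesis using neg
    by (auto simp: lead_def coeff_skew_part order_le_less)
qed

definition qw :: "real \<Rightarrow> real poly" where "qw \<beta> = [:\<beta> * (\<beta> + 1), - (2 * \<beta> + 1), 1:]"

lemma poly_qw: "poly (qw \<beta>) t = (t - \<beta>) * (t - \<beta> - 1)"
  by (simp add: qw_def algebra_simps)

text \<open>For even \<open>f\<close> the reflection of \<open>A * sh 1 f\<close> is A(- t) f(t -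
  1), so these are the twisted averages and differences. Written through parity parts they are
  polynomial and even by construction.\<close>

definition mu :: "real poly \<Rightarrow> real poly \<Rightarrow> real poly" where
  "mu A f = sym_part (A * sh 1 f)"

definition del :: "real poly \<Rightarrow> real poly \<Rightarrow> real poly" where
  "del A f = skew_part (A * sh 1 f)"

lemma evenp_mu [simp]: "evenp (mu A f)" and evenp_del [simp]: "evenp (del A f)"
  by (simp_all add: mu_def del_def)

lemma poly_mu: "evenp f \<Longrightarrow> poly (mu A f) t = poly A t * poly f (t + 1) + poly A (- t) * poly f (t - 1)"
proof -
  assume "evenp f"
  from evenp_minus[OF this, of "1 - t" "t - 1"] have "poly f (1 - t) = poly f (t - 1)" by simp
  then show ?thesis by (simp add: mu_def poly_sym_part)
qed

lemma poly_del: 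
  assumes "evenp f" "t \<noteq> 0"
  shows "poly (del A f) t = (poly A t * poly f (t + 1) - poly A (- t) * poly f (t - 1)) / (4 * t)"
proof -
  have "poly f (- t + 1) = poly f (t - 1)"
    using evenp_minus[OF assms(1), of "- t + 1" "t - 1"] by simp
  then show ?thesis
    using poly_skew_part[of t "A * sh 1 f"] assms(2) by (simp add: del_def field_simps)
qed

lemma lead_sh:
  assumes "lead f e c" shows "lead (sh h f) e c"
proof (cases "e < 0")
  case True
  then show ?thesis using lead_neg[OF assms True] by (simp add: sh_def)
next
  case False
  then obtain d where d: "e = int d" by (metis linorder_not_less nonneg_int_cases)
  have f: "degree f \<le> d" "coeff f d = c" using assms unfolding d lead_nat by auto
  have "coeff (sh h f) d = coeff f d"
  proof (cases d)
    case 0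
    with f obtain a where "f = [:a:]" by (metis degree_eq_zeroE le_zero_eq)
    then show ?thesis by (simp add: sh_def)
  next
    case (Suc d')
    then show ?thesis using f coeff_sh_top[of f d' h] by simp
  qed
  with f show ?thesis by (simp add: d lead_nat)
qed

lemma lead_mu_1: "lead f (2 * k) c \<Longrightarrow> lead (mu 1 f) (2 * k) (2 * c)"
  by (simp add: mu_def lead_sym_part lead_sh)

lemma lead_qw: "lead (qw \<beta>) 2 1"
  using lead_nat[of "qw \<beta>" 2 1] by (simp add: qw_def numeral_2_eq_2)

lemma lead_mu_qw: "lead f (2 * k) c \<Longrightarrow> lead (mu (qw \<beta>) f) (2 * k + 2) (2 * c)"
  unfolding mu_def
  using lead_sym_part[of "qw \<beta> * sh 1 f" "k + 1" c] lead_mult[OF lead_qw lead_sh, of f "2 * k" c \<beta> 1]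
  by (simp add: algebra_simps)

lemma evenp_coeff_sh:
  assumes f: "lead f (2 * k) c" and e: "evenp f" and i: "2 * k - 1 = int i"
  shows "coeff (sh 1 f) i = 2 * of_int k * c"
proof -
  have k: "2 * k = int (Suc i)" using i by simp
  then have "of_int (2 * k) = real (Suc i)" by (metis of_int_of_nat_eq)
  moreover have "degree f \<le> Suc i" "coeff f (Suc i) = c" using f unfolding k lead_nat by auto
  moreover have "odd i" using k by presburger
  ultimately show ?thesis using coeff_sh_top[of f i 1] e by (simp add: evenp_def)
qed

lemma lead_del_1:
  assumes "lead f (2 * k) c" "evenp f"
  shows "lead (del 1 f) (2 * k - 2) (of_int k * c)"
  unfolding del_def
proof (rule lead_skew_part)
  show "lead (1 * sh 1 f) (2 * k) c" using assms lead_sh by simp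
  show "coeff (1 * sh 1 f) i = 2 * (of_int k * c)" if "2 * k - 1 = int i" for i
    using evenp_coeff_sh[OF assms that] by simp
  show "of_int k * c = 0" if "k < 1"
    using lead_neg[OF assms(1)] that by (cases "k = 0") auto
qed

text \<open>Below the top, the shift contributes \<open>2 * k\<close> and the middle coefficient of
  \<open>qw\<close> contributes \<open>- (2 * \<beta> + 1)\<close>; half of their sum is the stated
  factor. The degree does not drop, in contrast to \<open>lead_del_1\<close>.\<close>

lemma lead_del_qw:
  assumes "lead f (2 * k) c" "evenp f"
  shows "lead (del (qw \<beta>) f) (2 * k) ((of_int k - \<beta> - 1/2) * c)"
proof -
  have L: "lead (qw \<beta> * sh 1 f) (2 * (k + 1)) c"
    using lead_mult[OF lead_qw lead_sh, OF assms(1), of \<beta> 1] by (simp add: algebra_simps)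
  have "lead (skew_part (qw \<beta> * sh 1 f)) (2 * (k + 1) - 2) ((of_int k - \<beta> - 1/2) * c)"
  proof (rule lead_skew_part[OF L])
    show "(of_int k - \<beta> - 1/2) * c = 0" if "k + 1 < 1" using lead_neg[OF assms(1)] that by simp
    fix i assume i: "2 * (k + 1) - 1 = int i"
    have S: "lead (sh 1 f) (2 * k) c" using lead_sh[OF assms(1)] .
    show "coeff (qw \<beta> * sh 1 f) i = 2 * ((of_int k - \<beta> - 1/2) * c)"
    proof (cases "k = 0")
      case True
      then have i1: "i = Suc 0" using i by simp
      have "coeff (sh 1 f) (Suc 0) = 0" "coeff (sh 1 f) 0 = c" using S True by (auto simp: lead_def)
      then show ?thesis using True i1 by (simp add: qw_def algebra_simps)
    next
      case False
      with i have "i \<ge> 2" by presburger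
      then obtain j where j: "i = Suc (Suc j)" by (auto simp: le_iff_add)
      have jk: "2 * k - 1 = int j" using i j by simp
      have "coeff (sh 1 f) (Suc j) = c" "coeff (sh 1 f) (Suc (Suc j)) = 0" 
        using S jk by (auto simp: lead_def)
      moreover have "coeff (sh 1 f) j = 2 * of_int k * c" using evenp_coeff_sh[OF assms jk] .
      ultimately show ?thesis by (simp add: qw_def j algebra_simps)
    qed
  qed
  then show ?thesis by (simp add: del_def)
qed

text \<open>Unfolded: \<open>r\<close> differences with \<open>A 0\<close>, ...,
  \<open>A (r - 1)\<close>, then \<open>k - r\<close> averages with the remaining weights; an index
  \<open>r > k\<close> counts as \<open>k\<close>. For \<open>r = 0, ..., k\<close> all these
  operators use the same \<open>k + 1\<close> values at t + k, t + k - 2, ..., t - k.\<close>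

fun sym_op :: "(nat \<Rightarrow> real poly) \<Rightarrow> nat \<Rightarrow> nat \<Rightarrow> real poly \<Rightarrow> real poly" where
  "sym_op A 0 r f = f"
| "sym_op A (Suc k) r f = (if r \<le> k then mu (A k) (sym_op A k r f) else del (A k) (sym_op A k k f))"

lemma evenp_sym_op: "evenp f \<Longrightarrow> evenp (sym_op A k r f)"
  by (cases k) auto

lemma lead_sym_op_1:
  assumes "lead f (2 * \<kappa>) c" "evenp f" "r \<le> k"
  shows "lead (sym_op (\<lambda>_. 1) k r f) (2 * \<kappa> - 2 * int r) (2 ^ (k - r) * (\<Prod>i<r. of_int \<kappa> - real i) * c)"
  using assms(3)
proof (induction k arbitrary: r)
  case 0
  then show ?case using assms by simp
next
  case (Suc k)
  show ?case
  proof (cases "r \<le> k")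
    case True
    then have "lead (mu 1 (sym_op (\<lambda>_. 1) k r f)) (2 * (\<kappa> - int r)) (2 * (2 ^ (k - r) * (\<Prod>i<r. of_int \<kappa> - real i) * c))"
      using Suc.IH[OF True] by (intro lead_mu_1) (simp add: algebra_simps)
    then show ?thesis using True by (simp add: algebra_simps Suc_diff_le)
  next
    case False
    then have r: "r = Suc k" using Suc.prems by simp
    have "lead (del 1 (sym_op (\<lambda>_. 1) k k f)) (2 * (\<kappa> - int k) - 2) (of_int (\<kappa> - int k) * (2 ^ (k - k) * (\<Prod>i<k. of_int \<kappa> - real i) * c))"
      using Suc.IH[of k] by (intro lead_del_1) (auto simp add: algebra_simps evenp_sym_op assms)
    then show ?thesis using r by (simp add: algebra_simps)
  qed
qed

text \<open>The differences leave the degree at \<open>2 * \<kappa>\<close>, but the parameter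
  \<open>b + i\<close> of the weight grows. So the factors decrease by one per step just as for the
  weight 1, and the product is a falling factorial of \<open>\<kappa> - b - 1/2\<close>.\<close>

lemma lead_sym_op_qw:
  assumes "lead f (2 * \<kappa>) c" "evenp f" "r \<le> k"
  shows "lead (sym_op (\<lambda>l. qw (b + real l)) k r f) (2 * \<kappa> + 2 * int k - 2 * int r)
           (2 ^ (k - r) * (\<Prod>i<r. of_int \<kappa> - b - 1/2 - real i) * c)"
  using assms(3)
proof (induction k arbitrary: r)
  case 0
  then show ?case using assms by simp
next
  case (Suc k)
  let ?B = "sym_op (\<lambda>l. qw (b + real l))"
  show ?case
  proof (cases "r \<le> k")
    case True
    then have "lead (mu (qw (b + real k)) (?B k r f)) (2 * (\<kappa> + int k - int r) + 2) (2 * (2 ^ (k - r) * (\<Prod>i<r. of_int \<kappa> - b - 1/2 - real i) * c))"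
      using Suc.IH[OF True] by (intro lead_mu_qw) (simp add: algebra_simps)
    then show ?thesis using True by (simp add: algebra_simps Suc_diff_le)
  next
    case False
    then have r: "r = Suc k" using Suc.prems by simp
    have "lead (del (qw (b + real k)) (?B k k f)) (2 * \<kappa>) ((of_int \<kappa> - (b + real k) - 1/2) * (2 ^ (k - k) * (\<Prod>i<k. of_int \<kappa> - b - 1/2 - real i) * c))"
      using Suc.IH[of k] by (intro lead_del_qw) (auto simp add: algebra_simps evenp_sym_op assms)
    then show ?thesis using r by (simp add: algebra_simps)
  qed
qed

text \<open>
  The coefficients of \<open>sym_op A k r\<close> with respect to the values at \<open>t + k - 2 * l\<close>, once the weights
  which depend on \<open>A\<close> are split off.
\<close>
fun sym_op_coeff :: "nat \<Rightarrow> nat \<Rightarrow> nat \<Rightarrow> real \<Rightarrow> real" where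
  "sym_op_coeff 0 r l t = (if l = 0 then 1 else 0)"
| "sym_op_coeff (Suc k) r l t = (if r \<le> k
     then sym_op_coeff k r l (t + 1) + (case l of 0 \<Rightarrow> 0 | Suc l' \<Rightarrow> sym_op_coeff k r l' (t - 1))
     else (sym_op_coeff k k l (t + 1) - (case l of 0 \<Rightarrow> 0 | Suc l' \<Rightarrow> sym_op_coeff k k l' (t - 1))) / (4 * t))"

lemma sym_op_coeff_eq_0: "k < l \<Longrightarrow> sym_op_coeff k r l t = 0"
  by (induction k arbitrary: r l t) (auto split: nat.splits)

lemma Ints_shift: "t + 1 \<in> \<int> \<longleftrightarrow> t \<in> \<int>" "t - 1 \<in> \<int> \<longleftrightarrow> (t::real) \<in> \<int>"
  using Ints_add[OF _ Ints_1, of "t - 1"] Ints_diff[OF _ Ints_1, of "t + 1"]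
    Ints_add[OF _ Ints_1, of t] Ints_diff[OF _ Ints_1, of t] by auto

text \<open>\<open>w k l\<close> is the weight collected on the way from \<open>t\<close> to the
  node t + k - 2 l. The two rules say that it depends on the end point only and not on the order of
  left and right steps; hence it factors out of the coefficients.\<close>

locale weight =
  fixes A :: "nat \<Rightarrow> real poly" and w :: "nat \<Rightarrow> nat \<Rightarrow> real \<Rightarrow> real"
  assumes w_0: "w 0 0 t = 1"
    and w_left: "l \<le> k \<Longrightarrow> w (Suc k) l t = poly (A k) t * w k l (t + 1)"
    and w_right: "l \<le> k \<Longrightarrow> w (Suc k) (Suc l) t = poly (A k) (- t) * w k l (t - 1)"
begin

text \<open>Nonintegral \<open>t\<close> keeps every divisor \<open>4 * t\<close>, taken at integral
  translates of the argument in the recursion, away from zero.\<close>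

lemma poly_sym_op:
  assumes "evenp f" "t \<notin> \<int>"
  shows "poly (sym_op A k r f) t = (\<Sum>l\<le>k. sym_op_coeff k r l t * w k l t * poly f (t + real k - 2 * real l))"
  using assms(2)
proof (induction k arbitrary: r t)
  case 0
  then show ?case by (simp add: w_0)
next
  case (Suc k)
  let ?F = "\<lambda>k l t. w k l t * poly f (t + real k - 2 * real l)"
  have t: "t + 1 \<notin> \<int>" "t - 1 \<notin> \<int>" "t \<noteq> 0" using Suc.prems by (auto simp: Ints_shift)
  have L: "poly (A k) t * poly (sym_op A k r f) (t + 1) = (\<Sum>l\<le>Suc k. sym_op_coeff k r l (t + 1) * ?F (Suc k) l t)" for r
  proof -
    have "poly (sym_op A k r f) (t + 1) = (\<Sum>l\<le>k. sym_op_coeff k r l (t + 1) * w k l (t + 1) * poly f (t + 1 + real k - 2 * real l))"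
      by (rule Suc.IH[OF t(1)])
    moreover have "t + 1 + real k - 2 * real l = t + real (Suc k) - 2 * real l" for l by simp
    ultimately show ?thesis by (simp add: sum_distrib_left sym_op_coeff_eq_0 w_left mult_ac add_ac)
  qed
  have R: "poly (A k) (- t) * poly (sym_op A k r f) (t - 1)
     = (\<Sum>l\<le>Suc k. (case l of 0 \<Rightarrow> 0 | Suc l' \<Rightarrow> sym_op_coeff k r l' (t - 1)) * ?F (Suc k) l t)" for r
  proof -
    have "poly (sym_op A k r f) (t - 1) = (\<Sum>l\<le>k. sym_op_coeff k r l (t - 1) * w k l (t - 1) * poly f (t - 1 + real k - 2 * real l))"
      by (rule Suc.IH[OF t(2)])
    moreover have "t - 1 + real k - 2 * real l = t + real (Suc k) - 2 * real (Suc l)" for l by simp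
    ultimately have "poly (sym_op A k r f) (t - 1) = (\<Sum>l\<le>k. sym_op_coeff k r l (t - 1) * w k l (t - 1) * poly f (t + real (Suc k) - 2 * real (Suc l)))"
      by (simp only:)
    then show ?thesis unfolding sum.atMost_Suc_shift 
      by (simp add: sum_distrib_left w_right mult_ac del: of_nat_Suc)
  qed
  show ?case
  proof (cases "r \<le> k")
    case True
    then have "poly (sym_op A (Suc k) r f) t = poly (A k) t * poly (sym_op A k r f) (t + 1) + poly (A k) (- t) * poly (sym_op A k r f) (t - 1)"
      by (simp add: poly_mu evenp_sym_op assms(1))
    also have "\<dots> = (\<Sum>l\<le>Suc k. sym_op_coeff (Suc k) r l t * ?F (Suc k) l t)"
      unfolding L R sum.distrib[symmetric] using True by (intro sum.cong) (auto simp: algebra_simps)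
    finally show ?thesis by (simp add: mult.assoc)
  next
    case False
    then have "poly (sym_op A (Suc k) r f) t = (poly (A k) t * poly (sym_op A k k f) (t + 1) - poly (A k) (- t) * poly (sym_op A k k f) (t - 1)) / (4 * t)"
      by (simp add: poly_del evenp_sym_op assms(1) t)
    also have "\<dots> = (\<Sum>l\<le>Suc k. sym_op_coeff (Suc k) r l t * ?F (Suc k) l t)"
      unfolding L R sum_subtractf[symmetric] sum_divide_distrib using False
      by (intro sum.cong) (auto simp: left_diff_distrib diff_divide_distrib)
    finally show ?thesis by (simp add: mult.assoc)
  qed
qed

end

text \<open>Formal adjoint of the unweighted operator followed by multiplication with
  \<open>G\<close>, applied to the constant 1: the term with the value at t + k - 2 l is rewritten
  in the variable s = t + k - 2 l.\<close>

definition sym_op_adj :: "nat \<Rightarrow> nat \<Rightarrow> (real \<Rightarrow> real) \<Rightarrow> real \<Rightarrow> real" where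
  "sym_op_adj k r G s = (\<Sum>l\<le>k. sym_op_coeff k r l (s - real k + 2 * real l) * G (s - real k + 2 * real l))"

text \<open>Taking adjoints reverses the order, so the outermost average or difference acts on
  \<open>G\<close> first, with its shifts reversed.\<close>

lemma sym_op_adj_Suc:
  "sym_op_adj (Suc k) r G s = (if r \<le> k then sym_op_adj k r (\<lambda>t. G (t - 1) + G (t + 1)) s
     else sym_op_adj k k (\<lambda>t. G (t - 1) / (4 * (t - 1)) - G (t + 1) / (4 * (t + 1))) s)"
proof -
  define \<tau> where "\<tau> l = s - real (Suc k) + 2 * real l" for l :: nat
  let ?\<sigma> = "\<lambda>l. s - real k + 2 * real l"
  have L: "(\<Sum>l\<le>Suc k. sym_op_coeff k r l (\<tau> l + 1) * H (\<tau> l)) = (\<Sum>l\<le>k. sym_op_coeff k r l (?\<sigma> l) * H (?\<sigma> l - 1))" for r H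
    by (auto simp: sym_op_coeff_eq_0 algebra_simps \<tau>_def intro!: sum.cong)
  have R: "(\<Sum>l\<le>Suc k. (case l of 0 \<Rightarrow> 0 | Suc l' \<Rightarrow> sym_op_coeff k r l' (\<tau> l - 1)) * H (\<tau> l))
      = (\<Sum>l\<le>k. sym_op_coeff k r l (?\<sigma> l) * H (?\<sigma> l + 1))" for r H
    unfolding sum.atMost_Suc_shift
    by (auto simp: algebra_simps \<tau>_def intro!: sum.cong)
  show ?thesis
  proof (cases "r \<le> k")
    case True
    then have "sym_op_adj (Suc k) r G s = (\<Sum>l\<le>Suc k. sym_op_coeff k r l (\<tau> l + 1) * G (\<tau> l))
        + (\<Sum>l\<le>Suc k. (case l of 0 \<Rightarrow> 0 | Suc l' \<Rightarrow> sym_op_coeff k r l' (\<tau> l - 1)) * G (\<tau> l))"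
      unfolding sym_op_adj_def \<tau>_def[symmetric] sum.distrib[symmetric] by (intro sum.cong) (auto simp: distrib_right)
    then show ?thesis unfolding L R using True by (simp add: sym_op_adj_def sum.distrib algebra_simps)
  next
    case False
    then have "sym_op_adj (Suc k) r G s = (\<Sum>l\<le>Suc k. sym_op_coeff k k l (\<tau> l + 1) * (G (\<tau> l) / (4 * \<tau> l)))
        - (\<Sum>l\<le>Suc k. (case l of 0 \<Rightarrow> 0 | Suc l' \<Rightarrow> sym_op_coeff k k l' (\<tau> l - 1)) * (G (\<tau> l) / (4 * \<tau> l)))"
      unfolding sym_op_adj_def \<tau>_def[symmetric] sum_subtractf[symmetric] 
      by (intro sum.cong) (auto simp: diff_divide_distrib left_diff_distrib right_diff_distrib)
    also have "\<dots> = (\<Sum>l\<le>k. sym_op_coeff k k l (?\<sigma> l) * (G (?\<sigma> l - 1) / (4 * (?\<sigma> l - 1)))) - (\<Sum>l\<le>k. sym_op_coeff k k l (?\<sigma> l) * (G (?\<sigma> l + 1) / (4 * (?\<sigma> l + 1))))"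
      unfolding L[of k "\<lambda>t. G t / (4 * t)"] R[of k "\<lambda>t. G t / (4 * t)"] by simp
    finally show ?thesis using False by (simp add: sym_op_adj_def sum_subtractf right_diff_distrib)
  qed
qed

lemma sym_op_adj_cong: "s \<notin> \<int> \<Longrightarrow> (\<And>t. t \<notin> \<int> \<Longrightarrow> G t = H t) \<Longrightarrow> sym_op_adj k r G s = sym_op_adj k r H s"
proof -
  assume s: "s \<notin> \<int>" and GH: "\<And>t. t \<notin> \<int> \<Longrightarrow> G t = H t"
  have "s - real k + 2 * real l \<notin> \<int>" for l
  proof
    assume "s - real k + 2 * real l \<in> \<int>"
    then have "(s - real k + 2 * real l) + (real k - 2 * real l) \<in> \<int>" by (intro Ints_add Ints_diff) auto
    with s show False by simp
  qed
  then show ?thesis using GH by (auto simp: sym_op_adj_def intro!: sum.cong)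
qed

lemma degree_diff_less_top: 
  fixes p q :: "real poly"
  assumes "degree p \<le> Suc d" "degree q \<le> Suc d" "coeff p (Suc d) = coeff q (Suc d)"
  shows "degree (p - q) \<le> d"
proof (rule degree_le, intro allI impI)
  fix i assume "d < i"
  then show "coeff (p - q) i = 0" using assms 
    by (cases "i = Suc d") (simp_all add: coeff_eq_0)
qed

text \<open>An average preserves parity and degree. A difference divides the odd \<open>G\<close> by
  its argument, which costs one degree, and then subtracts two shifts of the resulting even
  polynomial, which costs another and restores oddness. So \<open>r\<close> differences lower the
  degree by \<open>2 * r\<close>.\<close>

lemma sym_op_adj_oddp:
  assumes "oddp G" "degree G \<le> e + 2 * r" "r \<le> k"
  shows "\<exists>Q. oddp Q \<and> degree Q \<le> e \<and> (\<forall>s. s \<notin> \<int> \<longrightarrow> sym_op_adj k r (poly G) s = poly Q s)"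
  using assms
proof (induction k arbitrary: G r)
  case 0
  then show ?case by (intro exI[of _ G]) (auto simp: sym_op_adj_def)
next
  case (Suc k)
  show ?case
  proof (cases "r \<le> k")
    case True
    let ?G = "sh (-1) G + sh 1 G"
    have "oddp ?G" unfolding oddp_iff
    proof
      fix x show "poly ?G (- x) = - poly ?G x"
        using oddp_minus[OF \<open>oddp G\<close>, of "- x - 1" "x + 1"] oddp_minus[OF \<open>oddp G\<close>, of "- x + 1" "x - 1"]
        by simp
    qed
    moreover have "degree ?G \<le> e + 2 * r" using Suc.prems by (intro degree_add_le) auto
    ultimately obtain Q where "oddp Q" "degree Q \<le> e" "\<forall>s. s \<notin> \<int> \<longrightarrow> sym_op_adj k r (poly ?G) s = poly Q s"
      using Suc.IH[of ?G r] True by blast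
    moreover have "poly ?G = (\<lambda>t. poly G (t - 1) + poly G (t + 1))" by auto
    ultimately show ?thesis using True by (intro exI[of _ Q]) (simp add: sym_op_adj_Suc)
  next
    case False
    then have r: "r = Suc k" using Suc.prems by simp
    define K where "K = poly_shift 1 G"
    have GK: "G = [:0, 1:] * K"
    proof (rule poly_eqI)
      fix n show "coeff G n = coeff ([:0, 1:] * K) n"
        using \<open>oddp G\<close> by (cases n) (auto simp: K_def coeff_poly_shift oddp_def)
    qed
    have evK: "evenp K" using \<open>oddp G\<close> by (auto simp: K_def coeff_poly_shift oddp_def evenp_def)
    have dK: "degree K \<le> Suc (e + 2 * k)"
      by (rule degree_le) (use Suc.prems r in \<open>auto simp: K_def coeff_poly_shift intro!: coeff_eq_0\<close>)
    let ?G = "smult (1/4) (sh (-1) K - sh 1 K)"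
    have "oddp ?G" unfolding oddp_iff
    proof
      fix x show "poly ?G (- x) = - poly ?G x"
        using evenp_minus[OF evK, of "- x - 1" "x + 1"] evenp_minus[OF evK, of "- x + 1" "x - 1"]
        by (simp add: diff_divide_distrib)
    qed
    moreover have "degree ?G \<le> e + 2 * k"
    proof -
      have "coeff (sh (-1) K) (Suc (e + 2 * k)) = coeff (sh 1 K) (Suc (e + 2 * k))"
        using coeff_sh_top[OF dK] by metis
      then have "degree (sh (-1) K - sh 1 K) \<le> e + 2 * k" using dK by (intro degree_diff_less_top) auto
      then show ?thesis by simp
    qed
    ultimately obtain Q where Q: "oddp Q" "degree Q \<le> e" "\<forall>s. s \<notin> \<int> \<longrightarrow> sym_op_adj k k (poly ?G) s = poly Q s"
      using Suc.IH[of ?G k] by blast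
    have GK': "poly G x / (4 * x) = poly K x / 4" if "x \<noteq> 0" for x
      using that by (simp add: GK)
    have "sym_op_adj (Suc k) r (poly G) s = poly Q s" if "s \<notin> \<int>" for s
    proof -
      have "sym_op_adj (Suc k) r (poly G) s = sym_op_adj k k (\<lambda>t. poly G (t - 1) / (4 * (t - 1)) - poly G (t + 1) / (4 * (t + 1))) s"
        using False by (simp add: sym_op_adj_Suc)
      also have "\<dots> = sym_op_adj k k (poly ?G) s"
      proof (rule sym_op_adj_cong[OF that])
        fix t :: real assume t: "t \<notin> \<int>"
        then have "t - 1 \<notin> \<int>" "t + 1 \<notin> \<int>" by (simp_all add: Ints_shift)
        then have nz: "t - 1 \<noteq> 0" "t + 1 \<noteq> 0" using Ints_0 by metis+
        show "poly G (t - 1) / (4 * (t - 1)) - poly G (t + 1) / (4 * (t + 1)) = poly ?G t"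
          unfolding nz[THEN GK'] by (simp add: diff_divide_distrib)
      qed
      finally show ?thesis using Q that by simp
    qed
    with Q show ?thesis by blast
  qed
qed

section \<open>The numerator of \<open>\<Omega>\<^sub>1\<close>\<close>

text \<open>The element of \<open>J\<close> in position \<open>j\<close>, counted from 0, is at
  least \<open>j\<close>.\<close>

lemma prod_chain_dvd:
  fixes D :: "nat \<Rightarrow> 'a::comm_semiring_1"
  assumes "finite J" and D: "\<And>i j. i \<le> j \<Longrightarrow> D i dvd D j"
  shows "(\<Prod>j<card J. D j) dvd (\<Prod>j\<in>J. D j)"
  using assms(1)
proof (induction J rule: finite_linorder_max_induct)
  case (insert x A)
  have "card A \<le> x"
  proof -
    have "A \<subseteq> {..<x}" using insert by auto
    then show ?thesis using card_mono[of "{..<x}" A] by simp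
  qed
  moreover have "x \<notin> A" using insert by auto
  ultimately show ?case using insert by (simp add: mult_dvd_mono D mult.commute)
qed simp

text \<open>A kernel vector holds the coefficients, in the basis of falling factorials, of a
  polynomial of degree below \<open>n\<close> with the \<open>n\<close> distinct zeros
  \<open>\<alpha> h\<close>.\<close>

lemma falling_mat_det_nonzero:
  fixes \<alpha> c :: "nat \<Rightarrow> real"
  assumes inj: "inj_on \<alpha> {..<n}" and c: "\<And>h. h < n \<Longrightarrow> c h \<noteq> 0"
  shows "det (mat n n (\<lambda>(h, r). 2 ^ (n - 1 - r) * (\<Prod>i<r. \<alpha> h - real i) * c h)) \<noteq> 0"
    (is "det ?M \<noteq> 0")
proof
  assume "det ?M = 0"
  then obtain v where v: "v \<in> carrier_vec n" "v \<noteq> 0\<^sub>v n" "?M *\<^sub>v v = 0\<^sub>v n"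
    using det_0_iff_vec_prod_zero[of ?M n] by auto
  define P where "P = (\<Sum>r<n. smult (v $ r * 2 ^ (n - 1 - r)) (\<Prod>i<r. [:- real i, 1:]))"
  have evP: "poly P x = (\<Sum>r<n. v $ r * 2 ^ (n - 1 - r) * (\<Prod>i<r. x - real i))" for x
    by (simp add: P_def poly_sum poly_prod)
  have root: "poly P (\<alpha> h) = 0" if h: "h < n" for h
  proof -
    have "0 = (?M *\<^sub>v v) $ h" using v h by simp
    also have "\<dots> = (\<Sum>r<n. 2 ^ (n - 1 - r) * (\<Prod>i<r. \<alpha> h - real i) * c h * v $ r)"
      using h v(1) by (simp add: scalar_prod_def atLeast0LessThan)
    also have "\<dots> = c h * poly P (\<alpha> h)"
      by (simp add: evP sum_distrib_left mult_ac)
    finally show ?thesis using c[OF h] by simp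
  qed
  have n0: "n > 0" using v by (cases n) auto
  have "P = 0"
  proof (rule ccontr)
    assume P0: "P \<noteq> 0"
    have "degree P \<le> n - 1" unfolding P_def
      by (rule degree_sum_le) (auto intro!: order_trans[OF degree_smult_le] order_trans[OF degree_prod_sum_le])
    moreover have "n \<le> card {x. poly P x = 0}"
    proof -
      have "\<alpha> ` {..<n} \<subseteq> {x. poly P x = 0}" using root by auto
      then have "card (\<alpha> ` {..<n}) \<le> card {x. poly P x = 0}" by (intro card_mono poly_roots_finite P0)
      then show ?thesis by (simp add: card_image inj)
    qed
    ultimately show False using card_poly_roots_bound[OF P0] n0 by linarith
  qed
  \<comment> \<open>At the integer \<open>r\<close> the falling factorials of length above
    \<open>r\<close> vanish, and the shorter ones have zero coefficients by induction.\<close>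
  have "v $ r = 0" if "r < n" for r using that
  proof (induction r rule: less_induct)
    case (less r)
    have "0 = poly P (real r)" using \<open>P = 0\<close> by simp
    also have "\<dots> = (\<Sum>s\<in>{r}. v $ s * 2 ^ (n - 1 - s) * (\<Prod>i<s. real r - real i))"
      unfolding evP
    proof (rule sum.mono_neutral_right)
      show "\<forall>s\<in>{..<n} - {r}. v $ s * 2 ^ (n - 1 - s) * (\<Prod>i<s. real r - real i) = 0"
      proof
        fix s assume "s \<in> {..<n} - {r}"
        then consider "s < r" | "r < s" by force
        then show "v $ s * 2 ^ (n - 1 - s) * (\<Prod>i<s. real r - real i) = 0"
          using less by cases auto
      qed
    qed (use less in auto)
    finally have "v $ r * (\<Prod>i<r. real r - real i) = 0" by simp
    moreover have "(\<Prod>i<r. real r - real i) \<noteq> 0" by auto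
    ultimately show ?case by simp
  qed
  then have "v = 0\<^sub>v n" using v(1) by (intro eq_vecI) auto
  with v show False by simp
qed

text \<open>Induction on the last node: as a polynomial in that node the determinant has degree at
  most \<open>n\<close>, known zeros and the smaller determinant as leading coefficient. Distinct
  nodes allow the zeros to be counted.\<close>

lemma det_vandermonde:
  fixes x :: "nat \<Rightarrow> 'a::field"
  assumes "inj_on x {..<n}"
  shows "det (mat n n (\<lambda>(k, l). x l ^ k)) = (\<Prod>j<n. \<Prod>i<j. x j - x i)"
  using assms
proof (induction n)
  case 0
  then show ?case by simp
next
  case (Suc n)
  define V where "V = (\<Prod>j<n. \<Prod>i<j. x j - x i)"
  have inj: "inj_on x {..<n}" using Suc.prems by (rule inj_on_subset) auto
  have IH: "det (mat n n (\<lambda>(k, l). x l ^ k)) = V" using Suc.IH[OF inj] by (simp add: V_def)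
  define M where "M y = mat (Suc n) (Suc n) (\<lambda>(k, l). (if l < n then x l else y) ^ k)" for y
  define cc where "cc k = cofactor (M 0) k n" for k
  have md: "mat_delete (M y) k n = mat_delete (M 0) k n" if "k < Suc n" for y k
    by (rule eq_matI) (simp_all add: M_def mat_delete_def)
  have cof: "cofactor (M y) k n = cc k" if "k < Suc n" for y k
    unfolding cc_def cofactor_def using md[OF that, of y] by (simp only:)
  have Mn: "M y $$ (k, n) = y ^ k" if "k < Suc n" for y k using that by (simp add: M_def)
  define P where "P = (\<Sum>k<Suc n. monom (cc k) k)"
  have detM: "det (M y) = poly P y" for y
  proof -
    have "det (M y) = (\<Sum>k<Suc n. M y $$ (k, n) * cofactor (M y) k n)"
      by (rule laplace_expansion_column) (auto simp: M_def)
    also have "\<dots> = poly P y"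
      unfolding P_def poly_sum by (intro sum.cong) (auto simp: Mn cof poly_monom simp del: sum.lessThan_Suc)
    finally show ?thesis .
  qed
  have ccn: "cc n = V"
  proof -
    have "mat_delete (M 0) n n = mat n n (\<lambda>(k, l). x l ^ k)"
      by (intro eq_matI) (auto simp: M_def mat_delete_def)
    then show ?thesis by (simp add: cc_def cofactor_def IH)
  qed
  define Q where "Q = smult V (\<Prod>i<n. [:- x i, 1:])"
  have root: "poly P (x i) = 0" if "i < n" for i
  proof -
    have "det (M (x i)) = 0"
      by (rule det_identical_columns[of _ "Suc n" i n]) (use that in \<open>auto simp: M_def intro!: eq_vecI\<close>)
    then show ?thesis by (simp add: detM)
  qed
  have degprod: "degree (\<Prod>i<n. [:- x i, 1:]) = n" 
    by (subst degree_prod_eq_sum_degree) auto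
  have lcprod: "coeff (\<Prod>i<n. [:- x i, 1:]) n = 1"
    using lead_coeff_prod[of "\<lambda>i. [:- x i, 1:]" "{..<n}"] degprod by simp
  have cPn: "coeff P n = V" 
    by (simp add: P_def coeff_sum ccn)
  have dP: "degree P \<le> n" unfolding P_def
    by (rule degree_sum_le) (auto intro!: order_trans[OF degree_monom_le])
  have dQ: "degree Q \<le> n" using degprod by (auto simp: Q_def)
  have "P = Q"
  proof (rule ccontr)
    assume "P \<noteq> Q"
    then have PQ: "P - Q \<noteq> 0" by simp
    have "degree (P - Q) \<le> n" by (intro degree_diff_le dP dQ)
    moreover have "coeff (P - Q) n = 0" by (simp add: cPn Q_def lcprod)
    ultimately have "degree (P - Q) < n" using PQ
      by (metis le_neq_implies_less leading_coeff_0_iff)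
    moreover have "x ` {..<n} \<subseteq> {y. poly (P - Q) y = 0}" using root
      by (auto simp: Q_def poly_prod)
    then have "n \<le> card {y. poly (P - Q) y = 0}"
      using card_mono[OF poly_roots_finite[OF PQ], of "x ` {..<n}"] by (simp add: card_image inj)
    ultimately show False using card_poly_roots_bound[OF PQ] by linarith
  qed
  then have "det (M (x n)) = V * (\<Prod>i<n. x n - x i)"
    by (simp add: detM Q_def poly_prod)
  moreover have "M (x n) = mat (Suc n) (Suc n) (\<lambda>(k, l). x l ^ k)"
    by (intro eq_matI) (auto simp: M_def less_Suc_eq)
  ultimately show ?case by (simp add: V_def)
qed

text \<open>The denominators \<open>q\<close> (here) and \<open>p\<close> (\<open>ph\<close> below) as polynomials in \<open>t\<close>, up to constants.\<close>
definition qh :: "nat \<Rightarrow> real poly" where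
  "qh n = (\<Prod>i = 1..n div 2. \<Prod>j = 1..2 * n - 4 * i + 1. [:- real n - 1 + 2 * real i + real j, 1:])"

text \<open>Passing from \<open>n\<close> to \<open>n + 2\<close> nodes adds the pairs that involve
  the first or the last node. Their factors are t - n, ..., t + n, which is the factor
  \<open>i = 1\<close> of \<open>qh (n + 2)\<close>.\<close>

lemma prod_pairs_eq_qh:
  "(\<Prod>j<n. \<Prod>i<j. t + real n - 1 - real i - real j) = poly (qh n) t"
proof (induction n rule: induct_nat_012)
  case 0
  then show ?case by (simp add: qh_def)
next
  case 1
  then show ?case by (simp add: qh_def)
next
  case (ge2 n)
  have L: "(\<Prod>j<Suc (Suc n). \<Prod>i<j. t + real (Suc (Suc n)) - 1 - real i - real j)
      = (\<Prod>j<n. \<Prod>i<j. t + real n - 1 - real i - real j) * 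
        ((\<Prod>j\<le>n. t + real n - real j) * (\<Prod>i<n. t - 1 - real i))"
  proof -
    have "(\<Prod>j<Suc (Suc n). \<Prod>i<j. t + real (Suc (Suc n)) - 1 - real i - real j)
      = (\<Prod>j<Suc n. \<Prod>i<Suc j. t + real (Suc (Suc n)) - 1 - real i - real (Suc j))"
      by (subst prod.lessThan_Suc_shift) simp
    also have "\<dots> = (\<Prod>j<Suc n. (t + real n - real j) * (\<Prod>i<j. t + real n - 1 - real i - real j))"
      by (subst prod.lessThan_Suc_shift) (simp add: algebra_simps)
    also have "\<dots> = (\<Prod>j\<le>n. t + real n - real j) * (\<Prod>j<Suc n. \<Prod>i<j. t + real n - 1 - real i - real j)"
      by (simp only: prod.distrib lessThan_Suc_atMost)
    also have "(\<Prod>j<Suc n. \<Prod>i<j. t + real n - 1 - real i - real j)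
       = (\<Prod>j<n. \<Prod>i<j. t + real n - 1 - real i - real j) * (\<Prod>i<n. t - 1 - real i)"
      by (simp add: algebra_simps)
    finally show ?thesis by (simp add: mult_ac)
  qed
  have "(\<Prod>j = 1..2 * n + 1. t - real n - 1 + real j) = (\<Prod>k\<in>{- int n..int n}. t + of_int k)"
    by (rule prod.reindex_bij_witness[of _ "\<lambda>k. nat (k + int n + 1)" "\<lambda>j. int j - int n - 1"]) auto
  also have "\<dots> = (\<Prod>k\<in>{0..int n}. t + of_int k) * (\<Prod>k\<in>{- int n..-1}. t + of_int k)"
    by (subst prod.union_disjoint[symmetric]) (auto intro!: prod.cong)
  also have "(\<Prod>k\<in>{0..int n}. t + of_int k) = (\<Prod>j\<le>n. t + real n - real j)"
    by (rule prod.reindex_bij_witness[of _ "\<lambda>j. int n - int j" "\<lambda>k. nat (int n - k)"]) auto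
  also have "(\<Prod>k\<in>{- int n..-1}. t + of_int k) = (\<Prod>i<n. t - 1 - real i)"
    by (rule prod.reindex_bij_witness[of _ "\<lambda>i. - 1 - int i" "\<lambda>k. nat (- 1 - k)"]) auto
  finally have mid: "(\<Prod>j = 1..2 * n + 1. t - real n - 1 + real j) = (\<Prod>j\<le>n. t + real n - real j) * (\<Prod>i<n. t - 1 - real i)" .
  define G where "G n i = (\<Prod>j = 1..2 * n - 4 * i + 1. t + (- real n - 1 + 2 * real i + real j))" for n i
  have qh_G: "poly (qh k) t = (\<Prod>i = 1..k div 2. G k i)" for k
    by (simp add: qh_def poly_prod G_def add_ac del: prod.cl_ivl_Suc)
  have "poly (qh (Suc (Suc n))) t = (\<Prod>i = Suc 0..Suc (n div 2). G (Suc (Suc n)) i)"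
    by (simp add: qh_G del: prod.cl_ivl_Suc)
  also have "\<dots> = (\<Prod>i = 0..n div 2. G (Suc (Suc n)) (Suc i))"
    by (rule prod.atLeast_Suc_atMost_Suc_shift[unfolded o_def])
  also have "\<dots> = (\<Prod>i = 0..n div 2. G n i)"
  proof -
    have "2 * Suc (Suc n) - 4 * Suc i + 1 = 2 * n - 4 * i + 1"
      "- real (Suc (Suc n)) - 1 + 2 * real (Suc i) + real j = - real n - 1 + 2 * real i + real j" for i j
      by auto
    then show ?thesis unfolding G_def by (simp only:)
  qed
  also have "\<dots> = G n 0 * poly (qh n) t"
    unfolding qh_G by (simp add: prod.atLeast_Suc_atMost del: prod.cl_ivl_Suc)
  also have "G n 0 = (\<Prod>j = 1..2 * n + 1. t - real n - 1 + real j)"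
    by (simp add: G_def algebra_simps del: prod.cl_ivl_Suc)
  finally show ?case using L mid ge2.IH(1) by (simp add: mult_ac)
qed

lemma poly_eq_nonint:
  fixes p q :: "real poly"
  assumes "\<And>t. t \<notin> \<int> \<Longrightarrow> poly p t = poly q t"
  shows "p = q"
proof (rule ccontr)
  assume "p \<noteq> q"
  then have "finite {x. poly (p - q) x = 0}" by (intro poly_roots_finite) auto
  moreover have "{0<..<1} \<subseteq> {x. poly (p - q) x = 0}"
  proof
    fix x :: real assume "x \<in> {0<..<1}"
    then have "x \<notin> \<int>" by (auto elim!: Ints_cases)
    then show "x \<in> {x. poly (p - q) x = 0}" using assms by simp
  qed
  ultimately have "finite {0<..<1::real}" by (rule rev_finite_subset)
  then show False by (simp add: infinite_Ioo)
qed

lemma poly_det: "poly (det A) t = det (map_mat (\<lambda>p. poly p t) A)" for A :: "'a::comm_ring_1 poly mat"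
proof -
  interpret comm_ring_hom "\<lambda>p. poly p t" by unfold_locales auto
  show ?thesis by simp
qed

text \<open>Closed form of the product of the factors \<open>qw (b + i)\<close> collected on the way
  to the node t + k - 2 l; see \<open>weight_wtp\<close>.\<close>

definition wtp :: "real \<Rightarrow> nat \<Rightarrow> nat \<Rightarrow> real poly" where
  "wtp b k l = (\<Prod>i<2 * l. [:b + real k - real i, 1:]) * (\<Prod>i<2 * (k - l). [:- b - real k + real i, 1:])"

lemma weight_wtp: "weight (\<lambda>l. qw (b + real l)) (\<lambda>k l. poly (wtp b k l))"
proof
  fix k l :: nat and t :: real
  show "poly (wtp b 0 0) t = 1" by (simp add: wtp_def)
  assume l: "l \<le> k"
  have e: "2 * (Suc k - l) = Suc (Suc (2 * (k - l)))" using l by simp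
  show "poly (wtp b (Suc k) l) t = poly (qw (b + real k)) t * poly (wtp b k l) (t + 1)"
    by (simp add: wtp_def poly_prod e poly_qw prod.lessThan_Suc_shift del: prod.lessThan_Suc)
       (simp add: algebra_simps)
  show "poly (wtp b (Suc k) (Suc l)) t = poly (qw (b + real k)) (- t) * poly (wtp b k l) (t - 1)"
    by (simp add: wtp_def poly_prod poly_qw prod.lessThan_Suc_shift del: prod.lessThan_Suc)
       (simp add: algebra_simps)
qed

lemma weight_1: "weight (\<lambda>_. 1) (\<lambda>_ _ _. 1)"
  by unfold_locales auto

definition rw :: "real \<Rightarrow> nat \<Rightarrow> nat \<Rightarrow> nat \<Rightarrow> nat \<Rightarrow> real poly" where
  "rw b n m1 h l = (if h < m1 then wtp b (n - 1) l else 1)"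

definition Emat :: "real \<Rightarrow> nat \<Rightarrow> nat \<Rightarrow> (nat \<Rightarrow> real poly) \<Rightarrow> real poly mat" where
  "Emat b n m1 f = mat n n (\<lambda>(h, l). rw b n m1 h l * sh (real n - 1 - 2 * real l) (f h))"

definition Bmat :: "real \<Rightarrow> nat \<Rightarrow> nat \<Rightarrow> (nat \<Rightarrow> real poly) \<Rightarrow> real poly mat" where
  "Bmat b n m1 f = mat n n (\<lambda>(h, r). sym_op (if h < m1 then (\<lambda>l. qw (b + real l)) else (\<lambda>_. 1)) (n - 1) r (f h))"

lemma Emat_carrier [simp]: "Emat b n m1 f \<in> carrier_mat n n" by (simp add: Emat_def)
lemma Bmat_carrier [simp]: "Bmat b n m1 f \<in> carrier_mat n n" by (simp add: Bmat_def)

lemma poly_sym_op_rw: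
  assumes "evenp f" "t \<notin> \<int>" "n > 0"
  shows "poly (sym_op (if h < m1 then (\<lambda>l. qw (b + real l)) else (\<lambda>_. 1)) (n - 1) r f) t
    = (\<Sum>l<n. sym_op_coeff (n - 1) r l t * (poly (rw b n m1 h l) t * poly f (t + (real n - 1 - 2 * real l))))"
proof -
  obtain k where n: "n = Suc k" using assms(3) by (cases n) auto
  show ?thesis
    using weight.poly_sym_op[OF weight_wtp assms(1,2), of b k r] weight.poly_sym_op[OF weight_1 assms(1,2), of k r]
    by (auto simp: n rw_def lessThan_Suc_atMost algebra_simps simp del: sum.lessThan_Suc)
qed

text \<open>Since the weights sit in the entries of \<open>Emat\<close>, one and the same matrix of
  \<open>sym_op_coeff\<close> transforms both kinds of rows.\<close>

lemma det_Bmat_Emat: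
  assumes f: "\<And>h. h < n \<Longrightarrow> evenp (f h)" and t: "t \<notin> \<int>"
  shows "poly (det (Bmat b n m1 f)) t = poly (det (Emat b n m1 f)) t * det (mat n n (\<lambda>(l, r). sym_op_coeff (n - 1) r l t))"
proof -
  have "map_mat (\<lambda>p. poly p t) (Bmat b n m1 f) = map_mat (\<lambda>p. poly p t) (Emat b n m1 f) * mat n n (\<lambda>(l, r). sym_op_coeff (n - 1) r l t)"
    (is "?L = ?R")
  proof (rule eq_matI)
    fix h r assume "h < dim_row ?R" "r < dim_col ?R"
    then have hr: "h < n" "r < n" by (simp_all add: Emat_def)
    then have "?L $$ (h, r) = poly (sym_op (if h < m1 then (\<lambda>l. qw (b + real l)) else (\<lambda>_. 1)) (n - 1) r (f h)) t"
      by (simp add: Bmat_def)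
    also have "\<dots> = (\<Sum>l<n. sym_op_coeff (n - 1) r l t * (poly (rw b n m1 h l) t * poly (f h) (t + (real n - 1 - 2 * real l))))"
      by (rule poly_sym_op_rw) (use hr f t in auto)
    also have "\<dots> = ?R $$ (h, r)"
      using hr by (simp add: Emat_def scalar_prod_def atLeast0LessThan mult_ac)
    finally show "?L $$ (h, r) = ?R $$ (h, r)" .
  qed (simp_all add: Bmat_def Emat_def)
  then show ?thesis
    unfolding poly_det by (simp add: det_mult[of _ n])
qed

text \<open>Degrees split into a row part \<open>2 * e h\<close>, increased by
  \<open>2 * (n - 1)\<close> in weighted rows, and a column part \<open>- 2 * r\<close>, as
  \<open>lead_det\<close> requires.\<close>

lemma lead_Bmat:
  assumes f: "\<And>h. h < n \<Longrightarrow> lead (f h) (2 * e h) (c h)" "\<And>h. h < n \<Longrightarrow> evenp (f h)"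
    and "m1 \<le> n"
  shows "lead (det (Bmat b n m1 f)) (2 * (\<Sum>h<n. e h) + 2 * int m1 * (int n - 1) - int n * (int n - 1))
      (det (mat n n (\<lambda>(h, r). 2 ^ (n - 1 - r) * (\<Prod>i<r. (of_int (e h) - (if h < m1 then b + 1/2 else 0)) - real i) * c h)))"
proof -
  let ?e = "\<lambda>h. 2 * e h + (if h < m1 then 2 * int (n - 1) else 0)"
  have *: "lead (det (Bmat b n m1 f)) ((\<Sum>h<n. ?e h) + (\<Sum>r<n. - 2 * int r))
      (det (mat n n (\<lambda>(h, r). 2 ^ (n - 1 - r) * (\<Prod>i<r. (of_int (e h) - (if h < m1 then b + 1/2 else 0)) - real i) * c h)))"
  proof (rule lead_det[OF Bmat_carrier])
    fix h r assume hr: "h < n" "r < n"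
    then have r: "r \<le> n - 1" by simp
    show "lead (Bmat b n m1 f $$ (h, r)) (?e h + - 2 * int r)
        (2 ^ (n - 1 - r) * (\<Prod>i<r. (of_int (e h) - (if h < m1 then b + 1/2 else 0)) - real i) * c h)"
      using lead_sym_op_1[OF f(1)[OF hr(1)] f(2)[OF hr(1)] r] lead_sym_op_qw[OF f(1)[OF hr(1)] f(2)[OF hr(1)] r, of b] hr
      by (cases "h < m1") (simp_all add: Bmat_def algebra_simps)
  qed
  have 1: "(\<Sum>r<n. - 2 * int r) = - int n * (int n - 1)"
    by (induction n) (auto simp: algebra_simps)
  have 2: "(\<Sum>h<n. ?e h) = 2 * (\<Sum>h<n. e h) + 2 * int m1 * (int n - 1)"
  proof -
    have "(\<Sum>h<n. if h < m1 then 2 * int (n - 1) else 0) = (\<Sum>h<m1. 2 * int (n - 1))"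
      using \<open>m1 \<le> n\<close> by (intro sum.mono_neutral_cong_right) auto
    \<comment> \<open>The truncated difference \<open>n - 1\<close> is wrong only for
      \<open>n = 0\<close>, where there are no weighted rows.\<close>
    moreover have "m1 = 0 \<or> int (n - 1) = int n - 1" using \<open>m1 \<le> n\<close> by auto
    ultimately show ?thesis by (auto simp: sum.distrib sum_distrib_left)
  qed
  have 3: "(\<Sum>h<n. ?e h) + (\<Sum>r<n. - 2 * int r) = 2 * (\<Sum>h<n. e h) + 2 * int m1 * (int n - 1) - int n * (int n - 1)"
    unfolding 1 2 by simp
  show ?thesis using * unfolding 3 .
qed

lemma inj_on_nodes:
  assumes t: "t \<notin> \<int>"
  shows "inj_on (\<lambda>l. (t + (real n - 1 - 2 * real l))\<^sup>2) {..<n}" (is "inj_on ?x _")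
proof (rule inj_onI)
  fix i j assume "?x i = ?x j"
  then have "(t + (real n - 1 - 2 * real i)) = (t + (real n - 1 - 2 * real j)) \<or> t = real i + real j + 1 - real n"
    by (auto simp: power2_eq_iff)
  moreover have "t \<noteq> real i + real j + 1 - real n"
  proof
    assume "t = real i + real j + 1 - real n"
    then have "t = of_int (int i + int j + 1 - int n)" by simp
    with t show False using Ints_of_int by metis
  qed
  ultimately show "i = j" by auto
qed

text \<open>Comparing with the rows \<open>1, t\<^sup>2, t\<^sup>4, \<dots>\<close> gives the determinant of the transition matrix.\<close>
lemma det_Emat_eq_qh_det_Bmat:
  "\<exists>\<kappa>. \<kappa> \<noteq> 0 \<and> (\<forall>b m1 f. (\<forall>h<n. evenp (f h)) \<longrightarrow> det (Emat b n m1 f) = smult \<kappa> (qh n * det (Bmat b n m1 f)))"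
proof -
  let ?f = "\<lambda>h. monom 1 (2 * h) :: real poly"
  define K where "K = det (mat n n (\<lambda>(h, r). 2 ^ (n - 1 - r) * (\<Prod>i<r. real h - real i) * (1::real)))"
  have ev: "evenp (?f h)" for h by (auto simp: evenp_def)
  have K0: "K \<noteq> 0" unfolding K_def by (rule falling_mat_det_nonzero) auto
  \<comment> \<open>Without weighted rows and with row degrees 0, 2, 4, ... the total degree is 0,
    so this determinant is a constant, and it is nonzero. The transition determinant is therefore a
    constant over \<open>qh n\<close>.\<close>
  have "lead (det (Bmat 0 n 0 ?f)) (2 * (\<Sum>h<n. int h) + 2 * int 0 * (int n - 1) - int n * (int n - 1))
      (det (mat n n (\<lambda>(h, r). 2 ^ (n - 1 - r) * (\<Prod>i<r. (of_int (int h) - (if h < 0 then 0 + 1/2 else 0)) - real i) * 1)))"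
    by (rule lead_Bmat) (use lead_monom[of 1 "2 * _"] ev in auto)
  moreover have "2 * (\<Sum>h<n. int h) = int n * (int n - 1)"
    by (induction n) (auto simp: algebra_simps)
  ultimately have "lead (det (Bmat 0 n 0 ?f)) 0 K" by (simp add: K_def)
  then have detK: "det (Bmat 0 n 0 ?f) = [:K:]"
    using lead_nat[of _ 0 K] by (auto elim!: degree_eq_zeroE)
  define C where "C = (\<Prod>j<n. \<Prod>i<j. 4 * (real i - real j))"
  have C0: "C \<noteq> 0" by (auto simp: C_def)
  have van: "poly (det (Emat 0 n 0 ?f)) t = C * poly (qh n) t" if t: "t \<notin> \<int>" for t
  proof -
    let ?x = "\<lambda>l. (t + (real n - 1 - 2 * real l))\<^sup>2"
    from det_vandermonde[OF inj_on_nodes[OF t]]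
    have "det (mat n n (\<lambda>(k, l). ?x l ^ k)) = (\<Prod>j<n. \<Prod>i<j. ?x j - ?x i)" .
    also have "\<dots> = (\<Prod>j<n. \<Prod>i<j. 4 * (real i - real j) * (t + real n - 1 - real i - real j))"
      by (intro prod.cong refl) (simp add: power2_eq_square algebra_simps)
    also have "\<dots> = C * poly (qh n) t"
      by (simp add: prod.distrib C_def prod_pairs_eq_qh)
    also have "mat n n (\<lambda>(k, l). ?x l ^ k) = map_mat (\<lambda>p. poly p t) (Emat 0 n 0 ?f)"
      by (intro eq_matI) (auto simp: Emat_def rw_def poly_monom power_mult)
    finally show ?thesis by (simp add: poly_det)
  qed
  show ?thesis
  proof (intro exI[of _ "C / K"] conjI allI impI)
    show "C / K \<noteq> 0" using C0 K0 by simp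
    fix b m1 f assume f: "\<forall>h<n. evenp (f h :: real poly)"
    show "det (Emat b n m1 f) = smult (C / K) (qh n * det (Bmat b n m1 f))"
    proof (rule poly_eq_nonint)
      fix t :: real assume t: "t \<notin> \<int>"
      let ?d = "det (mat n n (\<lambda>(l, r). sym_op_coeff (n - 1) r l t))"
      have 1: "K = C * poly (qh n) t * ?d"
        using det_Bmat_Emat[of n ?f t 0 0] ev t van[OF t] by (simp add: detK)
      have 2: "poly (det (Bmat b n m1 f)) t = poly (det (Emat b n m1 f)) t * ?d"
        using det_Bmat_Emat[of n f t b m1] f t by simp
      have "K * poly (det (Emat b n m1 f)) t = C * poly (qh n) t * poly (det (Bmat b n m1 f)) t"
        unfolding 2 by (subst 1) (simp add: mult_ac)
      then show "poly (det (Emat b n m1 f)) t = poly (smult (C / K) (qh n * det (Bmat b n m1 f))) t"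
        using K0 by (simp add: field_simps)
    qed
  qed
qed

section \<open>Divisibility by the denominators\<close>

definition lin1 :: "real \<Rightarrow> nat \<Rightarrow> nat \<Rightarrow> real poly" where
  "lin1 b k j = (\<Prod>i<2 * j. [:b + real k - real i, 1:])"

definition lin2 :: "real \<Rightarrow> nat \<Rightarrow> nat \<Rightarrow> real poly" where
  "lin2 b k j = (\<Prod>i<2 * j. [:- b - real k + real i, 1:])"

lemma wtp_lin: "wtp b k l = lin1 b k l * lin2 b k (k - l)"
  by (simp add: wtp_def lin1_def lin2_def)

definition ph :: "real \<Rightarrow> nat \<Rightarrow> nat \<Rightarrow> real poly" where
  "ph b k q = (\<Prod>j<q. lin1 b k j) * (\<Prod>j<q. lin2 b k j)"

lemma lin_chain: "i \<le> j \<Longrightarrow> lin1 b k i dvd lin1 b k j" "i \<le> j \<Longrightarrow> lin2 b k i dvd lin2 b k j"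
  unfolding lin1_def lin2_def by (rule prod_dvd_prod_subset; auto)+

text \<open>Every term of the Leibniz expansion of \<open>det (Emat b n m1 f)\<close> is divisible by \<open>ph b (n - 1) m1\<close>.\<close>
lemma ph_dvd_det_Emat:
  assumes "m1 \<le> n"
  shows "ph b (n - 1) m1 dvd det (Emat b n m1 f)"
  unfolding det_def'[OF Emat_carrier]
proof (rule dvd_sum)
  fix p assume "p \<in> {p. p permutes {0..<n}}"
  then have p: "p permutes {0..<n}" by simp
  have inj: "inj_on p {..<m1}" using permutes_inj_on[OF p] .
  have pn: "p h < n" if "h < n" for h using permutes_in_image[OF p, of h] that by simp
  \<comment> \<open>The chain \<open>lin2\<close> is indexed by the complement
    \<open>n - 1 - p h\<close>, which also takes \<open>m1\<close> distinct values.\<close>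
  have inj': "inj_on (\<lambda>h. n - 1 - p h) {..<m1}"
  proof (rule inj_onI)
    fix h h' assume *: "h \<in> {..<m1}" "h' \<in> {..<m1}" "n - 1 - p h = n - 1 - p h'"
    then have "p h = p h'" using pn[of h] pn[of h'] assms by auto
    then show "h = h'" using inj * by (auto dest: inj_onD)
  qed
  have "ph b (n - 1) m1 dvd (\<Prod>j\<in>p ` {..<m1}. lin1 b (n - 1) j) * (\<Prod>j\<in>(\<lambda>h. n - 1 - p h) ` {..<m1}. lin2 b (n - 1) j)"
    unfolding ph_def
    by (intro mult_dvd_mono
        prod_chain_dvd[of "p ` {..<m1}" "lin1 b (n - 1)", unfolded card_image[OF inj] card_lessThan]
        prod_chain_dvd[of "(\<lambda>h. n - 1 - p h) ` {..<m1}" "lin2 b (n - 1)", unfolded card_image[OF inj'] card_lessThan])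
       (auto intro: lin_chain)
  also have "\<dots> = (\<Prod>h<m1. wtp b (n - 1) (p h))"
    unfolding prod.reindex[OF inj] prod.reindex[OF inj'] o_def by (simp add: wtp_lin prod.distrib)
  also have "\<dots> dvd (\<Prod>h<m1. Emat b n m1 f $$ (h, p h))"
    using assms pn by (intro prod_dvd_prod) (auto simp: Emat_def rw_def)
  also have "\<dots> dvd (\<Prod>h = 0..<n. Emat b n m1 f $$ (h, p h))"
    using assms by (intro prod_dvd_prod_subset) auto
  finally show "ph b (n - 1) m1 dvd signof p * (\<Prod>i = 0..<n. Emat b n m1 f $$ (i, p i))"
    by (rule dvd_mult)
qed

lemma dvd_linear_cancel:
  fixes c :: real
  assumes "p dvd [:c, 1:] * q" "poly p (- c) \<noteq> 0"
  shows "p dvd q"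
proof -
  obtain r where r: "[:c, 1:] * q = p * r" using assms(1) by (auto elim: dvdE)
  have "poly ([:c, 1:] * q) (- c) = 0" by simp
  then have "poly r (- c) = 0" using assms(2) unfolding r by simp
  then have "[:c, 1:] dvd r" by (simp add: poly_eq_0_iff_dvd)
  then obtain s where "r = [:c, 1:] * s" by (auto elim: dvdE)
  with r have "[:c, 1:] * q = [:c, 1:] * (p * s)" by (simp only: mult_ac)
  then have "q = p * s" by (subst (asm) mult_left_cancel) auto
  then show ?thesis by simp
qed

lemma dvd_prod_cancel:
  fixes p :: "'a::comm_semiring_1"
  assumes "\<And>i B. i \<in> I \<Longrightarrow> p dvd g i * B \<Longrightarrow> p dvd B" "p dvd (\<Prod>i\<in>I. g i) * B"
  shows "p dvd B"
  using assms by (induction I arbitrary: B rule: infinite_finite_induct) (auto simp: mult.assoc)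

text \<open>The zeros of \<open>ph\<close> differ from \<open>b\<close> or \<open>- b\<close> by
  integers, those of \<open>qh\<close> are integers.\<close>

lemma ph_dvd_qh_cancel:
  assumes b: "b \<notin> \<int>" and "ph b k q dvd qh n * B"
  shows "ph b k q dvd B"
proof -
  have 1: "b + real k - real i \<noteq> - real n - 1 + 2 * real i' + real j'" for i i' j'
  proof
    assume "b + real k - real i = - real n - 1 + 2 * real i' + real j'"
    then have "b = of_int (- int n - 1 + 2 * int i' + int j' - int k + int i)" by simp
    with b show False using Ints_of_int by metis
  qed
  have 2: "- b - real k + real i \<noteq> - real n - 1 + 2 * real i' + real j'" for i i' j'
  proof
    assume "- b - real k + real i = - real n - 1 + 2 * real i' + real j'"
    then have "b = of_int (int n + 1 - 2 * int i' - int j' - int k + int i)" by simp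
    with b show False using Ints_of_int by metis
  qed
  have k1: "b + real k - real i + (1 + real n - 2 * real i' - real j') \<noteq> 0" for i i' j' using 1[of i i' j'] by linarith
  have k2: "- b - real k + real i + (1 + real n - 2 * real i' - real j') \<noteq> 0" for i i' j' using 2[of i i' j'] by linarith
  have nz: "poly (ph b k q) (- (- real n - 1 + 2 * real i' + real j')) \<noteq> 0" for i' j'
    using k1 k2 by (auto simp: ph_def lin1_def lin2_def poly_prod)
  show ?thesis using assms(2) unfolding qh_def
    by (elim dvd_prod_cancel[rotated]) (rule dvd_linear_cancel[OF _ nz])
qed

section \<open>Polynomial dependence on the parameter \<open>b\<close>\<close>

definition eval_coeffs :: "real \<Rightarrow> real poly poly \<Rightarrow> real poly" where
  "eval_coeffs b X = map_poly (\<lambda>c. poly c b) X"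

lemma coeff_eval_coeffs [simp]: "coeff (eval_coeffs b X) i = poly (coeff X i) b"
  by (simp add: eval_coeffs_def coeff_map_poly)

lemma eval_coeffs_add: "eval_coeffs b (X + Y) = eval_coeffs b X + eval_coeffs b Y" by (simp add: poly_eq_iff)
lemma eval_coeffs_mult: "eval_coeffs b (X * Y) = eval_coeffs b X * eval_coeffs b Y" by (simp add: poly_eq_iff coeff_mult poly_sum)
lemma degree_eval_coeffs: "degree (eval_coeffs b X) \<le> degree X"
  by (rule degree_le) (auto simp: coeff_eq_0)

definition poly_family :: "(real \<Rightarrow> real poly) \<Rightarrow> bool" where
  "poly_family f \<longleftrightarrow> (\<exists>X. \<forall>b. f b = eval_coeffs b X)"

text \<open>Monic in the outer variable, which makes pseudo-division an honest division and the
  degree of \<open>f b\<close> independent of \<open>b\<close>.\<close>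

definition monic_family :: "(real \<Rightarrow> real poly) \<Rightarrow> bool" where
  "monic_family f \<longleftrightarrow> (\<exists>X. lead_coeff X = 1 \<and> (\<forall>b. f b = eval_coeffs b X))"

lemma poly_family_const [intro]: "poly_family (\<lambda>_. p)"
proof -
  have "eval_coeffs b (map_poly (\<lambda>c. [:c:]) p) = p" for b by (simp add: poly_eq_iff coeff_map_poly)
  then show ?thesis unfolding poly_family_def by metis
qed

lemma poly_family_add [intro]: "poly_family f \<Longrightarrow> poly_family g \<Longrightarrow> poly_family (\<lambda>b. f b + g b)"
  unfolding poly_family_def by (metis eval_coeffs_add)

lemma poly_family_mult [intro]: "poly_family f \<Longrightarrow> poly_family g \<Longrightarrow> poly_family (\<lambda>b. f b * g b)"
  unfolding poly_family_def by (metis eval_coeffs_mult)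

lemma poly_family_sum [intro]: "(\<And>i. i \<in> I \<Longrightarrow> poly_family (f i)) \<Longrightarrow> poly_family (\<lambda>b. \<Sum>i\<in>I. f i b)"
  by (induction I rule: infinite_finite_induct) auto

lemma poly_family_prod [intro]: "(\<And>i. i \<in> I \<Longrightarrow> poly_family (f i)) \<Longrightarrow> poly_family (\<lambda>b. \<Prod>i\<in>I. f i b)"
  by (induction I rule: infinite_finite_induct) auto

lemma monic_family_imp_poly_family: "monic_family f \<Longrightarrow> poly_family f" unfolding monic_family_def poly_family_def by blast

lemma monic_family_1: "monic_family (\<lambda>_. 1)"
  unfolding monic_family_def by (rule exI[of _ 1]) (auto simp: poly_eq_iff)

lemma monic_family_mult: "monic_family f \<Longrightarrow> monic_family g \<Longrightarrow> monic_family (\<lambda>b. f b * g b)"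
  unfolding monic_family_def by (metis eval_coeffs_mult lead_coeff_mult mult_1)

lemma monic_family_prod: "(\<And>i. i \<in> I \<Longrightarrow> monic_family (f i)) \<Longrightarrow> monic_family (\<lambda>b. \<Prod>i\<in>I. f i b)"
  by (induction I rule: infinite_finite_induct) (auto intro: monic_family_mult monic_family_1)

lemma monic_family_linear: "(\<And>b. l b = poly p b) \<Longrightarrow> monic_family (\<lambda>b. [:l b, 1:])"
  unfolding monic_family_def by (rule exI[of _ "[:p, 1:]"]) (auto simp: poly_eq_iff coeff_pCons split: nat.splits)

lemma poly_family_det:
  assumes "\<And>i j. i < n \<Longrightarrow> j < n \<Longrightarrow> poly_family (\<lambda>b. A b $$ (i, j))" "\<And>b. A b \<in> carrier_mat n n"
  shows "poly_family (\<lambda>b. det (A b))"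
  unfolding det_def'[OF assms(2)]
proof (intro poly_family_sum poly_family_mult poly_family_const poly_family_prod)
  fix p i assume "p \<in> {p. p permutes {0..<n}}" "i \<in> {0..<n}"
  then show "poly_family (\<lambda>b. A b $$ (i, p i))" using permutes_in_image[of p "{0..<n}" i] by (intro assms) auto
qed

text \<open>The remainder of the division has coefficients polynomial in \<open>b\<close>; each of
  them vanishes for infinitely many \<open>b\<close> and hence identically.\<close>

lemma poly_family_dvd_all:
  assumes f: "poly_family f" and g: "monic_family g" and inf: "infinite {b. g b dvd f b}"
  shows "g b dvd f b"
proof -
  obtain X where X: "\<And>b. f b = eval_coeffs b X" using f unfolding poly_family_def by blast
  obtain Y where Y: "lead_coeff Y = 1" "\<And>b. g b = eval_coeffs b Y" using g unfolding monic_family_def by blast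
  have Y0: "Y \<noteq> 0" using Y by auto
  obtain A R where AR: "pseudo_divmod X Y = (A, R)" by (cases "pseudo_divmod X Y")
  from pseudo_divmod[OF Y0 AR] have XA: "X = Y * A + R" and R: "R = 0 \<or> degree R < degree Y"
    by (simp_all add: Y(1))
  have fb: "f b = g b * eval_coeffs b A + eval_coeffs b R" for b by (simp add: X Y(2) XA eval_coeffs_add eval_coeffs_mult)
  have gb: "g b \<noteq> 0" "degree (g b) = degree Y" for b
  proof -
    have c: "coeff (g b) (degree Y) = 1" using Y by simp
    then show "g b \<noteq> 0" by auto
    show "degree (g b) = degree Y"
      using degree_eval_coeffs[of b Y] le_degree[of "g b" "degree Y"] c Y(2) by (intro antisym) auto
  qed
  have Rb: "eval_coeffs b R = 0" if "g b dvd f b" for b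
  proof (rule ccontr)
    assume nz: "eval_coeffs b R \<noteq> 0"
    have "R \<noteq> 0"
    proof
      assume "R = 0"
      then have "eval_coeffs b R = 0" by (simp add: eval_coeffs_def)
      with nz show False by simp
    qed
    with R have "degree (eval_coeffs b R) < degree Y" using degree_eval_coeffs[of b R] by simp
    moreover have "g b dvd eval_coeffs b R" using that unfolding fb by (simp add: dvd_add_right_iff)
    then have "degree (g b) \<le> degree (eval_coeffs b R)" using nz by (rule dvd_imp_degree_le)
    ultimately show False using gb by simp
  qed
  have "R = 0"
  proof (rule poly_eqI)
    fix i
    have "{b. g b dvd f b} \<subseteq> {b. poly (coeff R i) b = 0}"
    proof
      fix b assume "b \<in> {b. g b dvd f b}"
      then have "eval_coeffs b R = 0" using Rb by simp
      then show "b \<in> {b. poly (coeff R i) b = 0}" by (metis coeff_eval_coeffs coeff_0 mem_Collect_eq)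
    qed
    then have "infinite {b. poly (coeff R i) b = 0}" using inf finite_subset by blast
    then show "coeff R i = coeff 0 i" using poly_roots_finite[of "coeff R i"] by auto
  qed
  then show ?thesis unfolding fb by (simp add: eval_coeffs_def)
qed

lemma monic_family_lin: "monic_family (\<lambda>b. lin1 b k j)" "monic_family (\<lambda>b. lin2 b k j)"
  unfolding lin1_def lin2_def
  by (intro monic_family_prod monic_family_linear[where p = "[:real k - real i, 1:]" for i]; simp)
     (intro monic_family_prod monic_family_linear[where p = "[:- real k + real i, - 1:]" for i]; simp)

lemma monic_family_ph: "monic_family (\<lambda>b. ph b k q)"
  unfolding ph_def by (intro monic_family_mult monic_family_prod monic_family_lin)

lemma poly_family_det_Emat: "poly_family (\<lambda>b. det (Emat b n m1 f))"
proof (rule poly_family_det)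
  fix i j assume ij: "i < n" "j < n"
  have "poly_family (\<lambda>b. rw b n m1 i j * sh (real n - 1 - 2 * real j) (f i))"
    by (cases "i < m1") (auto simp: rw_def wtp_lin intro!: poly_family_mult monic_family_imp_poly_family[OF monic_family_lin(1)] monic_family_imp_poly_family[OF monic_family_lin(2)])
  then show "poly_family (\<lambda>b. Emat b n m1 f $$ (i, j))" using ij by (simp add: Emat_def)
qed simp

lemma monic_family_qh: "monic_family (\<lambda>_. qh n)"
  unfolding qh_def
proof (intro monic_family_prod)
  fix i j
  show "monic_family (\<lambda>b. [:- real n - 1 + 2 * real i + real j, 1:])"
    by (rule monic_family_linear[where p = "[:- real n - 1 + 2 * real i + real j:]"]) simp
qed

lemma infinite_nonint: "infinite {b::real. b \<notin> \<int>}"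
proof
  assume "finite {b::real. b \<notin> \<int>}"
  moreover have "{0<..<1} \<subseteq> {b::real. b \<notin> \<int>}" by (auto elim!: Ints_cases)
  ultimately have "finite {0<..<1::real}" by (rule rev_finite_subset)
  then show False by (simp add: infinite_Ioo)
qed

lemma evenp_mult_cancel:
  assumes "evenp (p * f)" "evenp p" "p \<noteq> 0"
  shows "evenp f"
proof -
  have "p * pcompose f [:0, -1:] = p * f"
  proof (rule poly_ext)
    fix x show "poly (p * pcompose f [:0, -1:]) x = poly (p * f) x"
      using assms(1,2) unfolding evenp_iff by (simp add: poly_pcompose)
  qed
  then have "pcompose f [:0, -1:] = f" using assms(3) by simp
  then have "poly (pcompose f [:0, -1:]) x = poly f x" for x by simp
  then show ?thesis unfolding evenp_iff by (simp add: poly_pcompose)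
qed

text \<open>Reflection exchanges \<open>lin1\<close> and \<open>lin2\<close>; the signs cancel
  because each has the even number \<open>2 * j\<close> of factors.\<close>

lemma evenp_ph: "evenp (ph b k q)"
proof -
  have "poly (ph b k q) (- t) = poly (ph b k q) t" for t
  proof -
    have "(\<Prod>i<2 * j. b + real k - real i - t) = (\<Prod>i<2 * j. - b - real k + real i + t)" for j
    proof -
      have "(\<Prod>i<2 * j. b + real k - real i - t) = (\<Prod>i<2 * j. (-1) * (- b - real k + real i + t))"
        by (intro prod.cong) auto
      also have "\<dots> = (\<Prod>i<2 * j. - b - real k + real i + t)" by (subst prod.distrib) simp
      finally show ?thesis .
    qed
    moreover have "(\<Prod>i<2 * j. - b - real k + real i - t) = (\<Prod>i<2 * j. b + real k - real i + t)" for j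
    proof -
      have "(\<Prod>i<2 * j. - b - real k + real i - t) = (\<Prod>i<2 * j. (-1) * (b + real k - real i + t))"
        by (intro prod.cong) auto
      also have "\<dots> = (\<Prod>i<2 * j. b + real k - real i + t)" by (subst prod.distrib) simp
      finally show ?thesis .
    qed
    ultimately show ?thesis
      by (simp add: ph_def lin1_def lin2_def poly_prod mult.commute)
  qed
  then show ?thesis by (simp add: evenp_iff)
qed

lemma evenp_det_Bmat:
  assumes "\<And>h. h < n \<Longrightarrow> evenp (f h)"
  shows "evenp (det (Bmat b n m1 f))"
  unfolding evenp_iff
proof
  fix x
  have "map_mat (\<lambda>p. poly p (- x)) (Bmat b n m1 f) = map_mat (\<lambda>p. poly p x) (Bmat b n m1 f)"
    using evenp_sym_op assms unfolding evenp_iff by (intro eq_matI) (auto simp: Bmat_def)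
  then show "poly (det (Bmat b n m1 f)) (- x) = poly (det (Bmat b n m1 f)) x"
    by (simp add: poly_det)
qed

lemma lead_lin: "lead (lin1 b k j) (2 * int j) 1" "lead (lin2 b k j) (2 * int j) 1"
proof -
  have L: "lead [:c, 1:] 1 (1::real)" for c using lead_nat[of "[:c, 1:]" 1 1] by simp
  show "lead (lin1 b k j) (2 * int j) 1" 
    unfolding lin1_def using lead_prod[of "{..<2 * j}" "\<lambda>i. [:b + real k - real i, 1:]" "\<lambda>_. 1" "\<lambda>_. 1"] L by simp
  show "lead (lin2 b k j) (2 * int j) 1" 
    unfolding lin2_def using lead_prod[of "{..<2 * j}" "\<lambda>i. [:- b - real k + real i, 1:]" "\<lambda>_. 1" "\<lambda>_. 1"] L by simp
qed

lemma lead_ph: "lead (ph b k q) (2 * int q * (int q - 1)) 1"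
proof -
  have "2 * (\<Sum>j<q. 2 * int j) = 2 * int q * (int q - 1)"
    by (induction q) (auto simp: algebra_simps)
  moreover have "lead (ph b k q) ((\<Sum>j<q. 2 * int j) + (\<Sum>j<q. 2 * int j)) ((\<Prod>j<q. 1) * (\<Prod>j<q. 1))"
    unfolding ph_def by (intro lead_mult lead_prod lead_lin) auto
  ultimately show ?thesis by (simp add: mult.assoc)
qed

text \<open>The division is exact for even rows, by \<open>ph_dvd_det_Bmat\<close>. The rows are
  kept arbitrary because single rows are later replaced by monomials.\<close>

definition Wpol :: "real \<Rightarrow> nat \<Rightarrow> nat \<Rightarrow> (nat \<Rightarrow> real poly) \<Rightarrow> real poly" where
  "Wpol b n m1 f = det (Bmat b n m1 f) div ph b (n - 1) m1"

lemma ph_nonzero: "ph b k q \<noteq> 0"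
  using lead_degree(2)[OF lead_ph, of b k q] by auto

lemma qh_nonzero: "qh n \<noteq> 0" by (simp add: qh_def del: prod.cl_ivl_Suc)

lemma ph_dvd_det_Bmat:
  assumes "m1 \<le> n" and f: "\<And>h. h < n \<Longrightarrow> evenp (f h)"
  shows "ph b (n - 1) m1 dvd det (Bmat b n m1 f)"
proof -
  obtain \<kappa> where k: "\<kappa> \<noteq> 0" "\<And>b. det (Emat b n m1 f) = smult \<kappa> (qh n * det (Bmat b n m1 f))"
    using det_Emat_eq_qh_det_Bmat[of n] f by blast
  \<comment> \<open>The factor \<open>qh n\<close> is carried along because the passage to all
    \<open>b\<close> is made for \<open>det (Emat b n m1 f)\<close>.\<close>
  have "qh n * ph b (n - 1) m1 dvd det (Emat b n m1 f)" if "b \<notin> \<int>" for b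
  proof -
    have "ph b (n - 1) m1 dvd smult \<kappa> (qh n * det (Bmat b n m1 f))"
      using ph_dvd_det_Emat[OF assms(1), of b f] k(2)[of b] by simp
    then have "ph b (n - 1) m1 dvd qh n * det (Bmat b n m1 f)" using k(1) by (simp add: dvd_smult_iff)
    then have "ph b (n - 1) m1 dvd det (Bmat b n m1 f)"
      by (rule ph_dvd_qh_cancel[OF that])
    then show ?thesis unfolding k(2) by (intro dvd_smult mult_dvd_mono) auto
  qed
  then have "infinite {b. qh n * ph b (n - 1) m1 dvd det (Emat b n m1 f)}"
    by (intro infinite_super[OF _ infinite_nonint]) auto
  from poly_family_dvd_all[OF poly_family_det_Emat monic_family_mult[OF monic_family_qh monic_family_ph] this]
  have "qh n * ph b (n - 1) m1 dvd det (Emat b n m1 f)" .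
  then have "qh n * ph b (n - 1) m1 dvd qh n * det (Bmat b n m1 f)"
    unfolding k(2) using k(1) by (simp add: dvd_smult_iff)
  then show ?thesis using qh_nonzero by simp
qed

lemma det_Bmat_Wpol:
  assumes "m1 \<le> n" and f: "\<And>h. h < n \<Longrightarrow> evenp (f h)"
  shows "det (Bmat b n m1 f) = ph b (n - 1) m1 * Wpol b n m1 f"
  using ph_dvd_det_Bmat[OF assms, where b = b] by (simp add: Wpol_def)

lemma evenp_Wpol:
  assumes "m1 \<le> n" and f: "\<And>h. h < n \<Longrightarrow> evenp (f h)"
  shows "evenp (Wpol b n m1 f)"
  using evenp_mult_cancel[of "ph b (n - 1) m1" "Wpol b n m1 f"] evenp_det_Bmat[of n f b m1, OF f]
    evenp_ph ph_nonzero det_Bmat_Wpol[of m1 n f b, OF assms] by simp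

text \<open>Subtracting the degree \<open>2 * m1 * (m1 - 1)\<close> of \<open>ph\<close> turns the
  mixed degree count of \<open>lead_Bmat\<close> into separate corrections for the two
  families.\<close>

lemma lead_Wpol:
  assumes "\<And>h. h < m1 + m3 \<Longrightarrow> lead (f h) (2 * e h) (c h)" "\<And>h. h < m1 + m3 \<Longrightarrow> evenp (f h)"
  shows "lead (Wpol b (m1 + m3) m1 f) (2 * (\<Sum>h<m1 + m3. e h) - int m1 * (int m1 - 1) - int m3 * (int m3 - 1))
      (det (mat (m1 + m3) (m1 + m3) (\<lambda>(h, r). 2 ^ (m1 + m3 - 1 - r) * (\<Prod>i<r. (of_int (e h) - (if h < m1 then b + 1/2 else 0)) - real i) * c h)))"
proof (rule lead_cancel[OF _ lead_ph])
  have eq: "2 * (\<Sum>h<m1 + m3. e h) + 2 * int m1 * (int (m1 + m3) - 1) - int (m1 + m3) * (int (m1 + m3) - 1)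
    = 2 * int m1 * (int m1 - 1) + (2 * (\<Sum>h<m1 + m3. e h) - int m1 * (int m1 - 1) - int m3 * (int m3 - 1))"
    by (simp add: algebra_simps)
  show "lead (ph b (m1 + m3 - 1) m1 * Wpol b (m1 + m3) m1 f)
     (2 * int m1 * (int m1 - 1) + (2 * (\<Sum>h<m1 + m3. e h) - int m1 * (int m1 - 1) - int m3 * (int m3 - 1)))
     (det (mat (m1 + m3) (m1 + m3) (\<lambda>(h, r). 2 ^ (m1 + m3 - 1 - r) * (\<Prod>i<r. (of_int (e h) - (if h < m1 then b + 1/2 else 0)) - real i) * c h)))"
    using lead_Bmat[of "m1 + m3" f e c m1 b] assms det_Bmat_Wpol[of m1 "m1 + m3" f b]
    unfolding eq[symmetric] by simp
qed

lemma det_Emat_Wpol: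
  "\<exists>\<kappa>. \<kappa> \<noteq> 0 \<and> (\<forall>b m1 f. m1 \<le> n \<and> (\<forall>h<n. evenp (f h)) \<longrightarrow>
     det (Emat b n m1 f) = smult \<kappa> (qh n * (ph b (n - 1) m1 * Wpol b n m1 f)))"
proof -
  obtain \<kappa> where "\<kappa> \<noteq> 0" "\<forall>b m1 f. (\<forall>h<n. evenp (f h)) \<longrightarrow> det (Emat b n m1 f) = smult \<kappa> (qh n * det (Bmat b n m1 f))"
    using det_Emat_eq_qh_det_Bmat[of n] by blast
  then show ?thesis using det_Bmat_Wpol by (intro exI[of _ \<kappa>]) auto
qed

section \<open>Adjoints\<close>

lemma vandermonde_kernel:
  fixes x y :: "nat \<Rightarrow> 'a::field"
  assumes "inj_on x {..<n}" and "\<And>k. k < n \<Longrightarrow> (\<Sum>l<n. y l * x l ^ k) = 0" and "l < n"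
  shows "y l = 0"
proof -
  let ?M = "mat n n (\<lambda>(k, l). x l ^ k)"
  have "det ?M \<noteq> 0"
  proof -
    have "x j \<noteq> x i" if "j < n" "i < j" for i j
      using that inj_onD[OF assms(1), of j i] by auto
    then show ?thesis unfolding det_vandermonde[OF assms(1)] by auto
  qed
  moreover have "?M *\<^sub>v vec n y = 0\<^sub>v n"
    using assms(2) by (intro eq_vecI) (auto simp: scalar_prod_def atLeast0LessThan mult.commute)
  ultimately have "vec n y = 0\<^sub>v n"
    using det_0_iff_vec_prod_zero_field[of ?M n] vec_carrier[of n y] by (metis mat_carrier)
  then show ?thesis using assms(3) by (metis index_vec index_zero_vec(1))
qed

text \<open>On t^(2 k) the unweighted operator with \<open>r\<close> differences gives 0 for k < r,
  a nonzero constant for k = r, and an even polynomial of degree at most 2 (k - r) otherwise. The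
  system is thus triangular with constant diagonal, and its solution inherits parity and degree
  bounds.\<close>

lemma triangular_solve:
  assumes odd: "\<And>k. k < n \<Longrightarrow> oddp (\<Phi> k)" and deg: "\<And>k. k < n \<Longrightarrow> degree (\<Phi> k) \<le> e + 2 * k"
  shows "\<exists>\<alpha>. (\<forall>k<n. oddp (\<alpha> k) \<and> degree (\<alpha> k) \<le> e + 2 * k \<and>
     \<Phi> k = (\<Sum>r<n. \<alpha> r * sym_op (\<lambda>_. 1) (n - 1) r (monom 1 (2 * k))))"
proof -
  let ?B = "\<lambda>r k. sym_op (\<lambda>_. 1) (n - 1) r (monom 1 (2 * k)) :: real poly"
  have ev: "evenp (monom 1 (2 * k))" for k by (auto simp: evenp_def)
  have L: "lead (?B r k) (2 * int k - 2 * int r) (2 ^ (n - 1 - r) * (\<Prod>i<r. real k - real i) * 1)" if "r < n" for r k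
  proof -
    have "r \<le> n - 1" using that by simp
    from lead_sym_op_1[OF _ ev this, of k "int k" 1] lead_monom[of 1 "2 * k"] show ?thesis by simp
  qed
  have z: "?B r k = 0" if "r < n" "k < r" for r k using lead_neg[OF L[OF that(1), of k]] that by simp
  define K where "K k = (2 ^ (n - 1 - k) * (\<Prod>i<k. real k - real i) :: real)" for k
  have K0: "K k \<noteq> 0" for k by (auto simp: K_def)
  have diag: "?B k k = [:K k:]" if "k < n" for k
    using L[OF that, of k] lead_nat[of "?B k k" 0 "K k"] by (auto simp: K_def elim!: degree_eq_zeroE)
  have dB: "degree (?B r k) \<le> 2 * (k - r)" if "r < n" "r \<le> k" for r k
    using L[OF that(1), of k] that lead_nat[of "?B r k" "2 * (k - r)"] by (simp add: of_nat_diff)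
  have "\<exists>\<alpha>. \<forall>k<q. oddp (\<alpha> k) \<and> degree (\<alpha> k) \<le> e + 2 * k \<and> \<Phi> k = (\<Sum>r\<le>k. \<alpha> r * ?B r k)" if "q \<le> n" for q
    using that
  proof (induction q)
    case 0
    then show ?case by simp
  next
    case (Suc q)
    then have q: "q < n" by simp
    obtain \<alpha> where \<alpha>: "\<And>k. k < q \<Longrightarrow> oddp (\<alpha> k)" "\<And>k. k < q \<Longrightarrow> degree (\<alpha> k) \<le> e + 2 * k"
      "\<And>k. k < q \<Longrightarrow> \<Phi> k = (\<Sum>r\<le>k. \<alpha> r * ?B r k)"
      using Suc.IH q by auto
    define a where "a = smult (1 / K q) (\<Phi> q - (\<Sum>r<q. \<alpha> r * ?B r q))"
    have "oddp a" unfolding oddp_iff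
    proof
      fix x
      have "poly (\<alpha> r) (- x) * poly (?B r q) (- x) = - (poly (\<alpha> r) x * poly (?B r q) x)" if "r < q" for r
        using \<alpha>(1)[OF that] evenp_sym_op[OF ev, of "\<lambda>_. 1" "n - 1" r q] by (simp add: oddp_iff evenp_iff)
      then have "(\<Sum>r<q. poly (\<alpha> r) (- x) * poly (?B r q) (- x)) = - (\<Sum>r<q. poly (\<alpha> r) x * poly (?B r q) x)"
        unfolding sum_negf[symmetric] by (intro sum.cong) auto
      then show "poly a (- x) = - poly a x"
        using odd[OF q] by (simp add: a_def poly_sum oddp_iff diff_divide_distrib)
    qed
    moreover have "degree a \<le> e + 2 * q"
    proof -
      have "degree (\<alpha> r * ?B r q) \<le> e + 2 * q" if "r < q" for r
        using degree_mult_le[of "\<alpha> r" "?B r q"] \<alpha>(2)[OF that] dB[of r q] that q by simp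
      then have "degree (\<Phi> q - (\<Sum>r<q. \<alpha> r * ?B r q)) \<le> e + 2 * q"
        by (intro degree_diff_le degree_sum_le deg q) auto
      then show ?thesis by (simp add: a_def)
    qed
    moreover have "\<Phi> q = (\<Sum>r<q. \<alpha> r * ?B r q) + a * ?B q q"
      unfolding diag[OF q] using K0[of q] by (simp add: a_def)
    ultimately show ?case
      using \<alpha> by (intro exI[of _ "\<alpha>(q := a)"]) (auto simp: less_Suc_eq lessThan_Suc_atMost[symmetric] intro!: sum.cong)
  qed
  from this[OF order_refl] obtain \<alpha> where \<alpha>: "\<forall>k<n. oddp (\<alpha> k) \<and> degree (\<alpha> k) \<le> e + 2 * k \<and> \<Phi> k = (\<Sum>r\<le>k. \<alpha> r * ?B r k)" ..
  have "(\<Sum>r\<le>k. \<alpha> r * ?B r k) = (\<Sum>r<n. \<alpha> r * ?B r k)" if "k < n" for k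
    using that z by (intro sum.mono_neutral_left) auto
  with \<alpha> show ?thesis by (intro exI[of _ \<alpha>]) auto
qed

lemma MOST_poly_nonzero: "p \<noteq> 0 \<Longrightarrow> MOST x. poly p x \<noteq> 0" for p :: "real poly"
  using poly_roots_finite[of p] by (simp add: MOST_iff_cofinite)

lemma MOST_shift:
  assumes "MOST x::real. P x" shows "MOST x. P (x + c)"
proof -
  have "{x. \<not> P (x + c)} \<subseteq> (\<lambda>x. x - c) ` {x. \<not> P x}"
    by (auto intro!: image_eqI[of _ _ "_ + c"])
  with assms show ?thesis by (auto simp: MOST_iff_cofinite intro: finite_subset)
qed

lemma MOST_all_finite:
  "finite I \<Longrightarrow> (\<And>i. i \<in> I \<Longrightarrow> MOST x. P i x) \<Longrightarrow> MOST x. \<forall>i\<in>I. P i x"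
  by (induction I rule: finite_induct) (auto simp: MOST_conj_distrib)

text \<open>The excluded integers form an infinite set, so the hypothesis is not yet a statement
  about almost all points. Clearing denominators gives a polynomial identity, which extends to
  them.\<close>

lemma rational_sum_eq:
  fixes A D :: "nat \<Rightarrow> real poly"
  assumes D: "\<And>l. l < n \<Longrightarrow> D l \<noteq> 0"
    and eq: "\<And>s. s \<notin> \<int> \<Longrightarrow> (\<And>l. l < n \<Longrightarrow> poly (D l) s \<noteq> 0) \<Longrightarrow> (\<Sum>l<n. poly (A l) s / poly (D l) s) = poly R s"
  shows "MOST s. (\<Sum>l<n. poly (A l) s / poly (D l) s) = poly R s"
proof -
  let ?P = "\<Prod>l<n. D l"
  have P0: "?P \<noteq> 0" using D by simp
  define X where "X = (\<Sum>l<n. A l * (\<Prod>l'\<in>{..<n} - {l}. D l')) - R * ?P"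
  have X: "poly X s = poly ?P s * ((\<Sum>l<n. poly (A l) s / poly (D l) s) - poly R s)"
    if "\<And>l. l < n \<Longrightarrow> poly (D l) s \<noteq> 0" for s
  proof -
    have "poly (A l * (\<Prod>l'\<in>{..<n} - {l}. D l')) s = poly ?P s * (poly (A l) s / poly (D l) s)" if "l < n" for l
      using that \<open>\<And>l. l < n \<Longrightarrow> poly (D l) s \<noteq> 0\<close>[OF that] by (simp add: poly_prod prod.remove[of "{..<n}" l])
    then show ?thesis by (simp add: X_def poly_sum sum_distrib_left right_diff_distrib)
  qed
  have "MOST s. \<forall>l\<in>{..<n}. poly (D l) s \<noteq> 0"
    by (intro MOST_all_finite MOST_poly_nonzero) (auto simp: D)
  then have good: "MOST s. \<forall>l<n. poly (D l) s \<noteq> 0" by (simp add: Ball_def)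
  have "X * ?P = 0"
  proof (rule poly_eq_nonint)
    fix t :: real assume t: "t \<notin> \<int>"
    show "poly (X * ?P) t = poly 0 t"
    proof (cases "\<forall>l<n. poly (D l) t \<noteq> 0")
      case True
      then show ?thesis using X[of t] eq[OF t] by simp
    next
      case False
      then show ?thesis by (auto simp: poly_prod)
    qed
  qed
  then have "X = 0" using P0 by simp
  show ?thesis
  proof (rule MOST_mono[OF good])
    fix s assume "\<forall>l<n. poly (D l) s \<noteq> 0"
    then show "(\<Sum>l<n. poly (A l) s / poly (D l) s) = poly R s"
      using X[of s] \<open>X = 0\<close> by (auto simp: poly_prod)
  qed
qed

text \<open>
  By \<open>triangular_solve\<close> the operator is a combination of the \<open>sym_op\<close> with odd polynomial coefficients, and the
  sum in the conclusion is its formal adjoint applied to \<open>1\<close>.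
\<close>
lemma adjoint_odd:
  fixes A :: "nat \<Rightarrow> real poly"
  assumes n: "n > 0" and Q: "Q \<noteq> 0"
    and odd: "\<And>k. k < n \<Longrightarrow> oddp (\<Phi> k)" and deg: "\<And>k. k < n \<Longrightarrow> degree (\<Phi> k) \<le> e + 2 * k"
    and eq: "\<And>k t. k < n \<Longrightarrow> poly Q t \<noteq> 0 \<Longrightarrow>
       (\<Sum>l<n. poly (A l) t / poly Q t * (t + (real n - 1 - 2 * real l)) ^ (2 * k)) = poly (\<Phi> k) t"
  shows "\<exists>R. oddp R \<and> degree R \<le> e \<and>
     (MOST s. (\<Sum>l<n. poly (A l) (s - (real n - 1 - 2 * real l)) / poly Q (s - (real n - 1 - 2 * real l))) = poly R s)"
proof -
  let ?d = "\<lambda>l. real n - 1 - 2 * real l"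
  let ?B = "\<lambda>r k. sym_op (\<lambda>_. 1) (n - 1) r (monom 1 (2 * k)) :: real poly"
  obtain \<alpha> where \<alpha>: "\<And>k. k < n \<Longrightarrow> oddp (\<alpha> k)" "\<And>k. k < n \<Longrightarrow> degree (\<alpha> k) \<le> e + 2 * k"
     "\<And>k. k < n \<Longrightarrow> \<Phi> k = (\<Sum>r<n. \<alpha> r * ?B r k)"
    using triangular_solve[of n \<Phi> e, OF odd deg] by blast
  have "\<forall>r\<in>{..<n}. \<exists>R. oddp R \<and> degree R \<le> e \<and> (\<forall>s. s \<notin> \<int> \<longrightarrow> sym_op_adj (n - 1) r (poly (\<alpha> r)) s = poly R s)"
    using \<alpha> by (auto intro!: sym_op_adj_oddp)
  then obtain R where R: "\<And>r. r < n \<Longrightarrow> oddp (R r)" "\<And>r. r < n \<Longrightarrow> degree (R r) \<le> e"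
    "\<And>r s. r < n \<Longrightarrow> s \<notin> \<int> \<Longrightarrow> sym_op_adj (n - 1) r (poly (\<alpha> r)) s = poly (R r) s"
    by (auto dest!: bchoice)
  \<comment> \<open>The \<open>n\<close> squared nodes are distinct, so the action on 1, t^2, ...,
    t^(2 n - 2) determines the coefficients of the operator.\<close>
  have T: "poly (A l) t / poly Q t = (\<Sum>r<n. poly (\<alpha> r) t * sym_op_coeff (n - 1) r l t)"
    if t: "t \<notin> \<int>" "poly Q t \<noteq> 0" and l: "l < n" for t l
  proof -
    define y where "y l = poly (A l) t / poly Q t - (\<Sum>r<n. poly (\<alpha> r) t * sym_op_coeff (n - 1) r l t)" for l
    have "(\<Sum>l<n. y l * ((t + ?d l)\<^sup>2) ^ k) = 0" if k: "k < n" for k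
    proof -
      have ev: "evenp (monom 1 (2 * k))" by (auto simp: evenp_def)
      have B: "poly (?B r k) t = (\<Sum>l<n. sym_op_coeff (n - 1) r l t * (t + ?d l) ^ (2 * k))" for r
        using weight.poly_sym_op[OF weight_1 ev t(1), of "n - 1" r] n
        by (cases n) (auto simp: lessThan_Suc_atMost poly_monom add_diff_eq simp del: sum.lessThan_Suc)
      have "(\<Sum>l<n. y l * (t + ?d l) ^ (2 * k)) = poly (\<Phi> k) t - (\<Sum>l<n. \<Sum>r<n. poly (\<alpha> r) t * sym_op_coeff (n - 1) r l t * (t + ?d l) ^ (2 * k))"
        unfolding eq[OF k t(2), symmetric] by (simp add: y_def left_diff_distrib sum_subtractf sum_distrib_right)
      also have "(\<Sum>l<n. \<Sum>r<n. poly (\<alpha> r) t * sym_op_coeff (n - 1) r l t * (t + ?d l) ^ (2 * k)) = (\<Sum>r<n. poly (\<alpha> r) t * poly (?B r k) t)"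
        unfolding B sum_distrib_left by (subst sum.swap) (simp add: mult.assoc)
      also have "\<dots> = poly (\<Phi> k) t" by (simp add: \<alpha>(3)[OF k] poly_sum)
      finally show ?thesis by (simp add: power_mult)
    qed
    from vandermonde_kernel[OF inj_on_nodes[OF t(1)] this l] show ?thesis by (simp add: y_def)
  qed
  define RR where "RR = (\<Sum>r<n. R r)"
  have sh0: "sh c p \<noteq> 0 \<longleftrightarrow> p \<noteq> 0" for c p
  proof -
    have "\<forall>x. poly p x = poly (sh c p) (x - c)" by simp
    then show ?thesis by (metis poly_0 poly_all_0_iff_0 poly_sh)
  qed
  have "MOST s. (\<Sum>l<n. poly (sh (- ?d l) (A l)) s / poly (sh (- ?d l) Q) s) = poly RR s"
  proof (rule rational_sum_eq)
    show "sh (- ?d l) Q \<noteq> 0" for l using Q sh0 by blast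
    fix s :: real assume s: "s \<notin> \<int>" and nz: "\<And>l. l < n \<Longrightarrow> poly (sh (- ?d l) Q) s \<noteq> 0"
    have nint: "s - ?d l \<notin> \<int>" for l
    proof
      assume "s - ?d l \<in> \<int>"
      moreover have "?d l \<in> \<int>" by auto
      ultimately have "(s - ?d l) + ?d l \<in> \<int>" by (rule Ints_add)
      with s show False by simp
    qed
    have "(\<Sum>l<n. poly (sh (- ?d l) (A l)) s / poly (sh (- ?d l) Q) s)
        = (\<Sum>l<n. \<Sum>r<n. poly (\<alpha> r) (s - ?d l) * sym_op_coeff (n - 1) r l (s - ?d l))"
    proof (rule sum.cong[OF refl])
      fix l assume "l \<in> {..<n}"
      then have l: "l < n" by simp
      have e: "s + - ?d l = s - ?d l" by simp
      show "poly (sh (- ?d l) (A l)) s / poly (sh (- ?d l) Q) s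
          = (\<Sum>r<n. poly (\<alpha> r) (s - ?d l) * sym_op_coeff (n - 1) r l (s - ?d l))"
        using T[OF nint _ l] nz[OF l] unfolding poly_sh e .
    qed
    also have "\<dots> = (\<Sum>r<n. sym_op_adj (n - 1) r (poly (\<alpha> r)) s)"
      unfolding sym_op_adj_def using n
      by (subst sum.swap) (cases n; auto simp: lessThan_Suc_atMost algebra_simps simp del: sum.lessThan_Suc intro!: sum.cong)
    also have "\<dots> = poly RR s" using R(3) s by (simp add: RR_def poly_sum)
    finally show "(\<Sum>l<n. poly (sh (- ?d l) (A l)) s / poly (sh (- ?d l) Q) s) = poly RR s" .
  qed
  moreover have "oddp RR" unfolding RR_def using R(1) by (auto simp: oddp_def coeff_sum)
  moreover have "degree RR \<le> e" unfolding RR_def using R(2) by (intro degree_sum_le) auto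
  ultimately show ?thesis unfolding poly_sh add_uminus_conv_diff by blast
qed

section \<open>Average and difference equations for polynomials\<close>

lemma degree_diff_sh:
  assumes "degree p \<le> Suc d" shows "degree (p - sh h p) \<le> d"
  using coeff_sh_top[OF assms, of h] assms by (intro degree_diff_less_top) auto

text \<open>The first approximation \<open>p / 2\<close> leaves half of \<open>p - sh 1 p\<close>,
  which has smaller degree.\<close>

lemma average_solution: "\<exists>g. g + sh 1 g = p"
proof (induction "degree p" arbitrary: p rule: less_induct)
  case less
  show ?case
  proof (cases "degree p")
    case 0
    then obtain c where "p = [:c:]" by (auto elim: degree_eq_zeroE)
    then show ?thesis by (intro exI[of _ "[:c/2:]"]) (simp add: sh_def)
  next
    case (Suc d)
    let ?r = "smult (1/2) (p - sh 1 p)"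
    have "degree ?r < degree p" using degree_diff_sh[of p d 1] Suc by simp
    then obtain g where g: "g + sh 1 g = ?r" using less by blast
    show ?thesis
    proof (intro exI[of _ "g + smult (1/2) p"] poly_ext)
      fix x
      have "poly g x + poly g (x + 1) = (poly p x - poly p (x + 1)) / 2"
        using arg_cong[OF g, of "\<lambda>q. poly q x"] by simp
      then show "poly (g + smult (1/2) p + sh 1 (g + smult (1/2) p)) x = poly p x"
        by (simp add: field_simps)
    qed
  qed
qed

lemma lead_coeff_add_sh: "lead g e c \<Longrightarrow> lead (g + sh h g) e (2 * c)"
  using lead_add[OF _ lead_sh, of g e c g c h] by simp

text \<open>Adding a shift doubles the leading coefficient.\<close>

lemma average_unique: "g + sh h g = 0 \<Longrightarrow> g = 0"
  using lead_degree(2)[OF lead_coeff_add_sh, of g "int (degree g)" "lead_coeff g" h]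
  by (cases "g = 0") (auto simp: lead_nat)

text \<open>The offset \<open>c\<close> serves \<theta>(x) = (x + a + 1/2)^2 - (a + 1/2)^2: even
  polynomials in x + a + 1/2 become polynomials in \<theta>(x).\<close>

lemma evenp_as_square:
  assumes "evenp f"
  shows "\<exists>P. \<forall>z. poly f z = poly P (z\<^sup>2 - c)"
proof -
  define P where "P = (\<Sum>i\<le>degree f. monom (coeff f (2 * i)) i)"
  have "poly f z = poly P (z\<^sup>2)" for z
  proof -
    have "poly f z = (\<Sum>i\<le>2 * degree f. coeff f i * z ^ i)"
      unfolding poly_altdef by (rule sum.mono_neutral_left) (auto simp: coeff_eq_0)
    also have "\<dots> = (\<Sum>i\<in>(\<lambda>i. 2 * i) ` {..degree f}. coeff f i * z ^ i)"
    proof (intro sum.mono_neutral_right ballI)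
      fix i assume i: "i \<in> {..2 * degree f} - (\<lambda>i. 2 * i) ` {..degree f}"
      have "odd i"
      proof
        assume "even i"
        then obtain j where "i = 2 * j" by (auto elim: evenE)
        with i show False by auto
      qed
      then show "coeff f i * z ^ i = 0" using assms by (simp add: evenp_def)
    qed auto
    also have "\<dots> = poly P (z\<^sup>2)"
      by (subst sum.reindex) (auto simp: inj_on_def P_def poly_sum poly_monom power_mult)
    finally show ?thesis .
  qed
  then show ?thesis by (intro exI[of _ "sh c P"]) simp
qed

text \<open>The leading monomial is removed by the difference of an even monomial; what is left is
  odd again and of smaller degree.\<close>

lemma odd_central_difference:
  assumes "oddp r"
  shows "\<exists>f. evenp f \<and> (\<forall>y. poly f (y + 1/2) - poly f (y - 1/2) = poly r y)"
  using assms
proof (induction "degree r" arbitrary: r rule: less_induct)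
  case less
  show ?case
  proof (cases "r = 0")
    case True
    then show ?thesis by (intro exI[of _ 0]) (auto simp: evenp_def)
  next
    case False
    define d where "d = degree r"
    have odd: "odd d" using less.prems False leading_coeff_0_iff unfolding oddp_def d_def by blast
    \<comment> \<open>The central difference of t^(d + 1) begins with (d + 1) t^d.\<close>
    define c where "c = lead_coeff r / real (Suc d)"
    have c: "real (Suc d) * c = lead_coeff r" by (simp add: c_def)
    let ?m = "monom c (Suc d)"
    have evm: "evenp ?m" using odd by (auto simp: evenp_def)
    let ?D = "sh (1/2) ?m - sh (-1/2) ?m"
    have degm: "degree ?m \<le> Suc d" by (rule degree_monom_le)
    have c0: "coeff ?D (Suc d) = 0" and c1: "coeff ?D d = lead_coeff r"
      using coeff_sh_top[OF degm, of "1/2"] coeff_sh_top[OF degm, of "-1/2"] c by simp_all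
    have degD: "degree ?D \<le> d"
      using coeff_sh_top[OF degm] degm by (intro degree_diff_less_top) auto
    have oddD: "oddp ?D" unfolding oddp_iff
    proof
      fix x show "poly ?D (- x) = - poly ?D x"
        using evenp_minus[OF evm, of "- x + 1/2" "x - 1/2"] evenp_minus[OF evm, of "- x - 1/2" "x + 1/2"] by simp
    qed
    let ?r = "r - ?D"
    have "oddp ?r" using less.prems oddD by (auto simp: oddp_def)
    have "\<exists>f. evenp f \<and> (\<forall>y. poly f (y + 1/2) - poly f (y - 1/2) = poly ?r y)"
    proof (cases "?r = 0")
      case True
      then show ?thesis by (intro exI[of _ 0]) (auto simp: evenp_def)
    next
      case nz: False
      have "degree ?r \<le> d" using degD by (intro degree_diff_le[of r d ?D]) (simp_all only: d_def order_refl)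
      moreover have "coeff ?r d = 0" using c1 by (simp add: d_def)
      ultimately have "degree ?r < degree r" using nz
        by (metis d_def le_neq_implies_less leading_coeff_0_iff)
      then show ?thesis using less.hyps \<open>oddp ?r\<close> by blast
    qed
    then obtain f where f: "evenp f" "\<And>y. poly f (y + 1/2) - poly f (y - 1/2) = poly ?r y" by blast
    show ?thesis
    proof (intro exI[of _ "f + ?m"] conjI allI)
      show "evenp (f + ?m)" using f(1) evm by (auto simp: evenp_def)
      fix y show "poly (f + ?m) (y + 1/2) - poly (f + ?m) (y - 1/2) = poly r y"
        using f(2)[of y] by simp
    qed
  qed
qed

section \<open>The degenerate parameters\<close>

text \<open>
  Normalised without denominators, so that the symmetry in \<open>A\<close>, \<open>B\<close> and \<open>C\<close> holds for all parameters.
\<close>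
definition cont_dual_hahn :: "nat \<Rightarrow> real \<Rightarrow> real \<Rightarrow> real \<Rightarrow> real \<Rightarrow> real" where
  "cont_dual_hahn n A B C \<tau> = (\<Sum>j\<le>n. pochhammer (- real n) j / fact j * pochhammer (A + B + real j) (n - j)
     * pochhammer (A + C + real j) (n - j) * (pochhammer (A + \<tau>) j * pochhammer (A - \<tau>) j))"

lemma cont_dual_hahn_swap: "cont_dual_hahn n A B C \<tau> = cont_dual_hahn n A C B \<tau>"
  by (simp add: cont_dual_hahn_def mult_ac)

lemma poch_neg_fact: "j \<le> n \<Longrightarrow> pochhammer (- real n) j / fact j = (-1) ^ j * real (n choose j)"
  using gbinomial_pochhammer[of "real n" j] by (simp add: binomial_gbinomial)

text \<open>All but the outermost factors agree on both sides of the difference. A basis function of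
  index \<open>j + 1\<close> for \<open>A\<close> becomes one of index \<open>j\<close> for
  \<open>A + 1/2\<close>.\<close>

lemma poch_diff:
  "pochhammer (A + (\<tau> + 1/2)) (Suc j) * pochhammer (A - (\<tau> + 1/2)) (Suc j)
   - pochhammer (A + (\<tau> - 1/2)) (Suc j) * pochhammer (A - (\<tau> - 1/2)) (Suc j)
   = - 2 * \<tau> * real (Suc j) * (pochhammer ((A + 1/2) + \<tau>) j * pochhammer ((A + 1/2) - \<tau>) j)" for \<tau> A :: real
proof -
  let ?p = "pochhammer ((A + 1/2) + \<tau>) j" and ?q = "pochhammer ((A + 1/2) - \<tau>) j"
  have 1: "pochhammer (A + (\<tau> + 1/2)) (Suc j) = ?p * (A + 1/2 + \<tau> + real j)"
    by (simp add: pochhammer_Suc add_ac)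
  have 2: "pochhammer (A - (\<tau> + 1/2)) (Suc j) = (A - \<tau> - 1/2) * ?q"
  proof -
    have "A - (\<tau> + 1/2) + 1 = A + 1/2 - \<tau>" by simp
    then show ?thesis by (simp only: pochhammer_rec) simp
  qed
  have 3: "pochhammer (A + (\<tau> - 1/2)) (Suc j) = (A + \<tau> - 1/2) * ?p"
  proof -
    have "A + (\<tau> - 1/2) + 1 = A + 1/2 + \<tau>" by simp
    then show ?thesis by (simp only: pochhammer_rec) simp
  qed
  have 4: "pochhammer (A - (\<tau> - 1/2)) (Suc j) = ?q * (A + 1/2 - \<tau> + real j)"
  proof -
    have "A - (\<tau> - 1/2) = A + 1/2 - \<tau>" by simp
    then show ?thesis by (simp only: pochhammer_Suc)
  qed
  show ?thesis unfolding 1 2 3 4 by (simp add: algebra_simps)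
qed

text \<open>The lowering relation: it raises all three parameters by 1/2, so it respects a
  permutation of them, which is what the induction for the symmetry uses.\<close>

lemma cont_dual_hahn_diff:
  "cont_dual_hahn (Suc n) A B C (\<tau> + 1/2) - cont_dual_hahn (Suc n) A B C (\<tau> - 1/2)
   = 2 * \<tau> * real (Suc n) * cont_dual_hahn n (A + 1/2) (B + 1/2) (C + 1/2) \<tau>"
proof -
  let ?N = "Suc n"
  let ?r = "\<lambda>j. 2 * \<tau> * real ?N * (pochhammer (- real n) j / fact j * pochhammer (A + 1/2 + (B + 1/2) + real j) (n - j)
     * pochhammer (A + 1/2 + (C + 1/2) + real j) (n - j) * (pochhammer (A + 1/2 + \<tau>) j * pochhammer (A + 1/2 - \<tau>) j))"
  let ?k = "\<lambda>j. pochhammer (- real ?N) j / fact j * pochhammer (A + B + real j) (?N - j) * pochhammer (A + C + real j) (?N - j)"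
  let ?e = "\<lambda>j. pochhammer (A + (\<tau> + 1/2)) j * pochhammer (A - (\<tau> + 1/2)) j - pochhammer (A + (\<tau> - 1/2)) j * pochhammer (A - (\<tau> - 1/2)) j"
  have "cont_dual_hahn ?N A B C (\<tau> + 1/2) - cont_dual_hahn ?N A B C (\<tau> - 1/2) = (\<Sum>j\<le>?N. ?k j * ?e j)"
    unfolding cont_dual_hahn_def sum_subtractf[symmetric] right_diff_distrib ..
  also have "\<dots> = (\<Sum>j\<le>n. ?k (Suc j) * ?e (Suc j))"
    by (subst sum.atMost_Suc_shift) simp
  also have "\<dots> = (\<Sum>j\<le>n. ?r j)"
  proof (rule sum.cong[OF refl])
    fix j assume "j \<in> {..n}"
    have e: "A + 1/2 + (B + 1/2) + real j = A + B + real (Suc j)" "A + 1/2 + (C + 1/2) + real j = A + C + real (Suc j)" by simp_all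
    have f: "pochhammer (- real ?N) (Suc j) / fact (Suc j) * real (Suc j) = - real ?N * (pochhammer (- real n) j / fact j)"
    proof -
      have "pochhammer (- real ?N) (Suc j) = - real ?N * pochhammer (- real n) j"
        by (simp add: pochhammer_rec)
      moreover have "fact (Suc j) = real (Suc j) * fact j" by (rule fact_Suc)
      ultimately show ?thesis by (simp only:) (simp del: of_nat_Suc)
    qed
    let ?P = "pochhammer (A + B + real (Suc j)) (n - j) * pochhammer (A + C + real (Suc j)) (n - j)"
    let ?E = "pochhammer (A + 1/2 + \<tau>) j * pochhammer (A + 1/2 - \<tau>) j"
    have "?k (Suc j) * ?e (Suc j) = - 2 * \<tau> * ?P * ?E * (pochhammer (- real ?N) (Suc j) / fact (Suc j) * real (Suc j))"
      unfolding poch_diff by (simp only: diff_Suc_Suc mult_ac)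
    also have "\<dots> = 2 * \<tau> * real ?N * (pochhammer (- real n) j / fact j * ?P * ?E)"
      unfolding f by (simp only: mult_ac mult_minus_left mult_minus_right minus_minus)
    finally show "?k (Suc j) * ?e (Suc j) = ?r j"
      unfolding e by (simp only: mult.assoc)
  qed
  also have "\<dots> = 2 * \<tau> * real ?N * cont_dual_hahn n (A + 1/2) (B + 1/2) (C + 1/2) \<tau>"
    unfolding cont_dual_hahn_def sum_distrib_left ..
  finally show ?thesis .
qed

lemma poch_shift_reflect:
  assumes "j \<le> n"
  shows "pochhammer (c + real j) (n - j) = (-1) ^ (n - j) * pochhammer (1 - real n - c) (n - j)"
proof -
  have "pochhammer (- (c + real n - 1)) (n - j) = (-1) ^ (n - j) * pochhammer ((c + real n - 1) - real (n - j) + 1) (n - j)"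
    by (rule pochhammer_minus)
  moreover have "(c + real n - 1) - real (n - j) + 1 = c + real j" using assms by (simp add: of_nat_diff)
  moreover have "- (c + real n - 1) = 1 - real n - c" by simp
  ultimately have "pochhammer (1 - real n - c) (n - j) = (-1) ^ (n - j) * pochhammer (c + real j) (n - j)"
    by (simp only:)
  then show ?thesis by simp
qed

text \<open>Reflecting the factor (c + j)_(n - j) turns the sum into the binomial theorem for
  Pochhammer symbols. In this form no division by a Pochhammer symbol of \<open>c\<close>
  occurs.\<close>

lemma chu_vandermonde:
  "(\<Sum>j\<le>n. pochhammer (- real n) j / fact j * pochhammer (c + real j) (n - j) * pochhammer x j) = pochhammer (c - x) n"
proof -
  have "(\<Sum>j\<le>n. pochhammer (- real n) j / fact j * pochhammer (c + real j) (n - j) * pochhammer x j)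
     = (\<Sum>j\<le>n. (-1) ^ n * (real (n choose j) * pochhammer x j * pochhammer (1 - real n - c) (n - j)))"
  proof (rule sum.cong[OF refl])
    fix j assume "j \<in> {..n}"
    then have j: "j \<le> n" by simp
    have s: "(-1::real) ^ n = (-1) ^ j * (-1) ^ (n - j)" using j by (simp add: power_add[symmetric])
    then show "pochhammer (- real n) j / fact j * pochhammer (c + real j) (n - j) * pochhammer x j
      = (-1) ^ n * (real (n choose j) * pochhammer x j * pochhammer (1 - real n - c) (n - j))"
      unfolding poch_neg_fact[OF j] poch_shift_reflect[OF j] s by (simp only: mult_ac)
  qed
  also have "\<dots> = (-1) ^ n * pochhammer (x + (1 - real n - c)) n"
    by (simp add: pochhammer_binomial_sum sum_distrib_left)
  also have "\<dots> = pochhammer (c - x) n"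
    using poch_shift_reflect[of 0 n "c - x"] by (simp add: algebra_simps)
  finally show ?thesis .
qed

lemma poch_0_sum:
  fixes f :: "nat \<Rightarrow> real"
  shows "(\<Sum>j\<le>n. f j * pochhammer 0 j) = f 0"
proof -
  have "(\<Sum>j\<le>n. f j * pochhammer 0 j) = (\<Sum>j\<in>{0}. f j * pochhammer 0 j)"
    by (rule sum.mono_neutral_right) (auto simp: pochhammer_0_left)
  then show ?thesis by simp
qed

lemma cont_dual_hahn_at_A: "cont_dual_hahn n A B C A = pochhammer (A + B) n * pochhammer (A + C) n"
  using poch_0_sum[of "\<lambda>j. pochhammer (- real n) j / fact j * pochhammer (A + B + real j) (n - j)
     * pochhammer (A + C + real j) (n - j) * pochhammer (A + A) j" n]
  by (simp add: cont_dual_hahn_def mult.assoc)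

text \<open>The symbol (A + C)_n splits off from every term; the rest is
  \<open>chu_vandermonde\<close> with \<open>x = A - C\<close>.\<close>

lemma cont_dual_hahn_at_C: "cont_dual_hahn n A B C C = pochhammer (A + C) n * pochhammer (B + C) n"
proof -
  have "cont_dual_hahn n A B C C = (\<Sum>j\<le>n. pochhammer (A + C) n * (pochhammer (- real n) j / fact j * pochhammer (A + B + real j) (n - j) * pochhammer (A - C) j))"
    unfolding cont_dual_hahn_def
  proof (rule sum.cong[OF refl])
    fix j assume "j \<in> {..n}"
    then have "pochhammer (A + C) n = pochhammer (A + C) j * pochhammer (A + C + real j) (n - j)"
      by (simp add: pochhammer_product)
    then show "pochhammer (- real n) j / fact j * pochhammer (A + B + real j) (n - j) * pochhammer (A + C + real j) (n - j)
       * (pochhammer (A + C) j * pochhammer (A - C) j)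
      = pochhammer (A + C) n * (pochhammer (- real n) j / fact j * pochhammer (A + B + real j) (n - j) * pochhammer (A - C) j)"
      by (simp add: mult_ac)
  qed
  also have "\<dots> = pochhammer (A + C) n * pochhammer (A + B - (A - C)) n"
    unfolding sum_distrib_left[symmetric] chu_vandermonde ..
  finally show ?thesis by (simp add: add.commute)
qed

lemma cont_dual_hahn_poly: "\<exists>p. \<forall>\<tau>. cont_dual_hahn n A B C \<tau> = poly p \<tau>"
  unfolding cont_dual_hahn_def pochhammer_prod
  by (intro exI[of _ "\<Sum>j\<le>n. smult (pochhammer (- real n) j / fact j * pochhammer (A + B + real j) (n - j)
     * pochhammer (A + C + real j) (n - j)) ((\<Prod>i = 0..<j. [:A + real i, 1:]) * (\<Prod>i = 0..<j. [:A + real i, - 1:]))"])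
     (auto simp: poly_sum poly_prod pochhammer_prod intro!: sum.cong prod.cong arg_cong2[of _ _ _ _ "(*)"])

text \<open>
  The difference of the two sides has period \<open>1\<close> by \<open>cont_dual_hahn_diff\<close> and induction, hence is constant,
  and it vanishes at \<open>\<tau> = C\<close>.
\<close>
lemma cont_dual_hahn_sym: "cont_dual_hahn n A B C \<tau> = cont_dual_hahn n C B A \<tau>"
proof (induction n arbitrary: A B C \<tau>)
  case 0
  then show ?case by (simp add: cont_dual_hahn_def)
next
  case (Suc n)
  obtain p q where p: "\<And>\<tau>. cont_dual_hahn (Suc n) A B C \<tau> = poly p \<tau>" and q: "\<And>\<tau>. cont_dual_hahn (Suc n) C B A \<tau> = poly q \<tau>"
    using cont_dual_hahn_poly by metis
  have per: "poly (p - q) (\<tau> + 1) = poly (p - q) \<tau>" for \<tau>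
  proof -
    have "cont_dual_hahn (Suc n) A B C (\<tau> + 1) - cont_dual_hahn (Suc n) A B C \<tau> = cont_dual_hahn (Suc n) C B A (\<tau> + 1) - cont_dual_hahn (Suc n) C B A \<tau>"
      using cont_dual_hahn_diff[of n A B C "\<tau> + 1/2"] cont_dual_hahn_diff[of n C B A "\<tau> + 1/2"] Suc.IH[of "A + 1/2" "B + 1/2" "C + 1/2" "\<tau> + 1/2"]
      by (simp add: add_ac)
    then show ?thesis by (simp add: p q)
  qed
  have "poly (p - q) C = 0"
    using cont_dual_hahn_at_C[of "Suc n" A B C] cont_dual_hahn_at_A[of "Suc n" C B A] by (simp add: p[symmetric] q[symmetric] add.commute mult.commute)
  then have z: "poly (p - q) (C + real k) = 0" for k
  proof (induction k)
    case (Suc k)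
    then show ?case using per[of "C + real k"] by (simp add: add_ac)
  qed simp
  have "p - q = 0"
  proof (rule ccontr)
    assume "p - q \<noteq> 0"
    then have "finite {x. poly (p - q) x = 0}" by (rule poly_roots_finite)
    moreover have "range (\<lambda>k. C + real k) \<subseteq> {x. poly (p - q) x = 0}" using z by auto
    ultimately have "finite (range (\<lambda>k. C + real k))" by (rule rev_finite_subset)
    then show False by (subst (asm) finite_image_iff) (auto simp: inj_on_def)
  qed
  then show ?case by (simp add: p q)
qed

lemma cont_dual_hahn_perm: "cont_dual_hahn n A B C \<tau> = cont_dual_hahn n B C A \<tau>"
  using cont_dual_hahn_swap cont_dual_hahn_sym by metis

text \<open>Up to sign, the ratio of the two polynomials in \<open>cont_dual_hahn_factor\<close>. It
  has degree \<open>2 * k\<close> in \<open>\<tau>\<close> and half-integral zeros.\<close>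

definition shift_factor :: "nat \<Rightarrow> real \<Rightarrow> real" where
  "shift_factor k \<tau> = pochhammer (1/2 - real k + \<tau>) k * pochhammer (1/2 - real k - \<tau>) k"

lemma poch_fact: "pochhammer (1 + real i) j * fact i = fact (i + j)"
proof -
  have "pochhammer (1::real) (i + j) = pochhammer 1 i * pochhammer (1 + real i) j"
    by (rule pochhammer_product') 
  then show ?thesis by (simp add: pochhammer_fact mult.commute)
qed

text \<open>By symmetry the sum may be expanded around the parameter 1/2 - k. Then (1 - k + j)_(v +
  k - j) vanishes for j < k, every other term contains \<open>shift_factor k\<close>, and after j =
  i + k the rest is the expansion around 1/2 with further parameter 1/2 + k.\<close>

lemma cont_dual_hahn_factor: "cont_dual_hahn (v + k) A (1/2) (1/2 - real k) \<tau> = (-1) ^ k * shift_factor k \<tau> * cont_dual_hahn v A (1/2) (1/2 + real k) \<tau>"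
proof -
  let ?u = "v + k"
  let ?g = "\<lambda>j. pochhammer (- real ?u) j / fact j * pochhammer (1/2 - real k + 1/2 + real j) (?u - j)
     * pochhammer (1/2 - real k + A + real j) (?u - j) * (pochhammer (1/2 - real k + \<tau>) j * pochhammer (1/2 - real k - \<tau>) j)"
  let ?r = "\<lambda>i. (-1) ^ k * shift_factor k \<tau> * (pochhammer (- real v) i / fact i * pochhammer (1/2 + (1/2 + real k) + real i) (v - i)
     * pochhammer (1/2 + A + real i) (v - i) * (pochhammer (1/2 + \<tau>) i * pochhammer (1/2 - \<tau>) i))"
  have "cont_dual_hahn ?u A (1/2) (1/2 - real k) \<tau> = cont_dual_hahn ?u (1/2 - real k) (1/2) A \<tau>" by (rule cont_dual_hahn_sym)
  also have "\<dots> = (\<Sum>j\<le>?u. ?g j)" by (simp only: cont_dual_hahn_def)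
  also have "\<dots> = (\<Sum>j = k..?u. ?g j)"
  proof (rule sum.mono_neutral_right)
    show "\<forall>j\<in>{..?u} - {k..?u}. ?g j = 0"
    proof
      fix j assume "j \<in> {..?u} - {k..?u}"
      then have j: "j < k" by auto
      have "1/2 - real k + 1/2 + real j = - real (k - 1 - j)" using j by (simp add: of_nat_diff)
      moreover have "pochhammer (- real (k - 1 - j)) (?u - j) = 0"
        by (rule pochhammer_of_nat_eq_0_lemma) (use j in auto)
      ultimately have "pochhammer (1/2 - real k + 1/2 + real j) (?u - j) = 0" by (simp only:)
      then show "?g j = 0" by (simp only: mult_zero_left mult_zero_right)
    qed
  qed auto
  also have "\<dots> = (\<Sum>i\<le>v. ?g (i + k))"
    by (rule sum.reindex_bij_witness[of _ "\<lambda>i. i + k" "\<lambda>j. j - k"]) auto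
  also have "\<dots> = (\<Sum>i\<le>v. ?r i)"
  proof (rule sum.cong[OF refl])
    fix i assume "i \<in> {..v}"
    then have i: "i \<le> v" by simp
    have 1: "pochhammer (1/2 - real k + \<tau>) (i + k) = pochhammer (1/2 - real k + \<tau>) k * pochhammer (1/2 + \<tau>) i"
      using pochhammer_product'[of "1/2 - real k + \<tau>" k i] by (simp add: add.commute)
    have 2: "pochhammer (1/2 - real k - \<tau>) (i + k) = pochhammer (1/2 - real k - \<tau>) k * pochhammer (1/2 - \<tau>) i"
      using pochhammer_product'[of "1/2 - real k - \<tau>" k i] by (simp add: add.commute)
    have 3: "1/2 - real k + A + real (i + k) = 1/2 + A + real i" "?u - (i + k) = v - i"
      "1/2 - real k + 1/2 + real (i + k) = 1 + real i" "1/2 + (1/2 + real k) + real i = 1 + real (k + i)"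
      by simp_all
    have ik: "i + k \<le> ?u" using i by simp
    have 4: "real (?u choose (i + k)) * pochhammer (1 + real i) (v - i) = real (v choose i) * pochhammer (1 + real (k + i)) (v - i)"
    proof -
      have b1: "fact (i + k) * fact (v - i) * real (?u choose (i + k)) = fact ?u"
        using arg_cong[OF binomial_fact_lemma[OF ik], of real] unfolding 3 of_nat_mult of_nat_fact .
      have b2: "fact i * fact (v - i) * real (v choose i) = fact v"
        using arg_cong[OF binomial_fact_lemma[OF i], of real] unfolding of_nat_mult of_nat_fact .
      have p1: "pochhammer (1 + real i) (v - i) * fact i = fact v"
        using poch_fact[of i "v - i"] i by simp
      have p2: "pochhammer (1 + real (k + i)) (v - i) * fact (k + i) = fact ?u"
        using poch_fact[of "k + i" "v - i"] i by (simp add: add.commute)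
      have "real (?u choose (i + k)) * pochhammer (1 + real i) (v - i) * (fact (i + k) * fact (v - i) * fact i)
         = (fact (i + k) * fact (v - i) * real (?u choose (i + k))) * (pochhammer (1 + real i) (v - i) * fact i)"
        by (simp only: mult_ac)
      also have "\<dots> = fact v * fact ?u" unfolding b1 p1 by (rule mult.commute)
      also have "\<dots> = (fact i * fact (v - i) * real (v choose i)) * (pochhammer (1 + real (k + i)) (v - i) * fact (k + i))"
        unfolding b2 p2 ..
      also have "\<dots> = real (v choose i) * pochhammer (1 + real (k + i)) (v - i) * (fact (i + k) * fact (v - i) * fact i)"
        by (simp only: mult_ac add.commute[of k i])
      finally show ?thesis by simp
    qed
    have "?g (i + k) = (-1) ^ (i + k) * (real (?u choose (i + k)) * pochhammer (1 + real i) (v - i)) * pochhammer (1/2 + A + real i) (v - i)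
        * (pochhammer (1/2 - real k + \<tau>) k * pochhammer (1/2 + \<tau>) i * (pochhammer (1/2 - real k - \<tau>) k * pochhammer (1/2 - \<tau>) i))"
      unfolding 1 2 3 poch_neg_fact[OF ik] by (simp only: mult_ac)
    also have "\<dots> = ?r i"
      unfolding 3 4 poch_neg_fact[OF i] shift_factor_def power_add by (simp only: mult_ac)
    finally show "?g (i + k) = ?r i" .
  qed
  also have "\<dots> = (-1) ^ k * shift_factor k \<tau> * cont_dual_hahn v (1/2) (1/2 + real k) A \<tau>"
    unfolding cont_dual_hahn_def sum_distrib_left ..
  also have "cont_dual_hahn v (1/2) (1/2 + real k) A \<tau> = cont_dual_hahn v A (1/2) (1/2 + real k) \<tau>"
    using cont_dual_hahn_perm by metis
  finally show ?thesis .
qed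

text \<open>With A = 1/2 - a, B = 1/2 and C = - M - A one has A + B = 1 - a and A + C = - M,
  matching the denominators, and each factor of the basis products becomes minus (A + i + \<tau>)(A
  + i - \<tau>).\<close>

lemma dual_hahn_cont_dual_hahn:
  assumes "dual_hahn_defined n (- a) M"
  shows "pochhammer (1 - a) n * pochhammer (- M) n * poly (dual_hahn n (- a) (- a) M) (\<tau>\<^sup>2 - (a - 1/2)\<^sup>2)
    = cont_dual_hahn n (1/2 - a) (1/2) (- M - (1/2 - a)) \<tau>"
proof -
  have D: "pochhammer (1 - a) j \<noteq> 0" "pochhammer (- M) j \<noteq> 0" if "j \<le> n" for j
    using assms that by (auto simp: dual_hahn_defined_def)
  let ?x = "\<tau>\<^sup>2 - (a - 1/2)\<^sup>2"
  have P: "(-1) ^ j * (\<Prod>i<j. ?x - real i * (- a + - a + 1 + real i)) = pochhammer (1/2 - a + \<tau>) j * pochhammer (1/2 - a - \<tau>) j" for j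
  proof -
    have "(-1) ^ j * (\<Prod>i<j. ?x - real i * (- a + - a + 1 + real i)) = (\<Prod>i<j. (-1) * (?x - real i * (- a + - a + 1 + real i)))"
      by (subst prod.distrib) simp
    also have "\<dots> = (\<Prod>i<j. (1/2 - a + \<tau> + real i) * (1/2 - a - \<tau> + real i))"
      by (intro prod.cong refl) (simp add: power2_eq_square algebra_simps)
    also have "\<dots> = pochhammer (1/2 - a + \<tau>) j * pochhammer (1/2 - a - \<tau>) j"
      by (simp add: prod.distrib pochhammer_prod atLeast0LessThan)
    finally show ?thesis .
  qed
  have "poly (dual_hahn n (- a) (- a) M) ?x = (\<Sum>j\<le>n. pochhammer (- real n) j / (pochhammer (1 - a) j * pochhammer (- M) j * fact j)
     * ((-1) ^ j * (\<Prod>i<j. ?x - real i * (- a + - a + 1 + real i))))"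
    unfolding dual_hahn_def poly_sum poly_smult poly_prod
    by (intro sum.cong refl) (simp add: mult_ac)
  also have "pochhammer (1 - a) n * pochhammer (- M) n * \<dots> = cont_dual_hahn n (1/2 - a) (1/2) (- M - (1/2 - a)) \<tau>"
    unfolding cont_dual_hahn_def sum_distrib_left P
  proof (rule sum.cong[OF refl])
    fix j assume "j \<in> {..n}"
    then have j: "j \<le> n" by simp
    have e: "1/2 - a + 1/2 + real j = 1 - a + real j" "1/2 - a + (- M - (1/2 - a)) + real j = - M + real j" by simp_all
    have s: "pochhammer (1 - a) n = pochhammer (1 - a) j * pochhammer (1 - a + real j) (n - j)"
      "pochhammer (- M) n = pochhammer (- M) j * pochhammer (- M + real j) (n - j)"
      by (rule pochhammer_product[OF j])+
    show "pochhammer (1 - a) n * pochhammer (- M) n * (pochhammer (- real n) j / (pochhammer (1 - a) j * pochhammer (- M) j * fact j) * (pochhammer (1/2 - a + \<tau>) j * pochhammer (1/2 - a - \<tau>) j))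
      = pochhammer (- real n) j / fact j * pochhammer (1/2 - a + 1/2 + real j) (n - j) * pochhammer (1/2 - a + (- M - (1/2 - a)) + real j) (n - j) * (pochhammer (1/2 - a + \<tau>) j * pochhammer (1/2 - a - \<tau>) j)"
      unfolding e s using D[OF j] by (simp add: field_simps)
  qed
  finally show ?thesis .
qed

lemma shift_factor_shift: "shift_factor k (\<tau> + 2) * ((1/2 - real k + \<tau>) * (3/2 - real k + \<tau>)) = shift_factor k \<tau> * ((1/2 + real k + \<tau>) * (3/2 + real k + \<tau>))"
proof -
  have P: "shift_factor k \<tau> = (-1) ^ k * pochhammer (1/2 - real k + \<tau>) (2 * k)" for \<tau>
  proof -
    have "pochhammer (1/2 - real k - \<tau>) k = (-1) ^ k * pochhammer (1/2 + \<tau>) k"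
      using pochhammer_minus[of "\<tau> + real k - 1/2" k] by (simp add: algebra_simps)
    moreover have "pochhammer (1/2 - real k + \<tau>) (2 * k) = pochhammer (1/2 - real k + \<tau>) k * pochhammer (1/2 + \<tau>) k"
      using pochhammer_product'[of "1/2 - real k + \<tau>" k k] by (simp add: mult_2)
    ultimately show ?thesis by (simp add: shift_factor_def)
  qed
  have G: "pochhammer (z + 2) m * (z * (z + 1)) = pochhammer z m * ((z + real m) * (z + real m + 1))" for z :: real and m
  proof -
    have "pochhammer z (Suc (Suc m)) = z * ((z + 1) * pochhammer (z + 1 + 1) m)" by (simp only: pochhammer_rec)
    moreover have "pochhammer z (Suc (Suc m)) = pochhammer z m * (z + real m) * (z + real (Suc m))" by (simp only: pochhammer_Suc)
    moreover have "z + 1 + 1 = z + 2" by simp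
    ultimately show ?thesis by (simp add: mult_ac add_ac)
  qed
  show ?thesis
  proof -
    have e: "1/2 - real k + \<tau> + 2 = 1/2 - real k + (\<tau> + 2)" "1/2 - real k + \<tau> + 1 = 3/2 - real k + \<tau>"
      "1/2 - real k + \<tau> + real (2 * k) = 1/2 + real k + \<tau>" "1/2 + real k + \<tau> + 1 = 3/2 + real k + \<tau>"
      by simp_all
    show ?thesis using G[of "1/2 - real k + \<tau>" "2 * k"] unfolding P e by (simp only: mult.assoc)
  qed
qed

lemma wtp_ratio:
  assumes "Suc l \<le> k"
  shows "poly (wtp b k l) t * ((t + real k - 2 * real (Suc l) + b + 1) * (t + real k - 2 * real (Suc l) + b + 2))
    = poly (wtp b k (Suc l)) t * ((t + real k - 2 * real (Suc l) - b) * (t + real k - 2 * real (Suc l) - b + 1))"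
proof -
  have e: "2 * (k - l) = Suc (Suc (2 * (k - Suc l)))" "2 * Suc l = Suc (Suc (2 * l))" using assms by auto
  have r: "real (2 * (k - Suc l)) = 2 * real k - 2 * real (Suc l)" using assms by (simp add: of_nat_diff)
  define D where "D = (\<Prod>i<2 * l. poly [:b + real k - real i, 1:] t)"
  define E where "E = (\<Prod>i<2 * (k - Suc l). poly [:- b - real k + real i, 1:] t)"
  define x where "x = t + real k - 2 * real (Suc l)"
  have p: "poly [:b + real k - real (2 * l), 1:] t = x + b + 2" "poly [:b + real k - real (Suc (2 * l)), 1:] t = x + b + 1"
    "poly [:- b - real k + real (2 * (k - Suc l)), 1:] t = x - b" "poly [:- b - real k + real (Suc (2 * (k - Suc l))), 1:] t = x - b + 1"
    unfolding of_nat_Suc[of "2 * (k - Suc l)"] r by (simp_all add: x_def)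
  have 1: "poly (wtp b k l) t = D * (E * (x - b) * (x - b + 1))"
    unfolding wtp_def poly_mult poly_prod e(1) prod.lessThan_Suc p D_def E_def ..
  have 2: "poly (wtp b k (Suc l)) t = D * (x + b + 2) * (x + b + 1) * E"
    unfolding wtp_def poly_mult poly_prod e(2) prod.lessThan_Suc p D_def E_def ..
  show ?thesis
    unfolding x_def[symmetric] 1 2 by (simp only: mult_ac)
qed

lemma det_proportional_rows:
  fixes M :: "'a::idom mat"
  assumes M: "M \<in> carrier_mat n n" and ij: "i < n" "j < n" "i \<noteq> j" and p: "p \<noteq> 0"
    and eq: "\<And>l. l < n \<Longrightarrow> p * M $$ (i, l) = q * M $$ (j, l)"
  shows "det M = 0"
proof -
  let ?v = "vec n (\<lambda>h. if h = i then p else if h = j then - q else 0)"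
  have "transpose_mat M *\<^sub>v ?v = 0\<^sub>v n"
  proof (rule eq_vecI)
    fix l assume l: "l < dim_vec (0\<^sub>v n :: 'a vec)"
    have "(transpose_mat M *\<^sub>v ?v) $ l = (\<Sum>h<n. M $$ (h, l) * (if h = i then p else if h = j then - q else 0))"
      using M l by (simp add: scalar_prod_def atLeast0LessThan)
    also have "\<dots> = (\<Sum>h\<in>{i, j}. M $$ (h, l) * (if h = i then p else if h = j then - q else 0))"
      by (rule sum.mono_neutral_right) (use ij in auto)
    also have "\<dots> = 0" using eq[of l] l ij by (simp add: mult.commute)
    finally show "(transpose_mat M *\<^sub>v ?v) $ l = 0\<^sub>v n $ l" using l by simp
  qed (use M in auto)
  moreover have "?v \<noteq> 0\<^sub>v n"
  proof
    assume "?v = 0\<^sub>v n"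
    then have "?v $ i = 0\<^sub>v n $ i" by (simp only:)
    with ij p show False by simp
  qed
  ultimately have "det (transpose_mat M) = 0"
    using det_0_iff_vec_prod_zero[of "transpose_mat M" n] M by (metis transpose_carrier_mat vec_carrier)
  then show ?thesis using det_transpose[OF M] by simp
qed

text \<open>By \<open>wtp_ratio\<close> and \<open>shift_factor_shift\<close>, neighbouring columns
  change the weight by the inverse of the change of \<open>shift_factor k\<close> if
  \<open>b + 1/2 = k\<close>, and by the same quotient if \<open>b + 1/2 = - k\<close>. Either way
  rows \<open>i\<close> and \<open>j\<close> are proportional.\<close>

lemma det_Emat_degenerate:
  assumes ij: "i < m1" "m1 \<le> j" "j < n"
    and b: "(b + 1/2 = real k \<and> (\<forall>\<tau>. poly (f i) \<tau> = c * shift_factor k \<tau> * poly (f j) \<tau>))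
        \<or> (b + 1/2 = - real k \<and> (\<forall>\<tau>. poly (f j) \<tau> = c * shift_factor k \<tau> * poly (f i) \<tau>))"
    and c: "c \<noteq> 0"
  shows "det (Emat b n m1 f) = 0"
proof -
  \<comment> \<open>\<open>poly_eq_nonint\<close> excludes integral arguments, whereas here the
    half-integral zeros of \<open>shift_factor\<close> must be avoided; the translation by 1/2
    exchanges the two.\<close>
  have "sh (- 1/2) (det (Emat b n m1 f)) = 0"
  proof (rule poly_eq_nonint)
    fix t' :: real assume t': "t' \<notin> \<int>"
    define t where "t = t' - 1/2"
    define \<tau> where "\<tau> l = t + (real n - 1 - 2 * real l)" for l :: nat
    define K where "K = n - 1"
    have nK: "real n - 1 = real K" using ij by (simp add: K_def)
    have half: "t + 1/2 + of_int z \<noteq> 0" for z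
    proof
      assume "t + 1/2 + of_int z = 0"
      then have "t' = of_int (- z)" by (simp add: t_def)
      with t' show False using Ints_of_int by metis
    qed
    have bk: "b = real k - 1/2 \<or> b = - real k - 1/2" using b by auto
    have step: "(b + 1/2 = real k \<longrightarrow> poly (wtp b K l) t * shift_factor k (\<tau> l) = poly (wtp b K (Suc l)) t * shift_factor k (\<tau> (Suc l)))
       \<and> (b + 1/2 = - real k \<longrightarrow> poly (wtp b K l) t * shift_factor k (\<tau> (Suc l)) = poly (wtp b K (Suc l)) t * shift_factor k (\<tau> l))" if l: "Suc l \<le> K" for l
    proof -
      let ?x = "\<tau> (Suc l)"
      have x: "\<tau> l = ?x + 2" by (simp add: \<tau>_def)
      have R: "poly (wtp b K l) t * ((?x + b + 1) * (?x + b + 2)) = poly (wtp b K (Suc l)) t * ((?x - b) * (?x - b + 1))"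
        using wtp_ratio[OF l, of b t] by (simp add: \<tau>_def nK algebra_simps)
      have nz: "1/2 - real k + ?x \<noteq> 0" "3/2 - real k + ?x \<noteq> 0" "1/2 + real k + ?x \<noteq> 0" "3/2 + real k + ?x \<noteq> 0"
        using half[of "int n - 1 - 2 * int (Suc l) - int k"] half[of "int n - 2 * int (Suc l) - int k"]
          half[of "int n - 1 - 2 * int (Suc l) + int k"] half[of "int n - 2 * int (Suc l) + int k"]
        by (auto simp: \<tau>_def)
      note S = shift_factor_shift[of k ?x]
      show ?thesis
      proof (intro conjI impI)
        assume "b + 1/2 = real k"
        then have b': "b = real k - 1/2" by simp
        define y1 y2 where "y1 = (1/2 - real k + ?x) * (3/2 - real k + ?x)" and "y2 = (1/2 + real k + ?x) * (3/2 + real k + ?x)"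
        have y1: "y1 \<noteq> 0" using nz by (simp add: y1_def)
        have R': "poly (wtp b K l) t * y2 = poly (wtp b K (Suc l)) t * y1"
        proof -
          have "(?x - b) * (?x - b + 1) = y1" "(?x + b + 1) * (?x + b + 2) = y2"
            unfolding y1_def y2_def b' by (simp_all add: algebra_simps)
          with R show ?thesis by (simp only:)
        qed
        have S': "shift_factor k (\<tau> l) * y1 = shift_factor k ?x * y2" using S unfolding x y1_def y2_def .
        have "poly (wtp b K l) t * shift_factor k (\<tau> l) * y1 = (poly (wtp b K l) t * y2) * shift_factor k ?x"
          using S' by (simp add: mult_ac)
        also have "\<dots> = poly (wtp b K (Suc l)) t * shift_factor k ?x * y1" unfolding R' by (simp add: mult_ac)
        finally show "poly (wtp b K l) t * shift_factor k (\<tau> l) = poly (wtp b K (Suc l)) t * shift_factor k ?x" using y1 by simp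
      next
        assume "b + 1/2 = - real k"
        then have b': "b = - real k - 1/2" by simp
        define y1 y2 where "y1 = (1/2 - real k + ?x) * (3/2 - real k + ?x)" and "y2 = (1/2 + real k + ?x) * (3/2 + real k + ?x)"
        have y1: "y1 \<noteq> 0" using nz by (simp add: y1_def)
        have R': "poly (wtp b K l) t * y1 = poly (wtp b K (Suc l)) t * y2"
        proof -
          have "(?x - b) * (?x - b + 1) = y2" "(?x + b + 1) * (?x + b + 2) = y1"
            unfolding y1_def y2_def b' by (simp_all add: algebra_simps)
          with R show ?thesis by (simp only:)
        qed
        have S': "shift_factor k (\<tau> l) * y1 = shift_factor k ?x * y2" using S unfolding x y1_def y2_def .
        have "poly (wtp b K l) t * shift_factor k ?x * y1 = (poly (wtp b K l) t * y1) * shift_factor k ?x"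
          by (simp add: mult_ac)
        also have "\<dots> = poly (wtp b K (Suc l)) t * (shift_factor k ?x * y2)" unfolding R' by (simp add: mult_ac)
        also have "\<dots> = poly (wtp b K (Suc l)) t * shift_factor k (\<tau> l) * y1" unfolding S'[symmetric] by (simp add: mult_ac)
        finally show "poly (wtp b K l) t * shift_factor k ?x = poly (wtp b K (Suc l)) t * shift_factor k (\<tau> l)" using y1 by simp
      qed
    qed
    have Pnz: "shift_factor k (\<tau> l) \<noteq> 0" for l
    proof -
      have "1/2 - real k + \<tau> l + real i \<noteq> 0" "1/2 - real k - \<tau> l + real i \<noteq> 0" for i
        using half[of "int n - 1 - 2 * int l - int k + int i"] half[of "int n - 1 - 2 * int l + int k - int i - 1"]
        by (auto simp: \<tau>_def)
      then show ?thesis by (auto simp: shift_factor_def pochhammer_prod)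
    qed
    have all1: "poly (wtp b K l) t * shift_factor k (\<tau> l) = poly (wtp b K 0) t * shift_factor k (\<tau> 0)" if "l \<le> K" "b + 1/2 = real k" for l
      using that(1)
    proof (induction l)
      case (Suc l)
      have "poly (wtp b K (Suc l)) t * shift_factor k (\<tau> (Suc l)) = poly (wtp b K l) t * shift_factor k (\<tau> l)"
        by (rule mp[OF conjunct1[OF step[OF Suc.prems]] that(2), symmetric])
      also have "\<dots> = poly (wtp b K 0) t * shift_factor k (\<tau> 0)" using Suc by simp
      finally show ?case .
    qed simp
    have all2: "poly (wtp b K l) t * shift_factor k (\<tau> 0) = poly (wtp b K 0) t * shift_factor k (\<tau> l)" if "l \<le> K" "b + 1/2 = - real k" for l
      using that(1)
    proof (induction l)
      case (Suc l)
      have IH: "poly (wtp b K l) t * shift_factor k (\<tau> 0) = poly (wtp b K 0) t * shift_factor k (\<tau> l)"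
        using Suc by simp
      have st: "poly (wtp b K l) t * shift_factor k (\<tau> (Suc l)) = poly (wtp b K (Suc l)) t * shift_factor k (\<tau> l)"
        by (rule mp[OF conjunct2[OF step[OF Suc.prems]] that(2)])
      have "poly (wtp b K (Suc l)) t * shift_factor k (\<tau> 0) * shift_factor k (\<tau> l) = (poly (wtp b K (Suc l)) t * shift_factor k (\<tau> l)) * shift_factor k (\<tau> 0)"
        by (simp only: mult_ac)
      also have "\<dots> = (poly (wtp b K l) t * shift_factor k (\<tau> 0)) * shift_factor k (\<tau> (Suc l))"
        unfolding st[symmetric] by (simp only: mult_ac)
      also have "\<dots> = poly (wtp b K 0) t * shift_factor k (\<tau> (Suc l)) * shift_factor k (\<tau> l)"
        unfolding IH by (simp only: mult_ac)
      finally show ?case using Pnz[of l] by simp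
    qed simp
    let ?M = "map_mat (\<lambda>p. poly p t) (Emat b n m1 f)"
    have Mi: "?M $$ (i, l) = poly (wtp b K l) t * poly (f i) (\<tau> l)" and Mj: "?M $$ (j, l) = poly (f j) (\<tau> l)" if "l < n" for l
      using that ij by (auto simp: Emat_def rw_def K_def \<tau>_def)
    have "det ?M = 0"
    proof (cases "b + 1/2 = real k \<and> (\<forall>\<tau>. poly (f i) \<tau> = c * shift_factor k \<tau> * poly (f j) \<tau>)")
      case True
      then have fi: "poly (f i) x = c * shift_factor k x * poly (f j) x" for x by blast
      show ?thesis
      proof (rule det_proportional_rows[of _ n i j 1 "c * (poly (wtp b K 0) t * shift_factor k (\<tau> 0))"])
        fix l assume l: "l < n"
        have "1 * ?M $$ (i, l) = c * (poly (wtp b K l) t * shift_factor k (\<tau> l)) * poly (f j) (\<tau> l)"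
          unfolding Mi[OF l] fi by (simp add: mult_ac)
        also have "poly (wtp b K l) t * shift_factor k (\<tau> l) = poly (wtp b K 0) t * shift_factor k (\<tau> 0)"
          using all1[of l] True l by (simp add: K_def)
        finally show "1 * ?M $$ (i, l) = c * (poly (wtp b K 0) t * shift_factor k (\<tau> 0)) * ?M $$ (j, l)"
          unfolding Mj[OF l] .
      qed (use ij in auto)
    next
      case False
      then have b2: "b + 1/2 = - real k" and fj: "\<And>x. poly (f j) x = c * shift_factor k x * poly (f i) x" using b by blast+
      show ?thesis
      proof (rule det_proportional_rows[of _ n i j "c * shift_factor k (\<tau> 0)" "poly (wtp b K 0) t"])
        fix l assume l: "l < n"
        have "c * shift_factor k (\<tau> 0) * ?M $$ (i, l) = c * (poly (wtp b K l) t * shift_factor k (\<tau> 0)) * poly (f i) (\<tau> l)"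
          unfolding Mi[OF l] by (simp add: mult_ac)
        also have "poly (wtp b K l) t * shift_factor k (\<tau> 0) = poly (wtp b K 0) t * shift_factor k (\<tau> l)"
          using all2[of l] b2 l by (simp add: K_def)
        finally show "c * shift_factor k (\<tau> 0) * ?M $$ (i, l) = poly (wtp b K 0) t * ?M $$ (j, l)"
          unfolding Mj[OF l] fj by (simp add: mult_ac)
      qed (use ij c Pnz in auto)
    qed
    then show "poly (sh (- 1/2) (det (Emat b n m1 f))) t' = poly 0 t'"
      by (simp add: poly_det t_def)
  qed
  then have "poly (sh (- 1/2) (det (Emat b n m1 f))) (x + 1/2) = 0" for x by simp
  then have "poly (det (Emat b n m1 f)) x = 0" for x by simp
  then show ?thesis using poly_all_0_iff_0 by blast
qed

section \<open>Orders of difference operators\<close>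

lemma shift_op_sh: "shift_op l f = sh (of_int l) f"
  by (simp add: shift_op_def sh_def)

lemma sh_mult: "sh h (f * g) = sh h f * sh h g"
  and sh_sum: "sh h (\<Sum>i\<in>I. F i) = (\<Sum>i\<in>I. sh h (F i))"
  and sh_sh: "sh h (sh h' f) = sh (h + h') f"
  by (auto intro!: poly_ext simp: poly_sum add_ac)

text \<open>
  Only the two extreme coefficients matter for the order, and of these only the terms of degree \<open>e\<close>;
  both may vanish.
\<close>
definition diffop_lead :: "(real poly \<Rightarrow> real poly) \<Rightarrow> nat \<Rightarrow> nat \<Rightarrow> real \<Rightarrow> real \<Rightarrow> bool" where
  "diffop_lead T k e c c' \<longleftrightarrow> (\<exists>h. (\<forall>f. T f = (\<Sum>l\<in>{- int k..int k}. h l * shift_op l f))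
     \<and> lead (h (int k)) (int e) c \<and> lead (h (- int k)) (int e) c')"

lemma diffop_lead_zero: "diffop_lead (\<lambda>_. 0) k e 0 0"
  unfolding diffop_lead_def by (rule exI[of _ "\<lambda>_. 0"]) simp

lemma diffop_lead_id: "diffop_lead (\<lambda>f. f) 0 0 1 1"
  unfolding diffop_lead_def
  by (rule exI[of _ "\<lambda>_. 1"]) (simp add: shift_op_sh sh_def lead_nat[of 1 0 1, simplified])

lemma diffop_lead_add:
  assumes "diffop_lead T k e c c'" "diffop_lead T' k e d d'"
  shows "diffop_lead (\<lambda>f. T f + T' f) k e (c + d) (c' + d')"
proof -
  obtain h where h: "\<And>f. T f = (\<Sum>l\<in>{- int k..int k}. h l * shift_op l f)"
    "lead (h (int k)) (int e) c" "lead (h (- int k)) (int e) c'" using assms(1) unfolding diffop_lead_def by blast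
  obtain h' where h': "\<And>f. T' f = (\<Sum>l\<in>{- int k..int k}. h' l * shift_op l f)"
    "lead (h' (int k)) (int e) d" "lead (h' (- int k)) (int e) d'" using assms(2) unfolding diffop_lead_def by blast
  show ?thesis unfolding diffop_lead_def
    using h h' by (intro exI[of _ "\<lambda>l. h l + h' l"]) (auto intro: lead_add simp: distrib_right sum.distrib)
qed

lemma diffop_lead_smult:
  assumes "diffop_lead T k e c c'"
  shows "diffop_lead (\<lambda>f. smult s (T f)) k e (s * c) (s * c')"
proof -
  obtain h where h: "\<And>f. T f = (\<Sum>l\<in>{- int k..int k}. h l * shift_op l f)"
    "lead (h (int k)) (int e) c" "lead (h (- int k)) (int e) c'" using assms(1) unfolding diffop_lead_def by blast
  have "smult s (T f) = (\<Sum>l\<in>{- int k..int k}. smult s (h l) * shift_op l f)" for f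
    unfolding h(1) by (rule poly_ext) (simp add: poly_sum sum_distrib_left mult.assoc)
  then show ?thesis unfolding diffop_lead_def
    using h by (intro exI[of _ "\<lambda>l. smult s (h l)"]) (auto intro: lead_smult)
qed

lemma diffop_lead_sum_0:
  "finite I \<Longrightarrow> (\<And>i. i \<in> I \<Longrightarrow> diffop_lead (T i) k e 0 0) \<Longrightarrow> diffop_lead (\<lambda>f. \<Sum>i\<in>I. T i f) k e 0 0"
proof (induction I rule: finite_induct)
  case empty
  then show ?case by (simp add: diffop_lead_zero)
next
  case (insert x F)
  then show ?case using diffop_lead_add[of "T x" k e 0 0 "\<lambda>f. \<Sum>i\<in>F. T i f" 0 0] by simp
qed

lemma diffop_lead_weaken:
  assumes "diffop_lead T k e c c'" "k < k' \<or> (k = k' \<and> e < e')"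
  shows "diffop_lead T k' e' 0 0"
proof -
  obtain h where h: "\<And>f. T f = (\<Sum>l\<in>{- int k..int k}. h l * shift_op l f)"
    "lead (h (int k)) (int e) c" "lead (h (- int k)) (int e) c'" using assms(1) unfolding diffop_lead_def by blast
  show ?thesis
  proof (cases "k = k'")
    case True
    then show ?thesis using h assms(2) unfolding diffop_lead_def
      by (intro exI[of _ h]) (auto intro: lead_mono)
  next
    case False
    then have k: "k < k'" using assms(2) by auto
    have "(\<Sum>l\<in>{- int k..int k}. h l * shift_op l f)
        = (\<Sum>l\<in>{- int k'..int k'}. (if l \<in> {- int k..int k} then h l else 0) * shift_op l f)" for f
      using k by (intro sum.mono_neutral_cong_left) auto
    then show ?thesis using k h(1) unfolding diffop_lead_def
      by (intro exI[of _ "\<lambda>l. if l \<in> {- int k..int k} then h l else 0"]) auto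
  qed
qed

text \<open>An extreme shift of the composition arises from one pair of shifts only, the two extreme
  ones, so no cancellation has to be considered.\<close>

lemma diffop_lead_comp:
  assumes "diffop_lead T k e c c'" "diffop_lead T' k2 e2 d d'"
  shows "diffop_lead (\<lambda>f. T (T' f)) (k + k2) (e + e2) (c * d) (c' * d')"
proof -
  obtain h where h: "\<And>f. T f = (\<Sum>l\<in>{- int k..int k}. h l * shift_op l f)"
    "lead (h (int k)) (int e) c" "lead (h (- int k)) (int e) c'" using assms(1) unfolding diffop_lead_def by blast
  obtain h' where h': "\<And>f. T' f = (\<Sum>l\<in>{- int k2..int k2}. h' l * shift_op l f)"
    "lead (h' (int k2)) (int e2) d" "lead (h' (- int k2)) (int e2) d'" using assms(2) unfolding diffop_lead_def by blast
  let ?I = "{- int k..int k}" and ?J = "{- int k2..int k2}" and ?L = "{- int (k + k2)..int (k + k2)}"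
  define g where "g p = (\<Sum>l\<in>?I. if p - l \<in> ?J then h l * shift_op l (h' (p - l)) else 0)" for p
  have "T (T' f) = (\<Sum>p\<in>?L. g p * shift_op p f)" for f
  proof -
    have "(\<Sum>p\<in>?L. g p * shift_op p f) = (\<Sum>l\<in>?I. \<Sum>p\<in>?L. (if p - l \<in> ?J then h l * shift_op l (h' (p - l)) else 0) * shift_op p f)"
      unfolding g_def sum_distrib_right by (rule sum.swap)
    also have "\<dots> = (\<Sum>l\<in>?I. \<Sum>m\<in>?J. h l * shift_op l (h' m) * shift_op (l + m) f)"
    proof (rule sum.cong[OF refl])
      fix l assume l: "l \<in> ?I"
      have "(\<Sum>p\<in>?L. (if p - l \<in> ?J then h l * shift_op l (h' (p - l)) else 0) * shift_op p f)
          = (\<Sum>p\<in>(\<lambda>m. l + m) ` ?J. h l * shift_op l (h' (p - l)) * shift_op p f)"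
        using l by (intro sum.mono_neutral_cong_right) (auto simp: image_iff intro: bexI[of _ "_ - l"])
      also have "\<dots> = (\<Sum>m\<in>?J. h l * shift_op l (h' m) * shift_op (l + m) f)"
        by (subst sum.reindex) (auto simp: inj_on_def)
      finally show "(\<Sum>p\<in>?L. (if p - l \<in> ?J then h l * shift_op l (h' (p - l)) else 0) * shift_op p f)
          = (\<Sum>m\<in>?J. h l * shift_op l (h' m) * shift_op (l + m) f)" .
    qed
    also have "\<dots> = T (T' f)"
      by (simp add: h(1) h'(1) shift_op_sh sh_sum sh_mult sh_sh sum_distrib_left mult.assoc)
    finally show ?thesis by simp
  qed
  moreover have "g (int (k + k2)) = h (int k) * shift_op (int k) (h' (int k2))"
  proof -
    have "g (int (k + k2)) = (\<Sum>l\<in>{int k}. if int (k + k2) - l \<in> ?J then h l * shift_op l (h' (int (k + k2) - l)) else 0)"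
      unfolding g_def by (rule sum.mono_neutral_right) auto
    then show ?thesis by simp
  qed
  moreover have "g (- int (k + k2)) = h (- int k) * shift_op (- int k) (h' (- int k2))"
  proof -
    have "g (- int (k + k2)) = (\<Sum>l\<in>{- int k}. if - int (k + k2) - l \<in> ?J then h l * shift_op l (h' (- int (k + k2) - l)) else 0)"
      unfolding g_def by (rule sum.mono_neutral_right) auto
    then show ?thesis by simp
  qed
  moreover have "lead (h (int k) * shift_op (int k) (h' (int k2))) (int (e + e2)) (c * d)"
    "lead (h (- int k) * shift_op (- int k) (h' (- int k2))) (int (e + e2)) (c' * d')"
    unfolding shift_op_sh of_nat_add by (intro lead_mult lead_sh h h')+
  ultimately show ?thesis unfolding diffop_lead_def by (intro exI[of _ g]) simp
qed

lemma lead_lin_const: "lead [:x, y:] 1 (y::real)"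
  using lead_nat[of "[:x, y:]" 1 y] by simp

lemma atLeastAtMost_1: "{- 1..1} = {-1, 0, 1::int}" by auto

lemma diffop_lead_hahn: "diffop_lead (hahn_op a N) 1 2 1 1"
  unfolding diffop_lead_def
proof (intro exI[of _ "\<lambda>l. if l = 1 then [:a + 1, 1:] * [:- N, 1:] else if l = 0 then
     - ([:a + 1, 1:] * [:- N, 1:] + [:0, 1:] * [:- a - N - 1, 1:]) else [:0, 1:] * [:- a - N - 1, 1:]"] conjI allI)
  show "lead (if int 1 = 1 then [:a + 1, 1:] * [:- N, 1:] else if int 1 = 0 then
     - ([:a + 1, 1:] * [:- N, 1:] + [:0, 1:] * [:- a - N - 1, 1:]) else [:0, 1:] * [:- a - N - 1, 1:]) (int 2) 1"
    using lead_mult[OF lead_lin_const lead_lin_const, of "a + 1" 1 "- N" 1] by simp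
  show "lead (if - int 1 = 1 then [:a + 1, 1:] * [:- N, 1:] else if - int 1 = 0 then
     - ([:a + 1, 1:] * [:- N, 1:] + [:0, 1:] * [:- a - N - 1, 1:]) else [:0, 1:] * [:- a - N - 1, 1:]) (int 2) 1"
    using lead_mult[OF lead_lin_const lead_lin_const, of 0 1 "- a - N - 1" 1] by simp
  fix f
  show "hahn_op a N f = (\<Sum>l = - int 1..int 1. (if l = 1 then [:a + 1, 1:] * [:- N, 1:] else if l = 0 then
     - ([:a + 1, 1:] * [:- N, 1:] + [:0, 1:] * [:- a - N - 1, 1:]) else [:0, 1:] * [:- a - N - 1, 1:]) * shift_op l f)"
    unfolding of_nat_1 atLeastAtMost_1 by (simp add: hahn_op_def)
qed

lemma diffop_lead_power:
  assumes "diffop_lead T k e 1 1"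
  shows "diffop_lead (T ^^ i) (i * k) (i * e) 1 1"
proof (induction i)
  case 0
  then show ?case using diffop_lead_id by (simp add: id_def)
next
  case (Suc i)
  then show ?case using diffop_lead_comp[OF assms Suc.IH] by (simp add: o_def)
qed

lemma diffop_lead_poly_op: "diffop_lead (poly_op P (hahn_op a N)) (degree P) (2 * degree P) (lead_coeff P) (lead_coeff P)"
proof -
  let ?T = "\<lambda>i f. smult (coeff P i) ((hahn_op a N ^^ i) f)"
  let ?d = "degree P"
  have D: "diffop_lead (?T i) i (2 * i) (coeff P i) (coeff P i)" for i
    using diffop_lead_smult[OF diffop_lead_power[OF diffop_lead_hahn, of i a N], of "coeff P i"] by (simp add: mult.commute)
  have "diffop_lead (\<lambda>f. \<Sum>i<?d. ?T i f) ?d (2 * ?d) 0 0"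
    by (rule diffop_lead_sum_0) (auto intro: diffop_lead_weaken[OF D])
  from diffop_lead_add[OF this D[of ?d]] show ?thesis
    by (simp add: poly_op_def[abs_def] lessThan_Suc_atMost[symmetric])
qed

text \<open>Each summand alone shifts in one direction only; the sum has reach 1 on both sides, with
  extreme coefficients of degree one.\<close>

lemma diffop_lead_D:
  "\<exists>c c'. diffop_lead (\<lambda>g. D1_op a g + D2_op a N g) 1 1 c c'"
  "\<exists>c c'. diffop_lead (\<lambda>g. D3_op a g + D4_op a N g) 1 1 c c'"
proof -
  have G: "diffop_lead (\<lambda>g. smult s g + [:x, 1:] * Delta_op g + (smult s g + [:y, 1:] * Nabla_op g)) 1 1 1 (- 1)" for s x y
    unfolding diffop_lead_def
  proof (intro exI[of _ "\<lambda>l. if l = 1 then [:x, 1:] else if l = 0 then [:2 * s + y - x:] else - [:y, 1:]"] conjI allI)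
    show "lead (if int 1 = 1 then [:x, 1:] else if int 1 = 0 then [:2 * s + y - x:] else - [:y, 1:]) (int 1) 1"
      using lead_lin_const[of x 1] by simp
    show "lead (if - int 1 = 1 then [:x, 1:] else if - int 1 = 0 then [:2 * s + y - x:] else - [:y, 1:]) (int 1) (- 1)"
      using lead_lin_const[of "- y" "- 1"] by simp
    fix g
    show "smult s g + [:x, 1:] * Delta_op g + (smult s g + [:y, 1:] * Nabla_op g)
      = (\<Sum>l = - int 1..int 1. (if l = 1 then [:x, 1:] else if l = 0 then [:2 * s + y - x:] else - [:y, 1:]) * shift_op l g)"
      unfolding of_nat_1 atLeastAtMost_1
      by (intro poly_ext) (simp add: Delta_op_def Nabla_op_def shift_op_sh algebra_simps)
  qed
  have "(\<lambda>g. D1_op a g + D2_op a N g) = (\<lambda>g. smult ((2 * a + 1) / 2) g + [:- N, 1:] * Delta_op g + (smult ((2 * a + 1) / 2) g + [:0, 1:] * Nabla_op g))"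
    by (auto simp: D1_op_def D2_op_def)
  then show "\<exists>c c'. diffop_lead (\<lambda>g. D1_op a g + D2_op a N g) 1 1 c c'" by (simp only:) (rule exI G)+
  have "(\<lambda>g. D3_op a g + D4_op a N g) = (\<lambda>g. smult ((2 * a + 1) / 2) g + [:a + 1, 1:] * Delta_op g + (smult ((2 * a + 1) / 2) g + [:- a - N - 1, 1:] * Nabla_op g))"
    by (auto simp: D3_op_def D4_op_def)
  then show "\<exists>c c'. diffop_lead (\<lambda>g. D3_op a g + D4_op a N g) 1 1 c c'" by (simp only:) (rule exI G)+
qed

text \<open>The first-order operator in the middle adds one to the reach but only one to the degree
  of the extreme coefficients, whereas a further power of \<open>hahn_op\<close> adds two. So even
  at equal reach \<open>d\<close> these coefficients stay below degree \<open>2 * d\<close>.\<close>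

lemma diffop_lead_sandwich:
  assumes "diffop_lead D 1 1 c c'" "p = 0 \<or> degree p + degree q + 1 \<le> d"
  shows "diffop_lead (\<lambda>f. poly_op p (hahn_op a N) (D (poly_op q (hahn_op a N) f))) d (2 * d) 0 0"
proof (cases "p = 0")
  case True
  then show ?thesis using diffop_lead_zero by (simp add: poly_op_def)
next
  case False
  have "diffop_lead (\<lambda>f. poly_op p (hahn_op a N) (D (poly_op q (hahn_op a N) f))) (degree p + (1 + degree q)) (2 * degree p + (1 + 2 * degree q))
      (lead_coeff p * (c * lead_coeff q)) (lead_coeff p * (c' * lead_coeff q))"
    by (rule diffop_lead_comp[OF diffop_lead_poly_op diffop_lead_comp[OF assms(1) diffop_lead_poly_op]])
  then show ?thesis by (rule diffop_lead_weaken) (use assms(2) False in auto)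
qed

lemma diffop_has_order_diffop_lead:
  assumes "diffop_lead T d e c c'" "c \<noteq> 0" "c' \<noteq> 0"
  shows "diffop_has_order T (2 * int d)"
proof -
  obtain h where h: "\<And>f. T f = (\<Sum>l\<in>{- int d..int d}. h l * shift_op l f)"
    "lead (h (int d)) (int e) c" "lead (h (- int d)) (int e) c'" using assms(1) unfolding diffop_lead_def by blast
  have "h (int d) \<noteq> 0" "h (- int d) \<noteq> 0"
    using lead_degree(2)[OF h(2) assms(2)] lead_degree(2)[OF h(3) assms(3)] assms by auto
  then show ?thesis unfolding diffop_has_order_def
    using h(1) by (intro exI[of _ h] exI[of _ "- int d"] exI[of _ "int d"]) auto
qed

lemma DS_order:
  assumes P: "P \<noteq> 0" "degree P = d"
    and Y: "\<And>h. h \<in> {1..card U} \<Longrightarrow> Mt h = 0 \<or> degree (Mt h) + degree (Ypol a N (sorted_list_of_set U ! (h - 1))) + 1 \<le> d"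
    and Z: "\<And>h. h \<in> {1..card V} \<Longrightarrow> Mt (2 * card U + h) = 0 \<or> degree (Mt (2 * card U + h)) + degree (Zpol a N (sorted_list_of_set V ! (h - 1))) + 1 \<le> d"
  shows "diffop_has_order (DS_op a N U V Mt P) (2 * int d)"
proof -
  obtain c c' where D12: "diffop_lead (\<lambda>g. D1_op a g + D2_op a N g) 1 1 c c'" using diffop_lead_D by blast
  obtain b b' where D34: "diffop_lead (\<lambda>g. D3_op a g + D4_op a N g) 1 1 b b'" using diffop_lead_D by blast
  have 1: "diffop_lead (\<lambda>f. smult (1/2) (poly_op P (hahn_op a N) f)) d (2 * d) (1/2 * lead_coeff P) (1/2 * lead_coeff P)"
    using diffop_lead_smult[OF diffop_lead_poly_op, of "1/2" P a N] P by simp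
  have 2: "diffop_lead (\<lambda>f. \<Sum>h = 1..card U. poly_op (Mt h) (hahn_op a N)
          ((\<lambda>g. D1_op a g + D2_op a N g) (poly_op (Ypol a N (sorted_list_of_set U ! (h - 1))) (hahn_op a N) f))) d (2 * d) 0 0"
    by (rule diffop_lead_sum_0[OF finite_atLeastAtMost]) (rule diffop_lead_sandwich[OF D12 Y])
  have 3: "diffop_lead (\<lambda>f. \<Sum>h = 1..card V. poly_op (Mt (2 * card U + h)) (hahn_op a N)
          ((\<lambda>g. D3_op a g + D4_op a N g) (poly_op (Zpol a N (sorted_list_of_set V ! (h - 1))) (hahn_op a N) f))) d (2 * d) 0 0"
    by (rule diffop_lead_sum_0[OF finite_atLeastAtMost]) (rule diffop_lead_sandwich[OF D34 Z])
  have "diffop_lead (DS_op a N U V Mt P) d (2 * d) (1/2 * lead_coeff P + 0 + 0) (1/2 * lead_coeff P + 0 + 0)"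
    using diffop_lead_add[OF diffop_lead_add[OF 1 2] 3] unfolding DS_op_def[abs_def] .
  then show ?thesis by (rule diffop_has_order_diffop_lead) (use P in auto)
qed

section \<open>The matrices of \<open>\<Omega>\<close> and \<open>\<Omega>\<^sub>1\<close>\<close>

lemma MOST_poch: "MOST x::real. pochhammer (x + c) j \<noteq> 0"
proof -
  have "(\<Prod>i = 0..<j. [:c + real i, 1:]) \<noteq> (0 :: real poly)" by simp
  from MOST_poly_nonzero[OF this] show ?thesis
    by (simp add: poly_prod pochhammer_prod add_ac)
qed

lemma MOST_nonzero_shift: "MOST x::real. x + c \<noteq> 0"
  using MOST_poch[of c 1] by simp

lemma prod_desc: "(\<Prod>i<j. c - real i) = pochhammer (c - real j + 1) j"
proof (induction j arbitrary: c)
  case (Suc j)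
  have "(\<Prod>i<Suc j. c - real i) = c * (\<Prod>i<j. (c - 1) - real i)"
    by (subst prod.lessThan_Suc_shift) (simp add: algebra_simps)
  also have "\<dots> = pochhammer (c - real (Suc j) + 1) (Suc j)"
    by (simp add: Suc.IH pochhammer_Suc)
  finally show ?case .
qed simp

lemma poly_lin1: "poly (lin1 b k j) t = pochhammer (t + b + real k - 2 * real j + 1) (2 * j)"
proof -
  have "poly (lin1 b k j) t = (\<Prod>i<2 * j. (t + b + real k) - real i)"
    by (simp add: lin1_def poly_prod algebra_simps)
  then show ?thesis by (simp only: prod_desc) simp
qed

lemma poly_lin2: "poly (lin2 b k j) t = pochhammer (t - b - real k) (2 * j)"
  by (simp add: lin2_def poly_prod pochhammer_prod atLeast0LessThan algebra_simps)

lemma det_scale_rows: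
  fixes B :: "nat \<Rightarrow> nat \<Rightarrow> 'a::comm_ring_1"
  shows "det (mat n n (\<lambda>(h, l). r h * B h l)) = (\<Prod>h<n. r h) * det (mat n n (\<lambda>(h, l). B h l))"
proof -
  have "(\<Prod>i = 0..<n. mat n n (\<lambda>(h, l). r h * B h l) $$ (i, p i)) = (\<Prod>h<n. r h) * (\<Prod>i = 0..<n. mat n n (\<lambda>(h, l). B h l) $$ (i, p i))"
    if "p permutes {0..<n}" for p
  proof -
    have "p i < n" if "i < n" for i using permutes_in_image[OF \<open>p permutes {0..<n}\<close>, of i] that by simp
    then have "(\<Prod>i = 0..<n. mat n n (\<lambda>(h, l). r h * B h l) $$ (i, p i)) = (\<Prod>i = 0..<n. r i * mat n n (\<lambda>(h, l). B h l) $$ (i, p i))"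
      by (intro prod.cong) auto
    then show ?thesis by (simp add: prod.distrib atLeast0LessThan)
  qed
  then show ?thesis
    unfolding det_def'[OF mat_carrier] sum_distrib_left
    by (intro sum.cong refl) (simp only: mem_Collect_eq mult_ac)
qed

locale krall =
  fixes a N :: real and U V :: "nat set"
  assumes fin: "finite U" "finite V"
begin

abbreviation "m1 \<equiv> card U"
abbreviation "m3 \<equiv> card V"
definition n :: nat where "n = m1 + m3"
abbreviation "m \<equiv> 2 * n"
abbreviation "bb \<equiv> a + N + 1/2"

definition deg :: "nat \<Rightarrow> nat" where
  "deg h = (if h < m1 then sorted_list_of_set U ! h else sorted_list_of_set V ! (h - m1))"

definition yz :: "nat \<Rightarrow> real poly" where
  "yz h = (if h < m1 then Ypol a N (deg h) else Zpol a N (deg h))"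

definition ff :: "nat \<Rightarrow> real poly" where
  "ff h = pcompose (yz h) [:- (a + 1/2)\<^sup>2, 0, 1:]"

definition tt :: "real \<Rightarrow> real" where "tt x = x - real n + a + 1/2"

lemma theta_sq: "theta a y = (y + a + 1/2)\<^sup>2 - (a + 1/2)\<^sup>2"
  by (simp add: theta_def power2_eq_square algebra_simps)

lemma poly_ff: "poly (ff h) z = poly (yz h) (z\<^sup>2 - (a + 1/2)\<^sup>2)"
  by (simp add: ff_def poly_pcompose power2_eq_square algebra_simps)

lemma evenp_ff: "evenp (ff h)"
  by (simp add: evenp_iff poly_ff)

definition EM :: "real \<Rightarrow> real mat" where
  "EM x = map_mat (\<lambda>p. poly p (tt x)) (Emat bb n m1 ff)"

lemma EM_carrier [simp]: "EM x \<in> carrier_mat n n" by (simp add: EM_def)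

lemma EM_index:
  assumes "h < n" "l < n"
  shows "EM x $$ (h, l) = poly (rw bb n m1 h l) (tt x) * poly (yz h) (theta a (x - 2 * real l - 1))"
proof -
  have "tt x + (real n - 1 - 2 * real l) = x - 2 * real l - 1 + a + 1/2" by (simp add: tt_def)
  moreover have "EM x $$ (h, l) = poly (rw bb n m1 h l) (tt x) * poly (ff h) (tt x + (real n - 1 - 2 * real l))"
    using assms by (simp add: EM_def Emat_def)
  ultimately show ?thesis by (simp only: poly_ff theta_sq)
qed

text \<open>Scalings that clear the denominators of \<open>xi\<close> in the rows from
  \<open>U\<close>: \<open>rhoo\<close> for odd column numbers, \<open>rhoe\<close> for even ones.
  The power of \<open>rhoo\<close> with exponent \<open>m1\<close> is a factor of
  \<open>Hfun\<close>.\<close>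

definition rhoo :: "real \<Rightarrow> real" where "rhoo x = Dfun a N (x - 1) (m - 1) / Nfun N (x - real m + 1) 1"
definition rhoe :: "real \<Rightarrow> real" where "rhoe x = pochhammer (x - real m + 2 * a + N + 2) (m - 2)"

definition nz :: "real \<Rightarrow> bool" where
  "nz x \<longleftrightarrow> pochhammer (x - real m + 2 * a + N + 2) m \<noteq> 0 \<and> x - real m - N \<noteq> 0"

lemma MOST_nz: "MOST x. nz x"
  using MOST_poch[of "- real m + 2 * a + N + 2" m] MOST_nonzero_shift[of "- real m - N"]
  by (simp add: nz_def MOST_conj_distrib add_diff_eq diff_add_eq algebra_simps)

lemma nz_poch: "nz x \<Longrightarrow> j \<le> m \<Longrightarrow> pochhammer (x - real m + 2 * a + N + 2) j \<noteq> 0"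
  using pochhammer_product[of j m "x - real m + 2 * a + N + 2"] by (auto simp: nz_def)

lemma wtp_poch:
  assumes "l < n"
  shows "poly (wtp bb (n - 1) l) (tt x) = pochhammer (x + 2 * a + N + 1 - 2 * real l) (2 * l) * pochhammer (x - real m - N + 1) (2 * (n - 1 - l))"
proof -
  have 1: "real (n - 1) = real n - 1" using assms by (simp add: of_nat_diff)
  have "tt x + bb + real (n - 1) - 2 * real l + 1 = x + 2 * a + N + 1 - 2 * real l" "tt x - bb - real (n - 1) = x - real m - N + 1"
    unfolding 1 by (simp_all add: tt_def)
  then show ?thesis unfolding wtp_lin poly_mult poly_lin1 poly_lin2 by (simp only:)
qed

lemma poch_quot:
  assumes "pochhammer (c::real) j \<noteq> 0" "j \<le> i"
  shows "pochhammer c i / pochhammer c j = pochhammer (c + real j) (i - j)"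
  using pochhammer_product[OF assms(2), of c] assms(1) by simp

text \<open>The Pochhammer symbols of numerator and denominator start at points independent of
  \<open>l\<close> and only their lengths vary. So \<open>rhoo\<close> leaves a final piece of the
  denominator symbol and removes one factor of the numerator, which are the two factors of
  \<open>wtp\<close>.\<close>

lemma xi_odd:
  assumes x: "nz x" and l: "l < n"
  shows "xi a N 1 (x - 2 * real l - 1) (m - 2 * l - 1) * rhoo x = poly (wtp bb (n - 1) l) (tt x)"
proof -
  let ?i = "m - 2 * l - 1" and ?c = "x - real m + 2 * a + N + 2" and ?z = "x - real m - N"
  have i: "real ?i = real m - 2 * real l - 1" "odd ?i" using l by (auto simp: of_nat_diff)
  have m1: "real (m - 1) = real m - 1" "odd (m - 1)" using l by (auto simp: of_nat_diff)
  have D1: "Dfun a N (x - 2 * real l - 1) ?i = - pochhammer ?c ?i"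
    unfolding Dfun_def i using i(2) by (simp add: algebra_simps)
  have N1: "Nfun N (x - 2 * real l - 1) ?i = pochhammer ?z ?i"
    unfolding Nfun_def i by (simp add: algebra_simps)
  have D2: "Dfun a N (x - 1) (m - 1) = - pochhammer ?c (m - 1)"
    unfolding Dfun_def m1 using m1(2) by (simp add: algebra_simps)
  have N2: "Nfun N (x - real m + 1) 1 = ?z"
    by (simp add: Nfun_def)
  have z: "?z \<noteq> 0" using x by (simp add: nz_def)
  have c: "pochhammer ?c ?i \<noteq> 0" using nz_poch[OF x] by simp
  have q1: "pochhammer ?c (m - 1) / pochhammer ?c ?i = pochhammer (x + 2 * a + N + 1 - 2 * real l) (2 * l)"
  proof -
    have "?c + real ?i = x + 2 * a + N + 1 - 2 * real l" "m - 1 - ?i = 2 * l" using l unfolding i by auto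
    moreover have "?i \<le> m - 1" by simp
    ultimately show ?thesis using poch_quot[OF c, of "m - 1"] by (simp only:)
  qed
  have q2: "pochhammer ?z ?i = ?z * pochhammer (x - real m - N + 1) (2 * (n - 1 - l))"
  proof -
    have "?i = Suc (2 * (n - 1 - l))" using l by simp
    then show ?thesis by (simp only: pochhammer_rec)
  qed
  have "xi a N 1 (x - 2 * real l - 1) ?i * rhoo x = pochhammer ?z ?i / ?z * (pochhammer ?c (m - 1) / pochhammer ?c ?i)"
    unfolding xi_def rhoo_def D1 N1 D2 N2 by simp
  also have "\<dots> = poly (wtp bb (n - 1) l) (tt x)"
    unfolding q1 q2 wtp_poch[OF l] using z by simp
  finally show ?thesis .
qed

lemma xi_even:
  assumes x: "nz x" and l: "l < n"
  shows "xi a N 1 (x - 2 * real l - 2) (m - 2 * l - 2) * rhoe x = poly (wtp bb (n - 1) l) (tt (x - 1))"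
proof -
  let ?i = "m - 2 * l - 2" and ?c = "x - real m + 2 * a + N + 2" and ?z = "x - real m - N"
  have i: "real ?i = real m - 2 * real l - 2" "even ?i" using l by (auto simp: of_nat_diff)
  have D1: "Dfun a N (x - 2 * real l - 2) ?i = pochhammer ?c ?i"
    unfolding Dfun_def i using i(2) by (simp add: algebra_simps)
  have N1: "Nfun N (x - 2 * real l - 2) ?i = pochhammer ?z ?i"
    unfolding Nfun_def i by (simp add: algebra_simps)
  have c: "pochhammer ?c ?i \<noteq> 0" using nz_poch[OF x] by simp
  have q1: "pochhammer ?c (m - 2) / pochhammer ?c ?i = pochhammer (x - 1 + 2 * a + N + 1 - 2 * real l) (2 * l)"
  proof -
    have "?c + real ?i = x - 1 + 2 * a + N + 1 - 2 * real l" "m - 2 - ?i = 2 * l" using l unfolding i by auto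
    moreover have "?i \<le> m - 2" by simp
    ultimately show ?thesis using poch_quot[OF c, of "m - 2"] by (simp only:)
  qed
  have q2: "pochhammer ?z ?i = pochhammer (x - 1 - real m - N + 1) (2 * (n - 1 - l))"
  proof -
    have "?z = x - 1 - real m - N + 1" "?i = 2 * (n - 1 - l)" by auto
    then show ?thesis by (simp only:)
  qed
  have "xi a N 1 (x - 2 * real l - 2) ?i * rhoe x = pochhammer ?z ?i * (pochhammer ?c (m - 2) / pochhammer ?c ?i)"
    unfolding xi_def rhoe_def D1 N1 by simp
  also have "\<dots> = poly (wtp bb (n - 1) l) (tt (x - 1))"
    unfolding q1 wtp_poch[OF l] q2 by (simp only: mult.commute)
  finally show ?thesis .
qed

lemma rho_nonzero: "nz x \<Longrightarrow> n > 0 \<Longrightarrow> rhoo x \<noteq> 0" "nz x \<Longrightarrow> rhoe x \<noteq> 0"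
proof -
  assume x: "nz x"
  then show "rhoe x \<noteq> 0" using nz_poch[OF x, of "m - 2"] by (simp add: rhoe_def)
  assume n: "n > 0"
  have m1: "real (m - 1) = real m - 1" using n by (simp add: of_nat_diff)
  have "x - 1 - real (m - 1) + 2 * a + N + 2 = x - real m + 2 * a + N + 2" unfolding m1 by simp
  moreover have "x - real m + 1 - real 1 - N = x - real m - N" by simp
  ultimately show "rhoo x \<noteq> 0"
    using nz_poch[OF x, of "m - 1"] x unfolding rhoo_def Dfun_def Nfun_def nz_def by simp
qed

text \<open>
  The rows of the matrix of \<open>\<Omega>\<close> are indexed by a row \<open>hb\<close> of the matrix of \<open>\<Omega>\<^sub>1\<close> and by whether
  the row carries the alternating signs.
\<close>
definition hb :: "nat \<Rightarrow> nat" where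
  "hb h = (if h < m1 then h else if h < 2 * m1 + m3 then h - m1 else h - m1 - m3)"
definition alt :: "nat \<Rightarrow> bool" where
  "alt h \<longleftrightarrow> (m1 \<le> h \<and> h < 2 * m1) \<or> 2 * m1 + m3 \<le> h"

definition sgn_col :: "nat \<Rightarrow> nat \<Rightarrow> real" where
  "sgn_col h k = (if alt h then (-1) ^ (k + 1) else 1)"

lemma hb_less: "h < m \<Longrightarrow> hb h < n" by (auto simp: hb_def n_def)

lemma hb_alt_inj: "h < m \<Longrightarrow> h' < m \<Longrightarrow> hb h = hb h' \<Longrightarrow> alt h = alt h' \<Longrightarrow> h = h'"
  by (auto simp: hb_def alt_def n_def split: if_splits)

lemma sum_rows: "(\<Sum>r<m. F (hb r) (alt r)) = (\<Sum>h<n. F h False + F h True)"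
proof -
  have "(\<Sum>r<m. F (hb r) (alt r)) = (\<Sum>(h, s)\<in>{..<n} \<times> {False, True}. F h s)"
    by (rule sum.reindex_bij_witness[of _ "\<lambda>(h, s). if h < m1 then (if s then h + m1 else h) else (if s then h + m1 + m3 else h + m1)"
         "\<lambda>r. (hb r, alt r)"]) (auto simp: hb_def alt_def n_def split: if_splits)
  then show ?thesis by (simp add: sum.cartesian_product[symmetric])
qed

definition rho :: "nat \<Rightarrow> nat \<Rightarrow> real \<Rightarrow> real" where
  "rho h k x = (if h < m1 then (if even k then rhoo x else rhoe x) else 1)"

definition xc :: "nat \<Rightarrow> real \<Rightarrow> real" where "xc k x = (if even k then x else x - 1)"

definition xr :: "nat \<Rightarrow> nat \<Rightarrow> real \<Rightarrow> real" where
  "xr h k y = xi a N (if h < m1 then 1 else 3) y (m - (k + 1))"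

lemma xr_rho:
  assumes x: "nz x" and k: "k < m"
  shows "xr h k (x - real (k + 1)) * rho h k x = poly (rw bb n m1 h (k div 2)) (tt (xc k x))"
proof (cases "h < m1")
  case True
  show ?thesis
  proof (cases "even k")
    case e: True
    then obtain l where l: "k = 2 * l" by (auto elim: evenE)
    have "x - real (k + 1) = x - 2 * real l - 1" "m - (k + 1) = m - 2 * l - 1" by (auto simp: l)
    then have "xr h k (x - real (k + 1)) = xi a N 1 (x - 2 * real l - 1) (m - 2 * l - 1)"
      unfolding xr_def using True by (simp only: if_True)
    then show ?thesis using xi_odd[OF x, of l] True e k by (simp add: rho_def xc_def rw_def l)
  next
    case o: False
    then obtain l where l: "k = 2 * l + 1" by (auto elim: oddE)
    have "x - real (k + 1) = x - 2 * real l - 2" "m - (k + 1) = m - 2 * l - 2" by (auto simp: l)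
    then have "xr h k (x - real (k + 1)) = xi a N 1 (x - 2 * real l - 2) (m - 2 * l - 2)"
      unfolding xr_def using True by (simp only: if_True)
    then show ?thesis using xi_even[OF x, of l] True o k by (simp add: rho_def xc_def rw_def l)
  qed
next
  case False
  then show ?thesis by (simp add: xr_def rho_def rw_def xi_def)
qed

lemma Omega_mat_index:
  assumes "h < m" "k < m"
  shows "Omega_mat a N U V x $$ (h, k) = sgn_col h k * (xr (hb h) k (x - real (k + 1)) * poly (yz (hb h)) (theta a (x - real (k + 1))))"
proof -
  have e: "h - m1 * 2 = h - (m1 + m1)" "h - (m3 + m1 * 2) = h - (m1 + (m1 + m3))" by simp_all
  have "h < m1 \<or> (m1 \<le> h \<and> h < 2 * m1) \<or> (2 * m1 \<le> h \<and> h < 2 * m1 + m3) \<or> 2 * m1 + m3 \<le> h" by linarith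
  then show ?thesis
    using assms
    unfolding Omega_mat_def Let_def
    by (elim disjE) (auto simp: e n_def sgn_col_def alt_def hb_def xr_def yz_def deg_def algebra_simps)
qed

lemma Omega_mat_carrier [simp]: "Omega_mat a N U V x \<in> carrier_mat m m"
  by (simp add: Omega_mat_def n_def)

lemma rho_nz: "nz x \<Longrightarrow> h < n \<Longrightarrow> rho h k x \<noteq> 0"
  using rho_nonzero[of x] by (auto simp: rho_def)

lemma Omega_mat_EM:
  assumes x: "nz x" and "h < m" "k < m"
  shows "Omega_mat a N U V x $$ (h, k) = sgn_col h k * (EM (xc k x) $$ (hb h, k div 2) / rho (hb h) k x)"
proof -
  have k2: "k div 2 < n" using assms by auto
  have th: "xc k x - 2 * real (k div 2) - 1 = x - real (k + 1)"
    by (cases "even k") (auto simp: xc_def elim!: evenE oddE)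
  have "xr (hb h) k (x - real (k + 1)) * poly (yz (hb h)) (theta a (x - real (k + 1))) = EM (xc k x) $$ (hb h, k div 2) / rho (hb h) k x"
    unfolding EM_index[OF hb_less[OF assms(2)] k2] th xr_rho[OF x assms(3), of "hb h", symmetric]
    using rho_nz[OF x hb_less[OF assms(2)], of k] by simp
  then show ?thesis unfolding Omega_mat_index[OF assms(2,3)] by simp
qed

lemma sum_cols: "(\<Sum>k<m. F k) = (\<Sum>l<n. F (2 * l) + F (2 * l + 1))"
proof -
  have "(\<Sum>k<2 * q. F k) = (\<Sum>l<q. F (2 * l) + F (2 * l + 1))" for q :: nat
    by (induction q) (auto simp: add.assoc)
  then show ?thesis .
qed

definition zz :: "nat \<Rightarrow> nat \<Rightarrow> real \<Rightarrow> real" where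
  "zz h l x = cofactor (EM x) h l / det (EM x)"

lemma EM_zz:
  assumes "det (EM x) \<noteq> 0" "h < n" "h' < n"
  shows "(\<Sum>l<n. EM x $$ (h', l) * zz h l x) = (if h = h' then 1 else 0)"
proof -
  have "(EM x * adj_mat (EM x)) $$ (h', h) = (det (EM x) \<cdot>\<^sub>m 1\<^sub>m n) $$ (h', h)"
    using adj_mat[OF EM_carrier] by simp
  then have "(\<Sum>l<n. EM x $$ (h', l) * cofactor (EM x) h l) = det (EM x) * (if h' = h then 1 else 0)"
    using assms EM_carrier[of x] by (simp add: scalar_prod_def adj_mat_def atLeast0LessThan carrier_matD[OF EM_carrier])
  then show ?thesis
    using assms(1) by (auto simp: zz_def sum_divide_distrib[symmetric])
qed

text \<open>The inverse of the matrix of \<Omega>. For rows with the same \<open>hb\<close>, the two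
  column parities contribute sign products whose half sum is 1 if \<open>alt\<close> agrees and 0 if
  it differs; hence the factor 1/2.\<close>

definition YM :: "real \<Rightarrow> real mat" where
  "YM x = mat m m (\<lambda>(k, h). sgn_col h k / 2 * rho (hb h) k x * zz (hb h) (k div 2) (xc k x))"

lemma Omega_YM:
  assumes x: "nz x" and E: "det (EM x) \<noteq> 0" "det (EM (x - 1)) \<noteq> 0"
  shows "Omega_mat a N U V x * YM x = 1\<^sub>m m"
proof (rule eq_matI)
  fix h' h assume "h' < dim_row (1\<^sub>m m :: real mat)" "h < dim_col (1\<^sub>m m :: real mat)"
  then have hh: "h' < m" "h < m" by auto
  let ?F = "\<lambda>k. Omega_mat a N U V x $$ (h', k) * YM x $$ (k, h)"
  let ?r = "\<lambda>k. rho (hb h) k x / rho (hb h') k x"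
  have "(Omega_mat a N U V x * YM x) $$ (h', h) = (\<Sum>k<m. ?F k)"
    using hh by (simp add: YM_def scalar_prod_def atLeast0LessThan carrier_matD[OF Omega_mat_carrier])
  also have "\<dots> = (\<Sum>l<n. ?F (2 * l) + ?F (2 * l + 1))" by (rule sum_cols)
  also have "\<dots> = (\<Sum>l<n. sgn_col h' 0 * sgn_col h 0 / 2 * ?r 0 * (EM x $$ (hb h', l) * zz (hb h) l x)
      + sgn_col h' 1 * sgn_col h 1 / 2 * ?r 1 * (EM (x - 1) $$ (hb h', l) * zz (hb h) l (x - 1)))"
  proof (rule sum.cong[OF refl])
    fix l assume "l \<in> {..<n}"
    then have l: "2 * l < m" "2 * l + 1 < m" by auto
    have s: "sgn_col g (2 * l) = sgn_col g 0" "sgn_col g (2 * l + 1) = sgn_col g 1" "rho i (2 * l) x = rho i 0 x" "rho i (2 * l + 1) x = rho i 1 x" for g i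
      by (simp_all add: sgn_col_def rho_def)
    have "?F (2 * l) = sgn_col h' 0 * sgn_col h 0 / 2 * ?r 0 * (EM x $$ (hb h', l) * zz (hb h) l x)"
      unfolding Omega_mat_EM[OF x hh(1) l(1)] using l hh by (simp add: YM_def s xc_def) (simp add: mult_ac)
    moreover have "?F (2 * l + 1) = sgn_col h' 1 * sgn_col h 1 / 2 * ?r 1 * (EM (x - 1) $$ (hb h', l) * zz (hb h) l (x - 1))"
      unfolding Omega_mat_EM[OF x hh(1) l(2)] using l hh by (simp add: YM_def s[simplified] xc_def) (simp add: mult_ac)
    ultimately show "?F (2 * l) + ?F (2 * l + 1) = sgn_col h' 0 * sgn_col h 0 / 2 * ?r 0 * (EM x $$ (hb h', l) * zz (hb h) l x)
      + sgn_col h' 1 * sgn_col h 1 / 2 * ?r 1 * (EM (x - 1) $$ (hb h', l) * zz (hb h) l (x - 1))" by (simp only:)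
  qed
  also have "\<dots> = sgn_col h' 0 * sgn_col h 0 / 2 * ?r 0 * (if hb h = hb h' then 1 else 0)
      + sgn_col h' 1 * sgn_col h 1 / 2 * ?r 1 * (if hb h = hb h' then 1 else 0)"
    unfolding sum.distrib sum_distrib_left[symmetric] EM_zz[OF E(1) hb_less[OF hh(2)] hb_less[OF hh(1)]]
      EM_zz[OF E(2) hb_less[OF hh(2)] hb_less[OF hh(1)]] ..
  also have "\<dots> = 1\<^sub>m m $$ (h', h)"
  proof (cases "hb h = hb h'")
    case True
    have "rho (hb h') 0 x \<noteq> 0" "rho (hb h') 1 x \<noteq> 0" using rho_nz[OF x hb_less[OF hh(1)]] by auto
    moreover have "h = h' \<longleftrightarrow> alt h = alt h'" using hb_alt_inj[OF hh(2,1) True] by auto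
    ultimately show ?thesis using True hh by (auto simp: sgn_col_def)
  next
    case False
    then show ?thesis using hh by auto
  qed
  finally show "(Omega_mat a N U V x * YM x) $$ (h', h) = 1\<^sub>m m $$ (h', h)" .
qed (auto simp: YM_def carrier_matD[OF Omega_mat_carrier])

lemma YM_carrier [simp]: "YM x \<in> carrier_mat m m" by (simp add: YM_def)

text \<open>The adjugate is the determinant times the inverse, so the minors occurring in
  \<open>Mfun\<close> are explicit.\<close>

lemma Omega_cofactor:
  assumes x: "nz x" and E: "det (EM x) \<noteq> 0" "det (EM (x - 1)) \<noteq> 0"
  shows "Omega a N U V x \<noteq> 0"
    and "h < m \<Longrightarrow> k < m \<Longrightarrow> cofactor (Omega_mat a N U V x) h k = Omega a N U V x * YM x $$ (k, h)"
proof -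
  let ?O = "Omega_mat a N U V x"
  have OY: "?O * YM x = 1\<^sub>m m" by (rule Omega_YM[OF assms])
  have "det ?O * det (YM x) = 1"
    using det_mult[OF Omega_mat_carrier YM_carrier, of x x] unfolding OY by simp
  then show "Omega a N U V x \<noteq> 0" by (auto simp: Omega_def)
  have YO: "YM x * ?O = 1\<^sub>m m" by (rule mat_mult_left_right_inverse[OF _ _ OY]) auto
  have adj: "adj_mat ?O \<in> carrier_mat m m" "?O * adj_mat ?O = det ?O \<cdot>\<^sub>m 1\<^sub>m m"
    using adj_mat[OF Omega_mat_carrier] by auto
  have "adj_mat ?O = (YM x * ?O) * adj_mat ?O" using YO adj by simp
  also have "\<dots> = YM x * (?O * adj_mat ?O)" by (rule assoc_mult_mat[of _ m m _ m _ m]) (use adj in auto)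
  also have "\<dots> = det ?O \<cdot>\<^sub>m YM x" unfolding adj(2) by (subst mult_smult_distrib[of _ m m]) (auto simp: right_mult_one_mat[OF YM_carrier])
  finally have A: "adj_mat ?O = det ?O \<cdot>\<^sub>m YM x" .
  assume "h < m" "k < m"
  then show "cofactor ?O h k = Omega a N U V x * YM x $$ (k, h)"
    using arg_cong[OF A, of "\<lambda>B. B $$ (k, h)"]
    by (simp add: adj_mat_def Omega_def carrier_matD[OF Omega_mat_carrier] carrier_matD[OF YM_carrier])
qed

lemma Omega_singular:
  assumes x: "nz x" and E: "det (EM x) = 0"
  shows "Omega a N U V x = 0"
proof -
  have "det (transpose_mat (EM x)) = 0" using E det_transpose[OF EM_carrier] by simp
  then obtain v where v: "v \<in> carrier_vec n" "v \<noteq> 0\<^sub>v n" "transpose_mat (EM x) *\<^sub>v v = 0\<^sub>v n"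
    using det_0_iff_vec_prod_zero_field[of "transpose_mat (EM x)" n] EM_carrier[of x] by auto
  have ker: "(\<Sum>h<n. EM x $$ (h, l) * v $ h) = 0" if "l < n" for l
  proof -
    have "(transpose_mat (EM x) *\<^sub>v v) $ l = 0" using v(3) that by simp
    then show ?thesis using that v(1)
      by (simp add: scalar_prod_def atLeast0LessThan carrier_matD[OF EM_carrier])
  qed
  let ?O = "Omega_mat a N U V x"
  \<comment> \<open>With opposite signs, plain and alternating copies of a row cancel in the columns
    belonging to \<open>x - 1\<close> and double in those belonging to \<open>x\<close>, where
    \<open>v\<close> is a null vector.\<close>
  let ?w = "vec m (\<lambda>r. (if alt r then - 1 else 1) * (v $ hb r * rho (hb r) 0 x))"
  have "transpose_mat ?O *\<^sub>v ?w = 0\<^sub>v m"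
  proof (rule eq_vecI)
    fix k assume "k < dim_vec (0\<^sub>v m :: real vec)"
    then have k: "k < m" by simp
    let ?G = "\<lambda>h s. (if s then (-1) ^ (k + 1) else 1) * (EM (xc k x) $$ (h, k div 2) / rho h k x) * ((if s then - 1 else 1) * (v $ h * rho h 0 x))"
    have "(transpose_mat ?O *\<^sub>v ?w) $ k = (\<Sum>r<m. ?O $$ (r, k) * ((if alt r then - 1 else 1) * (v $ hb r * rho (hb r) 0 x)))"
      using k by (simp add: scalar_prod_def atLeast0LessThan carrier_matD[OF Omega_mat_carrier])
    also have "\<dots> = (\<Sum>r<m. ?G (hb r) (alt r))"
      using k by (intro sum.cong refl) (simp only: Omega_mat_EM[OF x] lessThan_iff sgn_col_def)
    also have "\<dots> = (\<Sum>h<n. ?G h False + ?G h True)" by (rule sum_rows)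
    also have "\<dots> = 0"
    proof (cases "even k")
      case True
      have "(\<Sum>h<n. ?G h False + ?G h True) = (\<Sum>h<n. 2 * (EM x $$ (h, k div 2) * v $ h))"
      proof (rule sum.cong[OF refl])
        fix h assume "h \<in> {..<n}"
        then have "rho h 0 x \<noteq> 0" using rho_nz[OF x] by simp
        moreover have "rho h k x = rho h 0 x" using True by (simp add: rho_def)
        ultimately show "?G h False + ?G h True = 2 * (EM x $$ (h, k div 2) * v $ h)"
          using True by (simp add: xc_def)
      qed
      also have "\<dots> = 0" using ker[of "k div 2"] k by (simp add: sum_distrib_left[symmetric])
      finally show ?thesis .
    next
      case False
      then show ?thesis by simp
    qed
    finally show "(transpose_mat ?O *\<^sub>v ?w) $ k = 0\<^sub>v m $ k" using k by simp
  qed (simp add: carrier_matD[OF Omega_mat_carrier])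
  moreover have "?w \<noteq> 0\<^sub>v m"
  proof
    assume w: "?w = 0\<^sub>v m"
    have "v $ h = 0" if h: "h < n" for h
    proof -
      obtain r where r: "r < m" "hb r = h"
        using h by (intro that[of "if h < m1 then h else h + m1"]) (auto simp: hb_def n_def)
      have "?w $ r = 0" using w r by simp
      then show ?thesis using r rho_nz[OF x h, of 0] by (auto split: if_splits)
    qed
    then have "v = 0\<^sub>v n" using v(1) by (intro eq_vecI) auto
    with v show False by simp
  qed
  moreover have "transpose_mat ?O \<in> carrier_mat m m" "?w \<in> carrier_vec m" by simp_all
  ultimately have "det (transpose_mat ?O) = 0"
    using det_0_iff_vec_prod_zero_field by blast
  then show ?thesis using det_transpose[OF Omega_mat_carrier, of x] by (simp add: Omega_def)
qed

end

section \<open>The polynomial \<open>R\<close>\<close>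

lemma lead_imp_degree: "lead f (int d) c \<Longrightarrow> degree f \<le> d"
  by (simp add: lead_nat)

lemma sum_distinct_positive:
  assumes "finite A" "0 \<notin> A"
  shows "int (card A) * (int (card A) + 1) \<le> 2 * (\<Sum>x\<in>A. int x)"
  using assms
proof (induction A rule: finite_linorder_max_induct)
  case (insert x A)
  have "card A \<le> x - 1"
  proof -
    have "A \<subseteq> {1..x - 1}"
    proof
      fix y assume y: "y \<in> A"
      then have "y < x" using insert by auto
      moreover have "y \<noteq> 0" using insert.prems y by (metis insertCI)
      ultimately show "y \<in> {1..x - 1}" by auto
    qed
    then show ?thesis using card_mono[of "{1..x - 1}" A] by simp
  qed
  moreover have "x > 0" "x \<notin> A" using insert by auto
  ultimately have "int (card A) + 1 \<le> int x" by auto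
  then show ?case using insert \<open>x \<notin> A\<close> by (simp add: algebra_simps)
qed simp

lemma poly_cofactor: 
  "i < dim_row A \<Longrightarrow> j < dim_col A \<Longrightarrow> poly (cofactor A i j) t = cofactor (map_mat (\<lambda>p. poly p t) A) i j" for A :: "real poly mat"
proof -
  assume "i < dim_row A" "j < dim_col A"
  then have "map_mat (\<lambda>p. poly p t) (mat_delete A i j) = mat_delete (map_mat (\<lambda>p. poly p t) A) i j"
    by (intro eq_matI) (auto simp: mat_delete_def)
  then show ?thesis by (simp add: cofactor_def poly_det)
qed

text \<open>The cofactors along row \<open>h\<close> do not see that row, so the determinant is an
  operator in \<open>g\<close> with fixed coefficients.\<close>

lemma det_Emat_update:
  assumes "h < n"
  shows "det (Emat b n m1 (f(h := g))) = (\<Sum>l<n. rw b n m1 h l * sh (real n - 1 - 2 * real l) g * cofactor (Emat b n m1 f) h l)"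
proof -
  have "mat_delete (Emat b n m1 (f(h := g))) h l = mat_delete (Emat b n m1 f) h l" if "l < n" for l
    using that assms by (intro eq_matI) (auto simp: mat_delete_def Emat_def)
  then have "cofactor (Emat b n m1 (f(h := g))) h l = cofactor (Emat b n m1 f) h l" if "l < n" for l
    using that by (simp add: cofactor_def)
  then show ?thesis
    using laplace_expansion_row[OF Emat_carrier assms, of b m1 "f(h := g)"] assms
    by (simp add: Emat_def)
qed

lemma degree_dual_hahn:
  assumes "dual_hahn_defined u \<alpha> M"
  shows "degree (dual_hahn u \<alpha> \<beta> M) = u" "dual_hahn u \<alpha> \<beta> M \<noteq> 0"
proof -
  let ?P = "\<lambda>j. \<Prod>i<j. [:- (real i * (\<alpha> + \<beta> + 1 + real i)), 1:]"
  have L: "lead (?P j) (int j) 1" for j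
    using lead_prod[of "{..<j}" "\<lambda>i. [:- (real i * (\<alpha> + \<beta> + 1 + real i)), 1:]" "\<lambda>_. 1" "\<lambda>_. 1"]
    by (simp add: lead_lin_const)
  let ?c = "\<lambda>j. (-1) ^ j * pochhammer (- real u) j / (pochhammer (\<alpha> + 1) j * pochhammer (- M) j * fact j)"
  have "lead (\<Sum>j<u. smult (?c j) (?P j)) (int u) (\<Sum>j<u. 0)"
    by (rule lead_sum) (auto intro: lead_mono[OF lead_smult[OF L]])
  from lead_add[OF this lead_smult[OF L[of u], of "?c u"]]
  have "lead (dual_hahn u \<alpha> \<beta> M) (int u) (?c u)"
    by (simp add: dual_hahn_def lessThan_Suc_atMost[symmetric])
  moreover have "?c u \<noteq> 0"
    using assms by (auto simp: dual_hahn_defined_def pochhammer_of_nat_eq_0_iff)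
  ultimately show "degree (dual_hahn u \<alpha> \<beta> M) = u" "dual_hahn u \<alpha> \<beta> M \<noteq> 0"
    using lead_degree[of "dual_hahn u \<alpha> \<beta> M" "int u" "?c u"] by auto
qed

context krall
begin

lemma n_ge: "m1 \<le> n" by (simp add: n_def)

lemma pfun_ph: "pfun a N U V x = poly (ph bb (n - 1) m1) (tt x)"
proof (cases "n = 0")
  case True
  then show ?thesis by (simp add: pfun_def ph_def n_def)
next
  case False
  then have r: "real (n - 1) = real n - 1" by (simp add: of_nat_diff)
  have D: "Dfun a N (x - 1) (2 * j) = poly (lin1 bb (n - 1) j) (tt x)" for j
  proof -
    have "x - 1 - real (2 * j) + 2 * a + N + 2 = tt x + bb + real (n - 1) - 2 * real j + 1"
      unfolding r by (simp add: tt_def)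
    then show ?thesis unfolding Dfun_def poly_lin1 by (simp only:) simp
  qed
  have Nf: "Nfun N (x - real m + 2 * real j + 1) (2 * j) = poly (lin2 bb (n - 1) j) (tt x)" for j
  proof -
    have "x - real m + 2 * real j + 1 - real (2 * j) - N = tt x - bb - real (n - 1)"
      unfolding r by (simp add: tt_def)
    then show ?thesis unfolding Nfun_def poly_lin2 by (simp only:)
  qed
  have "pfun a N U V x = (\<Prod>j = 1..m1 - 1. poly (lin1 bb (n - 1) j) (tt x) * poly (lin2 bb (n - 1) j) (tt x))"
    using D Nf unfolding pfun_def n_def[symmetric] by simp
  \<comment> \<open>The index 0 may be added because its factors are empty products.\<close>
  also have "\<dots> = (\<Prod>j<m1. poly (lin1 bb (n - 1) j) (tt x) * poly (lin2 bb (n - 1) j) (tt x))"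
  proof (rule prod.mono_neutral_left)
    show "\<forall>i\<in>{..<m1} - {1..m1 - 1}. poly (lin1 bb (n - 1) i) (tt x) * poly (lin2 bb (n - 1) i) (tt x) = 1"
    proof
      fix i assume "i \<in> {..<m1} - {1..m1 - 1}"
      then have "i = 0" by auto
      then show "poly (lin1 bb (n - 1) i) (tt x) * poly (lin2 bb (n - 1) i) (tt x) = 1"
        by (simp add: lin1_def lin2_def)
    qed
  qed auto
  finally show ?thesis by (simp add: ph_def poly_prod prod.distrib)
qed

lemma sigma_shift: "sigma a y = - 2 * (y + a - 1/2)"
  by (simp add: sigma_def theta_def algebra_simps)

lemma qfun_qh: "\<exists>K. K \<noteq> 0 \<and> (\<forall>x. qfun a U V x = K * poly (qh n) (tt x))"
proof (intro exI conjI allI)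
  show "(\<Prod>i = 1..n div 2. \<Prod>j = 1..2 * n - 4 * i + 1. - 2 :: real) \<noteq> 0" by simp
  fix x
  have "sigma a (x - real m + 2 * real i + real j) = - 2 * (- real n - 1 + 2 * real i + real j + tt x)" for i j
    by (simp add: sigma_shift tt_def)
  then show "qfun a U V x = (\<Prod>i = 1..n div 2. \<Prod>j = 1..2 * n - 4 * i + 1. - 2 :: real) * poly (qh n) (tt x)"
    unfolding qfun_def qh_def poly_prod n_def[symmetric] prod.distrib[symmetric]
    by (simp only: poly_pCons poly_0 mult_zero_right add_0_right mult_1_right)
qed

text \<open>The columns are the odd-numbered ones of \<Omega>, and only the \<open>m1\<close> rows
  from \<open>U\<close> have to be scaled.\<close>

lemma Omega1_EM:
  assumes x: "nz x"
  shows "rhoo x ^ m1 * Omega1 a N U V x = det (EM x)"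
proof -
  let ?B = "\<lambda>h l. xr h (2 * l) (x - real (2 * l + 1)) * poly (yz h) (theta a (x - real (2 * l + 1)))"
  let ?r = "\<lambda>h. if h < m1 then rhoo x else 1"
  let ?A = "mat n n (\<lambda>(h, l). ?r h * ?B h l)"
  let ?C = "mat n n (\<lambda>(h, k).
     let j = k + 1; y = x - 2 * real j + 1 in
     if h < m1 then xi a N 1 y (m - 2 * j + 1) * poly (Ypol a N (sorted_list_of_set U ! h)) (theta a y)
     else xi a N 3 y (m - 2 * j + 1) * poly (Zpol a N (sorted_list_of_set V ! (h - m1))) (theta a y))"
  have "EM x = ?A"
  proof (rule eq_matI)
    fix h l assume "h < dim_row ?A" "l < dim_col ?A"
    then have hl: "h < n" "l < n" by auto
    then have l2: "2 * l < m" by simp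
    have e: "x - 2 * real l - 1 = x - real (2 * l + 1)" by simp
    have "xr h (2 * l) (x - real (2 * l + 1)) * ?r h = poly (rw bb n m1 h l) (tt x)"
      using xr_rho[OF x l2, of h] by (simp add: rho_def xc_def cong: if_cong)
    then have "EM x $$ (h, l) = (xr h (2 * l) (x - real (2 * l + 1)) * ?r h) * poly (yz h) (theta a (x - real (2 * l + 1)))"
      unfolding EM_index[OF hl] e by (simp only:)
    then show "EM x $$ (h, l) = ?A $$ (h, l)"
      using hl by (simp add: mult_ac)
  qed (auto simp: carrier_matD[OF EM_carrier])
  then have "det (EM x) = (\<Prod>h<n. ?r h) * det (mat n n (\<lambda>(h, l). ?B h l))"
    using det_scale_rows[of n ?r ?B] by simp
  also have "(\<Prod>h<n. ?r h) = (\<Prod>h<m1. rhoo x)"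
    by (rule prod.mono_neutral_cong_right) (auto simp: n_def)
  also have "mat n n (\<lambda>(h, l). ?B h l) = ?C"
  proof (rule eq_matI)
    fix h l assume "h < dim_row ?C" "l < dim_col ?C"
    then have hl: "h < n" "l < n" by auto
    have e: "x - 2 * real (l + 1) + 1 = x - real (2 * l + 1)" by simp
    have e2: "m - 2 * (l + 1) + 1 = m - (2 * l + 1)" using hl by simp
    show "mat n n (\<lambda>(h, l). ?B h l) $$ (h, l) = ?C $$ (h, l)"
      using hl unfolding index_mat(1)[OF hl] prod.case Let_def e e2
      by (cases "h < m1") (simp_all only: xr_def yz_def deg_def if_True if_False)
  qed auto
  finally show ?thesis unfolding Omega1_def n_def[symmetric] by (simp only: prod_constant card_lessThan)
qed

definition WW :: "real poly" where "WW = Wpol bb n m1 ff"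

lemma evenp_WW: "evenp WW"
  unfolding WW_def by (rule evenp_Wpol[OF n_ge evenp_ff])

text \<open>A single constant has to serve all row polynomials at once, because later the original
  rows and the modified ones are divided by the same \<open>QQ\<close>.\<close>

definition kap :: real where
  "kap = (SOME \<kappa>. \<kappa> \<noteq> 0 \<and> (\<forall>b q f. q \<le> n \<and> (\<forall>h<n. evenp (f h)) \<longrightarrow>
     det (Emat b n q f) = smult \<kappa> (qh n * (ph b (n - 1) q * Wpol b n q f))))"

lemma kap: "kap \<noteq> 0" "\<And>f. (\<And>h. evenp (f h)) \<Longrightarrow> det (Emat bb n m1 f) = smult kap (qh n * (ph bb (n - 1) m1 * Wpol bb n m1 f))"
  using someI_ex[OF det_Emat_Wpol[of n]] n_ge unfolding kap_def[symmetric] by auto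

definition QQ :: "real poly" where "QQ = smult kap (qh n * ph bb (n - 1) m1)"

lemma QQ_nonzero: "QQ \<noteq> 0"
  using kap(1) qh_nonzero ph_nonzero by (simp add: QQ_def)

lemma det_EM: "det (EM x) = poly QQ (tt x) * poly WW (tt x)"
  using kap(2)[OF evenp_ff] by (simp add: EM_def poly_det[symmetric] QQ_def WW_def mult_ac)

lemma MOST_tt: "MOST t. P t \<Longrightarrow> MOST x. P (tt x)"
  using MOST_shift[of P "- real n + a + 1/2"] by (simp add: tt_def add_diff_eq diff_add_eq algebra_simps)

text \<open>The power in \<open>Hfun\<close> is the scaling of \<open>Omega1_EM\<close>,
  \<open>pfun\<close> and \<open>qfun\<close> cancel against \<open>QQ\<close>, and the remaining
  factor \<open>sigma\<close> is \<open>- 2 * tt x\<close>.\<close>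

lemma H_Omega1:
  "\<exists>C. C \<noteq> 0 \<and> (MOST x. Hfun a N U V x * Omega1 a N U V x = C * (tt x * poly WW (tt x)))"
proof -
  obtain K where K: "K \<noteq> 0" "\<And>x. qfun a U V x = K * poly (qh n) (tt x)" using qfun_qh by blast
  have "MOST x. Hfun a N U V x * Omega1 a N U V x = - 2 * kap / K * (tt x * poly WW (tt x))"
  proof (rule MOST_rev_mp[OF MOST_nz], rule MOST_rev_mp[OF MOST_tt[OF MOST_poly_nonzero[OF QQ_nonzero]]], rule always_eventually, intro allI impI)
    fix x assume q: "poly QQ (tt x) \<noteq> 0" and x: "nz x"
    have q': "poly (qh n) (tt x) \<noteq> 0" "poly (ph bb (n - 1) m1) (tt x) \<noteq> 0" using q by (auto simp: QQ_def)
    have s: "sigma a (x - real m1 - real m3 + 1) = - 2 * tt x" by (simp add: sigma_shift tt_def n_def)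
    have "Hfun a N U V x = - 2 * tt x * rhoo x ^ m1 / (poly (ph bb (n - 1) m1) (tt x) * (K * poly (qh n) (tt x)))"
      unfolding Hfun_def s pfun_ph K(2) n_def[symmetric] rhoo_def by (simp add: power_divide)
    then have "Hfun a N U V x * Omega1 a N U V x = - 2 * tt x * (rhoo x ^ m1 * Omega1 a N U V x) / (poly (ph bb (n - 1) m1) (tt x) * (K * poly (qh n) (tt x)))"
      by simp
    also have "\<dots> = - 2 * kap / K * (tt x * poly WW (tt x))"
      unfolding Omega1_EM[OF x] det_EM using q' K(1) by (simp add: QQ_def field_simps)
    finally show "Hfun a N U V x * Omega1 a N U V x = - 2 * kap / K * (tt x * poly WW (tt x))" .
  qed
  then show ?thesis using K(1) kap(1) by (intro exI[of _ "- 2 * kap / K"]) auto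
qed

definition C1 :: real where
  "C1 = (SOME C. C \<noteq> 0 \<and> (MOST x. Hfun a N U V x * Omega1 a N U V x = C * (tt x * poly WW (tt x))))"

lemma C1: "C1 \<noteq> 0" "MOST x. Hfun a N U V x * Omega1 a N U V x = C1 * (tt x * poly WW (tt x))"
  using someI_ex[OF H_Omega1] unfolding C1_def[symmetric] by auto

definition sl :: "real poly" where "sl = [:2 * (real n - a), - 2:]"

lemma poly_sl: "poly sl x = sigma a (x - (real m - 1) / 2)"
  by (simp add: sl_def sigma_shift field_simps)

lemma sl_nonzero: "sl \<noteq> 0" by (simp add: sl_def)

definition HO :: "real \<Rightarrow> real poly" where
  "HO c = smult (c * C1) (sh (- real n + a + 1/2) ([:0, 1:] * WW))"

lemma poly_HO: "poly (HO c) x = c * C1 * (tt x * poly WW (tt x))"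
proof -
  have "x + (- real n + a + 1/2) = tt x" by (simp add: tt_def)
  then show ?thesis by (simp add: HO_def)
qed

lemma is_R_iff: "is_R a N U V c R \<longleftrightarrow> sl * R + sh 1 (sl * R) = HO c"
proof
  have e: "poly (sl * R + sh 1 (sl * R)) x = sigma a (x - (real m - 1) / 2) * poly R x + sigma a (x + 1 - (real m - 1) / 2) * poly R (x + 1)" for x
    by (simp only: poly_add poly_mult poly_sh poly_sl)
  {
    assume "is_R a N U V c R"
    then have "MOST x. poly (sl * R + sh 1 (sl * R)) x = c * (Hfun a N U V x * Omega1 a N U V x)"
      unfolding is_R_def e n_def[symmetric] .
    then have "MOST x. poly (sl * R + sh 1 (sl * R)) x = poly (HO c) x"
      using C1(2) unfolding poly_HO by eventually_elim (simp add: mult_ac)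
    then show "sl * R + sh 1 (sl * R) = HO c" by (rule poly_inf_eq)
  next
    assume *: "sl * R + sh 1 (sl * R) = HO c"
    show "is_R a N U V c R"
      unfolding is_R_def n_def[symmetric] e[symmetric] * poly_HO
      using C1(2) by eventually_elim (simp add: mult_ac)
  }
qed

text \<open>As t W(t) is odd, the reflected negative of a solution solves the same equation, and the
  solution is unique.\<close>

lemma antisym_solution:
  assumes "g + sh 1 g = HO c"
  shows "poly g (2 * (real n - a) - x) = - poly g x"
proof -
  define g' where "g' = - pcompose g [:2 * (real n - a), - 1:]"
  have g': "poly g' x = - poly g (2 * (real n - a) - x)" for x
    by (simp add: g'_def poly_pcompose)
  have G: "poly g x + poly g (x + 1) = c * C1 * (tt x * poly WW (tt x))" for x
    using arg_cong[OF assms, of "\<lambda>p. poly p x"] by (simp add: poly_HO)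
  have "g' + sh 1 g' = HO c"
  proof (rule poly_ext)
    fix x
    let ?y = "2 * (real n - a) - x - 1"
    have y: "tt ?y = - tt x" by (simp add: tt_def)
    have "poly (g' + sh 1 g') x = - (poly g ?y + poly g (?y + 1))"
    proof -
      have "poly g (2 * (real n - a) - (x + 1)) = poly g ?y" "poly g (2 * (real n - a) - x) = poly g (?y + 1)"
        by (rule arg_cong[of _ _ "poly g"], simp)+
      then show ?thesis unfolding poly_add poly_sh g' by linarith
    qed
    also have "\<dots> = poly (HO c) x"
      unfolding G y poly_HO using evenp_WW by (simp add: evenp_iff)
    finally show "poly (g' + sh 1 g') x = poly (HO c) x" .
  qed
  moreover have "(g - g') + sh 1 (g - g') = (g + sh 1 g) - (g' + sh 1 g')"
    by (rule poly_ext) simp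
  ultimately have "(g - g') + sh 1 (g - g') = 0" unfolding assms by simp
  then have "g - g' = 0" by (rule average_unique)
  then have "g = g'" by simp
  then show ?thesis using g'[of x] by simp
qed

text \<open>Antisymmetry about \<open>n - a\<close> forces a zero there. This is the zero of the
  linear polynomial \<open>sl\<close>, so the solution of the average equation is divisible by
  \<open>sl\<close>.\<close>

lemma ex1_R: "\<exists>!R. is_R a N U V c R"
proof -
  obtain g where g: "g + sh 1 g = HO c" using average_solution by blast
  have "poly g (real n - a) = 0"
    using antisym_solution[OF g, of "real n - a"] by simp
  then obtain q where q: "g = [:- (real n - a), 1:] * q" by (auto simp: poly_eq_0_iff_dvd elim: dvdE)
  have "g = sl * smult (- 1/2) q"
    unfolding q sl_def by (rule poly_ext) (simp add: algebra_simps)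
  then have "is_R a N U V c (smult (- 1/2) q)" unfolding is_R_iff using g by simp
  moreover have "R = R'" if "is_R a N U V c R" "is_R a N U V c R'" for R R'
  proof -
    have "sl * (R - R') + sh 1 (sl * (R - R')) = 0"
    proof -
      have "sl * (R - R') + sh 1 (sl * (R - R')) = (sl * R + sh 1 (sl * R)) - (sl * R' + sh 1 (sl * R'))"
        by (rule poly_ext) (simp add: right_diff_distrib)
      then show ?thesis using that unfolding is_R_iff by simp
    qed
    then have "sl * (R - R') = 0" by (rule average_unique)
    then show ?thesis using sl_nonzero by simp
  qed
  ultimately show ?thesis by blast
qed

end

section \<open>The functions \<open>M\<^sub>h\<close>, \<open>P\<^sub>S\<close> and the order\<close>

lemma lead_coeff_nat: "lead f (int (degree f)) (lead_coeff f)"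
  by (simp add: lead_nat)

lemma sum_lessThan_add: "(\<Sum>h<p + q. f h) = (\<Sum>h<p. f h) + (\<Sum>h<(q::nat). (f (p + h) :: int))"
  by (induction q) (auto simp: add.assoc)

locale krall_generic = krall +
  assumes pos: "0 \<notin> U" "0 \<notin> V"
    and Ydef: "\<And>u. u \<in> U \<Longrightarrow> dual_hahn_defined u (- a) (2 * a + N)"
    and Zdef: "\<And>v. v \<in> V \<Longrightarrow> dual_hahn_defined v (- a) (- 2 - N)"
    and Onz: "\<not> (MOST x. Omega a N U V x = 0)"
begin

lemma deg_mem: "h < m1 \<Longrightarrow> deg h \<in> U" "m1 \<le> h \<Longrightarrow> h < n \<Longrightarrow> deg h \<in> V"
  using nth_mem[of h "sorted_list_of_set U"] nth_mem[of "h - m1" "sorted_list_of_set V"] fin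
  by (auto simp: deg_def n_def)

lemma degree_yz: 
  assumes "h < n" shows "degree (yz h) = deg h" "yz h \<noteq> 0"
proof -
  have P: "degree (pcompose p [:2 * a, 1:]) = degree p" "pcompose p [:2 * a, 1:] = 0 \<longleftrightarrow> p = 0" for p :: "real poly"
    by (auto simp: degree_pcompose pcompose_eq_0_iff)
  show "degree (yz h) = deg h" "yz h \<noteq> 0"
    using degree_dual_hahn[OF Ydef[OF deg_mem(1)], of h "- a"] degree_dual_hahn[OF Zdef[OF deg_mem(2)], of h "- a"] assms
    by (cases "h < m1"; simp add: yz_def Ypol_def Zpol_def P)+
qed

definition cc :: "nat \<Rightarrow> real" where "cc h = lead_coeff (ff h)"

lemma lead_ff:
  assumes "h < n" shows "lead (ff h) (2 * int (deg h)) (cc h)" "cc h \<noteq> 0"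
proof -
  have d: "degree (ff h) = 2 * deg h"
    by (simp add: ff_def degree_pcompose degree_yz[OF assms])
  show "lead (ff h) (2 * int (deg h)) (cc h)"
    using lead_coeff_nat[of "ff h"] by (simp add: d cc_def)
  show "cc h \<noteq> 0"
    using degree_yz[OF assms] by (simp add: cc_def ff_def pcompose_eq_0_iff)
qed

lemma sum_deg: "(\<Sum>h<n. int (deg h)) = (\<Sum>u\<in>U. int u) + (\<Sum>v\<in>V. int v)"
proof -
  have S: "(\<Sum>i<card X. int (sorted_list_of_set X ! i)) = (\<Sum>x\<in>X. int x)" if "finite X" for X :: "nat set"
  proof -
    have "(\<Sum>x\<in>X. int x) = sum_list (map int (sorted_list_of_set X))"
      using that by (simp add: sum_list_distinct_conv_sum_set)
    also have "\<dots> = (\<Sum>i<card X. int (sorted_list_of_set X ! i))"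
      by (simp add: sum_list_sum_nth atLeast0LessThan)
    finally show ?thesis by simp
  qed
  have "(\<Sum>h<n. int (deg h)) = (\<Sum>h<m1. int (deg h)) + (\<Sum>h<m3. int (deg (m1 + h)))"
    unfolding n_def by (rule sum_lessThan_add)
  then show ?thesis using S fin by (simp add: deg_def)
qed

definition D2 :: int where
  "D2 = 2 * (\<Sum>h<n. int (deg h)) - int m1 * (int m1 - 1) - int m3 * (int m3 - 1)"

text \<open>Half the degree of \<open>WW\<close>, by \<open>lead_WW\<close>; the division is exact
  by \<open>D2_Dn\<close>.\<close>

definition Dn :: nat where "Dn = nat (D2 div 2)"

lemma card_sum_le: "finite X \<Longrightarrow> 0 \<notin> X \<Longrightarrow> int (card X) * (int (card X) - 1) \<le> 2 * (\<Sum>x\<in>X. int x)"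
  using sum_distinct_positive[of X] by (simp add: algebra_simps)

text \<open>The \<open>card X - 1\<close> remaining elements are distinct and positive, which bounds
  their sum from below. This yields \<open>deg h \<le> Dn\<close>, so that the degree bounds for the
  \<open>M_h\<close> involve no truncated subtraction.\<close>

lemma card_sum_remove_le:
  assumes "finite X" "0 \<notin> X" "y \<in> X"
  shows "2 * int y + int (card X) * (int (card X) - 1) \<le> 2 * (\<Sum>x\<in>X. int x)"
proof -
  have "int (card (X - {y})) * (int (card (X - {y})) + 1) \<le> 2 * (\<Sum>x\<in>X - {y}. int x)"
    by (rule sum_distinct_positive) (use assms in auto)
  moreover have "(\<Sum>x\<in>X. int x) = int y + (\<Sum>x\<in>X - {y}. int x)" using assms by (simp add: sum.remove)
  moreover have "int (card (X - {y})) = int (card X) - 1"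
  proof -
    have "card X > 0" using assms card_gt_0_iff by blast
    then show ?thesis using assms by (simp add: of_nat_diff)
  qed
  ultimately show ?thesis by (simp add: algebra_simps)
qed

lemma D2_nonneg: "0 \<le> D2"
  using card_sum_le[OF fin(1) pos(1)] card_sum_le[OF fin(2) pos(2)] by (simp add: D2_def sum_deg)

lemma D2_Dn: "D2 = 2 * int Dn"
proof -
  have "even D2" by (simp add: D2_def)
  then show ?thesis using D2_nonneg by (auto simp: Dn_def)
qed

lemma deg_le_Dn: "h < n \<Longrightarrow> deg h \<le> Dn"
proof -
  assume h: "h < n"
  have "2 * int (deg h) \<le> D2"
  proof (cases "h < m1")
    case True
    show ?thesis
      using card_sum_remove_le[OF fin(1) pos(1) deg_mem(1)[OF True]] card_sum_le[OF fin(2) pos(2)]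
      by (simp add: D2_def sum_deg)
  next
    case False
    show ?thesis
      using card_sum_remove_le[OF fin(2) pos(2) deg_mem(2)[OF _ h]] card_sum_le[OF fin(1) pos(1)] False
      by (simp add: D2_def sum_deg)
  qed
  then show ?thesis by (simp add: D2_Dn)
qed

section \<open>Distinctness of the Vandermonde nodes\<close>

lemma Y_cont_dual_hahn:
  assumes "h < m1"
  shows "\<exists>C. C \<noteq> 0 \<and> (\<forall>\<tau>. C * poly (ff h) \<tau> = cont_dual_hahn (deg h) (1/2 - a) (1/2) (- bb) \<tau>)"
proof (intro exI conjI allI)
  let ?M = "2 * a + N"
  have D: "dual_hahn_defined (deg h) (- a) ?M" by (rule Ydef[OF deg_mem(1)[OF assms]])
  show "pochhammer (1 - a) (deg h) * pochhammer (- ?M) (deg h) \<noteq> 0"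
    using D by (auto simp: dual_hahn_defined_def)
  fix \<tau> :: real
  have e: "\<tau>\<^sup>2 - (a + 1/2)\<^sup>2 + 2 * a = \<tau>\<^sup>2 - (a - 1/2)\<^sup>2" "- ?M - (1/2 - a) = - bb"
    by (simp_all add: power2_eq_square algebra_simps)
  have "poly (ff h) \<tau> = poly (dual_hahn (deg h) (- a) (- a) ?M) (\<tau>\<^sup>2 - (a + 1/2)\<^sup>2 + 2 * a)"
    using assms by (simp add: poly_ff yz_def Ypol_def poly_pcompose add.commute)
  then show "pochhammer (1 - a) (deg h) * pochhammer (- ?M) (deg h) * poly (ff h) \<tau> = cont_dual_hahn (deg h) (1/2 - a) (1/2) (- bb) \<tau>"
    using dual_hahn_cont_dual_hahn[OF D, of \<tau>] unfolding e by (simp only:)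
qed

lemma Z_cont_dual_hahn:
  assumes "m1 \<le> h" "h < n"
  shows "\<exists>C. C \<noteq> 0 \<and> (\<forall>\<tau>. C * poly (ff h) \<tau> = cont_dual_hahn (deg h) (1/2 - a) (1/2) (bb + 1) \<tau>)"
proof (intro exI conjI allI)
  let ?M = "- 2 - N"
  have D: "dual_hahn_defined (deg h) (- a) ?M" by (rule Zdef[OF deg_mem(2)[OF assms]])
  show "pochhammer (1 - a) (deg h) * pochhammer (- ?M) (deg h) \<noteq> 0"
    using D by (auto simp: dual_hahn_defined_def)
  fix \<tau> :: real
  have e: "\<tau>\<^sup>2 - (a + 1/2)\<^sup>2 + 2 * a = \<tau>\<^sup>2 - (a - 1/2)\<^sup>2" "- ?M - (1/2 - a) = bb + 1"
    by (simp_all add: power2_eq_square algebra_simps)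
  have "poly (ff h) \<tau> = poly (dual_hahn (deg h) (- a) (- a) ?M) (\<tau>\<^sup>2 - (a + 1/2)\<^sup>2 + 2 * a)"
    using assms by (simp add: poly_ff yz_def Zpol_def poly_pcompose add.commute)
  then show "pochhammer (1 - a) (deg h) * pochhammer (- ?M) (deg h) * poly (ff h) \<tau> = cont_dual_hahn (deg h) (1/2 - a) (1/2) (bb + 1) \<tau>"
    using dual_hahn_cont_dual_hahn[OF D, of \<tau>] unfolding e by (simp only:)
qed

lemma det_Emat_nonzero: "det (Emat bb n m1 ff) \<noteq> 0"
proof
  assume "det (Emat bb n m1 ff) = 0"
  then have E: "det (EM x) = 0" for x by (simp add: EM_def poly_det[symmetric])
  have "MOST x. Omega a N U V x = 0"
    using MOST_nz by (rule MOST_mono) (rule Omega_singular[OF _ E])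
  with Onz show False by simp
qed

text \<open>If \<open>bb + 1/2 = k\<close>, the third parameters \<open>- bb\<close> and
  \<open>bb + 1\<close> are 1/2 - k and 1/2 + k, and the degrees differ by \<open>k\<close>: this is
  the situation of \<open>cont_dual_hahn_factor\<close>. For negative values the two families
  exchange roles. Then \<open>E\<close>, and with it \<Omega>, would be singular.\<close>

lemma not_degenerate:
  assumes "i < m1" "m1 \<le> j" "j < n"
  shows "bb + 1/2 \<noteq> real (deg i) - real (deg j)"
proof
  assume b: "bb + 1/2 = real (deg i) - real (deg j)"
  obtain CY where CY: "CY \<noteq> 0" "\<And>\<tau>. CY * poly (ff i) \<tau> = cont_dual_hahn (deg i) (1/2 - a) (1/2) (- bb) \<tau>"
    using Y_cont_dual_hahn[OF assms(1)] by blast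
  obtain CZ where CZ: "CZ \<noteq> 0" "\<And>\<tau>. CZ * poly (ff j) \<tau> = cont_dual_hahn (deg j) (1/2 - a) (1/2) (bb + 1) \<tau>"
    using Z_cont_dual_hahn[OF assms(2,3)] by blast
  have "det (Emat bb n m1 ff) = 0"
  proof (cases "deg j \<le> deg i")
    case True
    define k where "k = deg i - deg j"
    have k: "deg i = deg j + k" using True by (simp add: k_def)
    have bk: "- bb = 1/2 - real k" "bb + 1 = 1/2 + real k" "bb + 1/2 = real k" using b by (simp_all add: k)
    have P: "poly (ff i) \<tau> = ((-1) ^ k * CZ / CY) * shift_factor k \<tau> * poly (ff j) \<tau>" for \<tau>
    proof -
      have "CY * poly (ff i) \<tau> = (-1) ^ k * shift_factor k \<tau> * (CZ * poly (ff j) \<tau>)"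
        unfolding CY(2) CZ(2) k bk(1,2) by (rule cont_dual_hahn_factor)
      then show ?thesis using CY(1) by (simp add: field_simps)
    qed
    show ?thesis
      by (rule det_Emat_degenerate[OF assms, of bb k ff "(-1) ^ k * CZ / CY"]) (use P bk(3) CY(1) CZ(1) in auto)
  next
    case False
    define k where "k = deg j - deg i"
    have k: "deg j = deg i + k" using False by (simp add: k_def)
    have bk: "bb + 1 = 1/2 - real k" "- bb = 1/2 + real k" "bb + 1/2 = - real k" using b by (simp_all add: k)
    have P: "poly (ff j) \<tau> = ((-1) ^ k * CY / CZ) * shift_factor k \<tau> * poly (ff i) \<tau>" for \<tau>
    proof -
      have "CZ * poly (ff j) \<tau> = (-1) ^ k * shift_factor k \<tau> * (CY * poly (ff i) \<tau>)"
        unfolding CY(2) CZ(2) k bk(1,2) by (rule cont_dual_hahn_factor)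
      then show ?thesis using CZ(1) by (simp add: field_simps)
    qed
    show ?thesis
      by (rule det_Emat_degenerate[OF assms, of bb k ff "(-1) ^ k * CY / CZ"]) (use P bk(3) CY(1) CZ(1) in auto)
  qed
  with det_Emat_nonzero show False by simp
qed

lemma inj_alpha: "inj_on (\<lambda>h. real_of_int (int (deg h)) - (if h < m1 then bb + 1/2 else 0)) {..<n}"
proof (rule inj_onI)
  fix i j
  assume ij: "i \<in> {..<n}" "j \<in> {..<n}" and eq: "real_of_int (int (deg i)) - (if i < m1 then bb + 1/2 else 0) = real_of_int (int (deg j)) - (if j < m1 then bb + 1/2 else 0)"
  have U: "i = j" if "i < m1" "j < m1" "deg i = deg j"
    using that fin nth_eq_iff_index_eq[of "sorted_list_of_set U" i j] by (simp add: deg_def)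
  have V: "i = j" if "\<not> i < m1" "\<not> j < m1" "deg i = deg j"
  proof -
    have "i - m1 = j - m1"
      using that ij fin nth_eq_iff_index_eq[of "sorted_list_of_set V" "i - m1" "j - m1"] by (simp add: deg_def n_def)
    then show ?thesis using that by simp
  qed
  show "i = j"
  proof (cases "i < m1"; cases "j < m1")
    assume "i < m1" "\<not> j < m1"
    then show ?thesis using not_degenerate[of i j] ij eq by simp
  next
    assume "\<not> i < m1" "j < m1"
    then show ?thesis using not_degenerate[of j i] ij eq by simp
  next
    assume "i < m1" "j < m1"
    then show ?thesis using U eq by simp
  next
    assume "\<not> i < m1" "\<not> j < m1"
    then show ?thesis using V eq by simp
  qed
qed

lemma lead_WW: "\<exists>L. L \<noteq> 0 \<and> lead WW (2 * int Dn) L"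
proof -
  let ?M = "mat n n (\<lambda>(h, r). 2 ^ (n - 1 - r) * (\<Prod>i<r. (of_int (int (deg h)) - (if h < m1 then bb + 1/2 else 0)) - real i) * cc h)"
  have "lead (Wpol bb (m1 + m3) m1 ff) (2 * (\<Sum>h<m1 + m3. int (deg h)) - int m1 * (int m1 - 1) - int m3 * (int m3 - 1))
      (det (mat (m1 + m3) (m1 + m3) (\<lambda>(h, r). 2 ^ (m1 + m3 - 1 - r) * (\<Prod>i<r. (of_int (int (deg h)) - (if h < m1 then bb + 1/2 else 0)) - real i) * cc h)))"
    by (rule lead_Wpol) (use lead_ff evenp_ff in \<open>auto simp: n_def\<close>)
  then have "lead WW D2 (det ?M)" unfolding n_def[symmetric] WW_def D2_def .
  moreover have "det ?M \<noteq> 0"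
    by (rule falling_mat_det_nonzero[OF inj_alpha]) (use lead_ff in auto)
  ultimately show ?thesis by (auto simp: D2_Dn)
qed

lemma WW_nonzero: "WW \<noteq> 0"
  using lead_WW lead_degree(2)[of WW] by force

text \<open>Numerator of the coefficient \<open>T_l\<close> of the operator belonging to row
  \<open>h\<close>; the common denominator is \<open>QQ\<close>.\<close>

definition AA :: "nat \<Rightarrow> nat \<Rightarrow> real poly" where
  "AA h l = [:0, 1:] * rw bb n m1 h l * cofactor (Emat bb n m1 ff) h l"

text \<open>With row \<open>h\<close> replaced by t^(2 k), the operator returns t W for the modified
  rows. Its degree bound arises from 2 Dn by exchanging 2 deg h for 2 k and adding 1, which is the
  form required by \<open>adjoint_odd\<close>.\<close>

lemma M_adjoint:
  assumes h: "h < n"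
  shows "\<exists>Q. oddp Q \<and> degree Q \<le> 2 * (Dn - deg h) + 1 \<and>
    (MOST s. (\<Sum>l<n. poly (AA h l) (s - (real n - 1 - 2 * real l)) / poly QQ (s - (real n - 1 - 2 * real l))) = poly Q s)"
proof (rule adjoint_odd[OF _ QQ_nonzero])
  let ?f = "\<lambda>k. ff(h := monom 1 (2 * k))"
  let ?W = "\<lambda>k. Wpol bb n m1 (?f k)"
  have ev: "evenp (?f k h')" for k h' using evenp_ff by (auto simp: evenp_def)
  show "n > 0" using h by simp
  show "oddp ([:0, 1:] * ?W k)" for k
    using evenp_Wpol[of m1 n "?f k" bb, OF n_ge ev] by (simp add: oddp_iff evenp_iff)
  show "degree ([:0, 1:] * ?W k) \<le> 2 * (Dn - deg h) + 1 + 2 * k" for k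
  proof -
    let ?e = "\<lambda>h'. if h' = h then int k else int (deg h')"
    let ?c = "\<lambda>h'. if h' = h then 1 else cc h'"
    have L: "\<exists>C. lead (Wpol bb (m1 + m3) m1 (?f k)) (2 * (\<Sum>h'<m1 + m3. ?e h') - int m1 * (int m1 - 1) - int m3 * (int m3 - 1)) C"
    proof (rule exI, rule lead_Wpol)
      fix h' assume "h' < m1 + m3"
      then show "lead (?f k h') (2 * ?e h') (?c h')"
        using lead_ff(1)[of h'] lead_monom[of "1::real" "2 * k"] by (auto simp: n_def)
    qed (rule ev)
    have "(\<Sum>h'<n. ?e h') = int k + (\<Sum>h'\<in>{..<n} - {h}. int (deg h'))"
      using h by (subst sum.remove[of _ h]) (auto intro!: sum.cong)
    moreover have "(\<Sum>h'<n. int (deg h')) = int (deg h) + (\<Sum>h'\<in>{..<n} - {h}. int (deg h'))"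
      using h by (subst sum.remove[of _ h]) auto
    ultimately have "2 * (\<Sum>h'<n. ?e h') - int m1 * (int m1 - 1) - int m3 * (int m3 - 1) = D2 - 2 * int (deg h) + 2 * int k"
      by (simp add: D2_def)
    also have "\<dots> = int (2 * (Dn - deg h) + 2 * k)"
      using deg_le_Dn[OF h] by (simp add: D2_Dn of_nat_diff)
    finally have E: "2 * (\<Sum>h'<n. ?e h') - int m1 * (int m1 - 1) - int m3 * (int m3 - 1) = int (2 * (Dn - deg h) + 2 * k)" .
    obtain C where "lead (?W k) (int (2 * (Dn - deg h) + 2 * k)) C"
      using L unfolding n_def[symmetric] E by blast
    then have "degree (?W k) \<le> 2 * (Dn - deg h) + 2 * k" by (rule lead_imp_degree)
    then show ?thesis
      using degree_mult_le[of "[:0, 1:]" "?W k"] by simp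
  qed
  fix k t assume q: "poly QQ t \<noteq> 0"
  have "(\<Sum>l<n. poly (AA h l) t / poly QQ t * (t + (real n - 1 - 2 * real l)) ^ (2 * k))
     = t * poly (det (Emat bb n m1 (?f k))) t / poly QQ t"
    unfolding det_Emat_update[OF h]
    by (simp add: poly_sum poly_monom AA_def sum_distrib_left sum_divide_distrib mult_ac)
  also have "\<dots> = poly ([:0, 1:] * ?W k) t"
    using q unfolding kap(2)[of "?f k", OF ev] by (simp add: QQ_def)
  finally show "(\<Sum>l<n. poly (AA h l) t / poly QQ t * (t + (real n - 1 - 2 * real l)) ^ (2 * k)) = poly ([:0, 1:] * ?W k) t" .
qed

lemma MOST_sum_shift:
  assumes "MOST y::real. G y"
  shows "MOST x. \<forall>k\<le>q. G (x + real k)"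
proof -
  have "MOST x. \<forall>k\<in>{..q}. G (x + real k)"
    by (rule MOST_all_finite) (auto intro: MOST_shift[OF assms])
  then show ?thesis by (simp add: Ball_def)
qed

text \<open>As \<open>m\<close> is even, \<open>m - j\<close> has the parity of \<open>j\<close>.
  The signs of the blocks 2 and 4 thus agree with those of the alternating rows and square to 1 in
  \<open>Mfun\<close>.\<close>

lemma xi_block:
  assumes "h < m" "k < m"
  shows "xi a N (block U V (Suc h)) x (m - Suc k) = sgn_col h k * xr (hb h) k x"
proof -
  have s: "(-1::real) ^ (m - Suc k) = (-1) ^ (k + 1)"
    using assms(2) by (simp add: minus_one_power_iff)
  have s': "(-1::real) ^ (2 * m1 + 2 * m3 - Suc k) = - ((-1) ^ k)" using s by (simp add: n_def)
  have "h < m1 \<or> (m1 \<le> h \<and> h < 2 * m1) \<or> (2 * m1 \<le> h \<and> h < 2 * m1 + m3) \<or> 2 * m1 + m3 \<le> h" by linarith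
  then show ?thesis
    using assms by (elim disjE) (auto simp: block_def xr_def sgn_col_def alt_def hb_def n_def xi_def s')
qed

definition good :: "real \<Rightarrow> bool" where
  "good y \<longleftrightarrow> nz y \<and> poly QQ (tt y) \<noteq> 0 \<and> poly WW (tt y) \<noteq> 0"

lemma MOST_good: "MOST y. good y"
  unfolding good_def MOST_conj_distrib
  using MOST_nz MOST_tt[OF MOST_poly_nonzero[OF QQ_nonzero]] MOST_tt[OF MOST_poly_nonzero[OF WW_nonzero]] by simp

lemma good_Omega:
  assumes "good x" "good (x - 1)"
  shows "Omega a N U V x \<noteq> 0"
  using assms by (intro Omega_cofactor(1)) (auto simp: good_def det_EM)

lemma Mfun_sum:
  assumes R: "is_R a N U V c R" and h: "h < m" and g: "\<forall>k\<le>m. good (x + real k)"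
  shows "Mfun a N U V R (Suc h) x = c * C1 / 2 *
    (\<Sum>l<n. poly (AA (hb h) l) (x + a + 1/2 - (real n - 1 - 2 * real l)) / poly QQ (x + a + 1/2 - (real n - 1 - 2 * real l)))"
proof -
  have hn: "hb h < n" by (rule hb_less[OF h])
  define G where "G y = poly (sl * R) y" for y
  have GG: "G y + G (y + 1) = c * C1 * (tt y * poly WW (tt y))" for y
  proof -
    have "poly (sl * R + sh 1 (sl * R)) y = poly (HO c) y" using R unfolding is_R_iff by simp
    then show ?thesis by (simp only: poly_add poly_sh G_def poly_HO)
  qed
  have S: "Sfun a N U V R y = G y / Omega a N U V y" for y
    by (simp only: Sfun_def G_def poly_mult poly_sl n_def)
  define Y where "Y k = xc k (x + real (k + 1))" for k
  have trm: "(-1) ^ (Suc h + Suc k) * xi a N (block U V (Suc h)) x (m - Suc k) * Sfun a N U V R (x + real (Suc k))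
     * det (mat_delete (Omega_mat a N U V (x + real (Suc k))) h k)
     = 1/2 * poly (rw bb n m1 (hb h) (k div 2)) (tt (Y k)) * zz (hb h) (k div 2) (Y k) * G (x + real (Suc k))" if k: "k < m" for k
  proof -
    let ?x = "x + real (k + 1)"
    have g1: "good ?x" using g k by (auto dest: spec[of _ "k + 1"])
    have g2: "good (?x - 1)"
    proof -
      have "?x - 1 = x + real k" by simp
      then show ?thesis using g k by simp
    qed
    have nzx: "nz ?x" using g1 by (simp add: good_def)
    have E: "det (EM ?x) \<noteq> 0" "det (EM (?x - 1)) \<noteq> 0" using g1 g2 by (auto simp: good_def det_EM)
    have O: "Omega a N U V ?x \<noteq> 0" by (rule Omega_cofactor(1)[OF nzx E])
    have cof: "(-1) ^ (h + k) * det (mat_delete (Omega_mat a N U V ?x) h k) = Omega a N U V ?x * YM ?x $$ (k, h)"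
      using Omega_cofactor(2)[OF nzx E h k] by (simp add: cofactor_def)
    have xrr: "xr (hb h) k x * rho (hb h) k ?x = poly (rw bb n m1 (hb h) (k div 2)) (tt (Y k))"
      using xr_rho[OF nzx k, of "hb h"] by (simp add: Y_def)
    have sg: "sgn_col h k * sgn_col h k = 1" by (simp add: sgn_col_def flip: power_add)
    have "(-1) ^ (Suc h + Suc k) * xi a N (block U V (Suc h)) x (m - Suc k) * Sfun a N U V R ?x
     * det (mat_delete (Omega_mat a N U V ?x) h k)
      = sgn_col h k * xr (hb h) k x * (G ?x / Omega a N U V ?x) * ((-1) ^ (h + k) * det (mat_delete (Omega_mat a N U V ?x) h k))"
      unfolding xi_block[OF h k] S by simp
    also have "\<dots> = sgn_col h k * xr (hb h) k x * G ?x * YM ?x $$ (k, h)"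
      unfolding cof using O by simp
    also have "\<dots> = (sgn_col h k * sgn_col h k) * (xr (hb h) k x * rho (hb h) k ?x) * zz (hb h) (k div 2) (Y k) * G ?x / 2"
      using k h by (simp add: YM_def Y_def)
    finally show ?thesis unfolding sg xrr by simp
  qed
  have "Mfun a N U V R (Suc h) x = (\<Sum>j = 1..m. (-1) ^ (Suc h + j) * xi a N (block U V (Suc h)) x (m - j) * Sfun a N U V R (x + real j)
     * det (mat_delete (Omega_mat a N U V (x + real j)) h (j - 1)))"
    unfolding Mfun_def n_def[symmetric] by simp
  also have "\<dots> = (\<Sum>k<m. (-1) ^ (Suc h + Suc k) * xi a N (block U V (Suc h)) x (m - Suc k) * Sfun a N U V R (x + real (Suc k))
     * det (mat_delete (Omega_mat a N U V (x + real (Suc k))) h k))"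
    by (rule sum.reindex_bij_witness[of _ Suc "\<lambda>j. j - 1"]) auto
  also have "\<dots> = (\<Sum>k<m. 1/2 * poly (rw bb n m1 (hb h) (k div 2)) (tt (Y k)) * zz (hb h) (k div 2) (Y k) * G (x + real (Suc k)))"
    using trm by (intro sum.cong) auto
  \<comment> \<open>The columns \<open>2 * l\<close> and \<open>2 * l + 1\<close> evaluate
    \<open>E\<close> at the same point x + 2 l + 1, so \<open>G\<close> enters only through the sum
    of two consecutive values, which \<open>GG\<close> evaluates.\<close>
  also have "\<dots> = (\<Sum>l<n. 1/2 * poly (rw bb n m1 (hb h) l) (tt (x + 2 * real l + 1)) * zz (hb h) l (x + 2 * real l + 1)
      * (G (x + 2 * real l + 1) + G (x + 2 * real l + 1 + 1)))"
    unfolding sum_cols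
  proof (rule sum.cong[OF refl])
    fix l
    have y: "Y (2 * l) = x + 2 * real l + 1" "Y (2 * l + 1) = x + 2 * real l + 1"
      "x + real (Suc (2 * l)) = x + 2 * real l + 1" "x + real (Suc (2 * l + 1)) = x + 2 * real l + 1 + 1"
      "2 * l div 2 = l" "(2 * l + 1) div 2 = l"
      by (simp_all add: Y_def xc_def)
    show "1/2 * poly (rw bb n m1 (hb h) (2 * l div 2)) (tt (Y (2 * l))) * zz (hb h) (2 * l div 2) (Y (2 * l)) * G (x + real (Suc (2 * l)))
       + 1/2 * poly (rw bb n m1 (hb h) ((2 * l + 1) div 2)) (tt (Y (2 * l + 1))) * zz (hb h) ((2 * l + 1) div 2) (Y (2 * l + 1)) * G (x + real (Suc (2 * l + 1)))
      = 1/2 * poly (rw bb n m1 (hb h) l) (tt (x + 2 * real l + 1)) * zz (hb h) l (x + 2 * real l + 1)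
      * (G (x + 2 * real l + 1) + G (x + 2 * real l + 1 + 1))"
      unfolding y by (simp only: distrib_left)
  qed
  \<comment> \<open>The factor \<open>WW\<close> from \<open>GG\<close> cancels the one in the
    determinant below the cofactor in \<open>zz\<close>.\<close>
  also have "\<dots> = (\<Sum>l<n. c * C1 / 2 * (poly (AA (hb h) l) (x + a + 1/2 - (real n - 1 - 2 * real l)) / poly QQ (x + a + 1/2 - (real n - 1 - 2 * real l))))"
  proof (rule sum.cong[OF refl])
    fix l assume "l \<in> {..<n}"
    then have l: "l < n" by simp
    let ?y = "x + 2 * real l + 1"
    have t: "x + a + 1/2 - (real n - 1 - 2 * real l) = tt ?y" by (simp add: tt_def)
    have "2 * l + 1 \<le> m" using l by simp
    then have "good (x + real (2 * l + 1))" using g by blast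
    moreover have "x + real (2 * l + 1) = ?y" by simp
    ultimately have "good ?y" by (simp only:)
    then have q: "poly QQ (tt ?y) \<noteq> 0" "poly WW (tt ?y) \<noteq> 0" by (auto simp: good_def)
    have z: "zz (hb h) l ?y = poly (cofactor (Emat bb n m1 ff) (hb h) l) (tt ?y) / (poly QQ (tt ?y) * poly WW (tt ?y))"
    proof -
      have "cofactor (EM ?y) (hb h) l = poly (cofactor (Emat bb n m1 ff) (hb h) l) (tt ?y)"
        using hn l by (simp add: EM_def poly_cofactor carrier_matD[OF Emat_carrier])
      then show ?thesis unfolding zz_def det_EM by (simp only:)
    qed
    show "1/2 * poly (rw bb n m1 (hb h) l) (tt ?y) * zz (hb h) l ?y * (G ?y + G (?y + 1))
      = c * C1 / 2 * (poly (AA (hb h) l) (x + a + 1/2 - (real n - 1 - 2 * real l)) / poly QQ (x + a + 1/2 - (real n - 1 - 2 * real l)))"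
      unfolding t GG z AA_def using q by (simp add: field_simps)
  qed
  finally show ?thesis by (simp add: sum_distrib_left)
qed

lemma Mfun_poly:
  assumes R: "is_R a N U V c R" and h: "h < m"
  shows "\<exists>Q. oddp Q \<and> degree Q \<le> 2 * (Dn - deg (hb h)) + 1 \<and> (MOST x. Mfun a N U V R (Suc h) x = poly Q (x + a + 1/2))"
proof -
  obtain Q where Q: "oddp Q" "degree Q \<le> 2 * (Dn - deg (hb h)) + 1"
    "MOST s. (\<Sum>l<n. poly (AA (hb h) l) (s - (real n - 1 - 2 * real l)) / poly QQ (s - (real n - 1 - 2 * real l))) = poly Q s"
    using M_adjoint[OF hb_less[OF h]] by blast
  have "MOST x. (\<Sum>l<n. poly (AA (hb h) l) (x + (a + 1/2) - (real n - 1 - 2 * real l)) / poly QQ (x + (a + 1/2) - (real n - 1 - 2 * real l))) = poly Q (x + (a + 1/2))"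
    by (rule MOST_shift[OF Q(3)])
  then have "MOST x. Mfun a N U V R (Suc h) x = poly (smult (c * C1 / 2) Q) (x + a + 1/2)"
    using MOST_sum_shift[OF MOST_good, of m]
    by eventually_elim (simp add: Mfun_sum[OF R h] add.assoc)
  moreover have "oddp (smult (c * C1 / 2) Q)" using Q(1) by (simp add: oddp_def)
  moreover have "degree (smult (c * C1 / 2) Q) \<le> 2 * (Dn - deg (hb h)) + 1" using Q(2) degree_smult_le order_trans by blast
  ultimately show ?thesis by blast
qed

lemma exists_Mtilde:
  assumes R: "is_R a N U V c R"
  shows "\<exists>Mt. is_Mtilde a N U V R Mt"
proof -
  have "\<forall>h\<in>{1..m}. \<exists>P. MOST x. Mfun a N U V R h x = sigma a (x + 1) * poly P (theta a x)"
  proof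
    fix h' assume "h' \<in> {1..m}"
    then obtain h where h: "h' = Suc h" "h < m" by (cases h') auto
    obtain Q where Q: "oddp Q" "MOST x. Mfun a N U V R (Suc h) x = poly Q (x + a + 1/2)"
      using Mfun_poly[OF R h(2)] by blast
    define K where "K = poly_shift 1 Q"
    have QK: "Q = [:0, 1:] * K"
    proof (rule poly_eqI)
      fix i show "coeff Q i = coeff ([:0, 1:] * K) i"
        using Q(1) by (cases i) (auto simp: K_def coeff_poly_shift oddp_def)
    qed
    have "evenp K" using Q(1) by (auto simp: K_def coeff_poly_shift oddp_def evenp_def)
    then obtain P where P: "\<And>z. poly K z = poly P (z\<^sup>2 - (a + 1/2)\<^sup>2)" using evenp_as_square by blast
    \<comment> \<open>An odd polynomial is z times an even one, and
      \<open>sigma a (x + 1) = - 2 * z\<close>; hence the factor -1/2.\<close>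
    have "poly Q (x + a + 1/2) = sigma a (x + 1) * poly (smult (- 1/2) P) (theta a x)" for x
    proof -
      define z where "z = x + a + 1/2"
      have sg: "sigma a (x + 1) = - 2 * z" by (simp add: sigma_shift z_def)
      show ?thesis unfolding QK poly_mult P theta_sq z_def[symmetric] sg by simp
    qed
    then show "\<exists>P. MOST x. Mfun a N U V R h' x = sigma a (x + 1) * poly P (theta a x)"
      using Q(2) unfolding h(1) by (intro exI[of _ "smult (- 1/2) P"]) (simp only:)
  qed
  then obtain Mt where "\<forall>h\<in>{1..m}. MOST x. Mfun a N U V R h x = sigma a (x + 1) * poly (Mt h) (theta a x)"
    by (auto dest: bchoice)
  then show ?thesis unfolding is_Mtilde_def n_def[symmetric] by blast
qed

section \<open>Degrees of the polynomials entering the operator\<close>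

lemma degree_theta: "degree (pcompose p [:0, 2 * a + 1, 1:]) = 2 * degree p"
  by (simp add: degree_pcompose)

lemma poly_theta: "poly (pcompose p [:0, 2 * a + 1, 1:]) x = poly p (theta a x)"
  by (simp add: poly_pcompose theta_def algebra_simps)

lemma degree_Mtilde:
  assumes R: "is_R a N U V c R" and Mt: "is_Mtilde a N U V R Mt" and h: "h < m"
  shows "Mt (Suc h) = 0 \<or> degree (Mt (Suc h)) \<le> Dn - deg (hb h)"
proof (cases "Mt (Suc h) = 0")
  case False
  obtain Q where Q: "degree Q \<le> 2 * (Dn - deg (hb h)) + 1" "MOST x. Mfun a N U V R (Suc h) x = poly Q (x + a + 1/2)"
    using Mfun_poly[OF R h] by blast
  have M: "MOST x. Mfun a N U V R (Suc h) x = sigma a (x + 1) * poly (Mt (Suc h)) (theta a x)"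
    using Mt h unfolding is_Mtilde_def n_def[symmetric] by auto
  let ?L = "[:- (2 * a + 1), - 2:] * pcompose (Mt (Suc h)) [:0, 2 * a + 1, 1:]"
  have e: "poly ?L x = sigma a (x + 1) * poly (Mt (Suc h)) (theta a x)" for x
    unfolding poly_mult poly_theta by (simp add: sigma_shift)
  have f: "poly (sh (a + 1/2) Q) x = poly Q (x + a + 1/2)" for x by (simp add: add.assoc)
  have "MOST x. poly ?L x = poly (sh (a + 1/2) Q) x"
    unfolding e f using M Q(2) by eventually_elim simp
  then have L: "?L = sh (a + 1/2) Q" by (rule poly_inf_eq)
  have "degree ?L = 1 + 2 * degree (Mt (Suc h))"
    using False by (subst degree_mult_eq) (auto simp: degree_theta pcompose_eq_0_iff)
  then show ?thesis using Q(1) unfolding L by simp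
qed simp

text \<open>Averaging preserves the degree, so S \<Omega> has the degree 2 Dn + 1 of t W.\<close>

lemma lead_g:
  assumes "is_R a N U V c R" "c \<noteq> 0"
  shows "\<exists>L. L \<noteq> 0 \<and> lead (sl * R) (int (2 * Dn + 1)) L"
proof -
  obtain L where L: "L \<noteq> 0" "lead WW (2 * int Dn) L" using lead_WW by blast
  have "lead [:0, 1:] 1 (1::real)" by (rule lead_lin_const)
  from lead_smult[OF lead_sh[OF lead_mult[OF this L(2)]], of "c * C1" "- real n + a + 1/2"]
  have HO: "lead (HO c) (int (2 * Dn + 1)) (c * C1 * L)" by (simp add: HO_def)
  have nz: "c * C1 * L \<noteq> 0" using assms(2) C1(1) L(1) by simp
  let ?g = "sl * R"
  have g: "?g + sh 1 ?g = HO c" using assms(1) by (simp only: is_R_iff)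
  have L2: "lead (HO c) (int (degree ?g)) (2 * lead_coeff ?g)"
    using lead_coeff_add_sh[OF lead_coeff_nat[of ?g], of 1] unfolding g .
  have "?g \<noteq> 0" 
  proof
    assume "?g = 0"
    have "HO c = 0" using g unfolding \<open>?g = 0\<close> by (simp add: sh_def)
    then show False using lead_degree(2)[OF HO nz] nz by simp
  qed
  then have "int (degree ?g) = int (2 * Dn + 1)"
    using lead_degree(1)[OF L2] lead_degree(1)[OF HO nz] by simp
  then show ?thesis using lead_coeff_nat[of ?g] \<open>?g \<noteq> 0\<close> by (intro exI[of _ "lead_coeff ?g"]) simp
qed

lemma S_Omega:
  "MOST x. Sfun a N U V R x * Omega a N U V x = poly (sl * R) x"
proof -
  have "MOST x. good (x + (- 1))" by (rule MOST_shift[OF MOST_good])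
  with MOST_good show ?thesis
  proof eventually_elim
    case (elim x)
    then have "Omega a N U V x \<noteq> 0" using good_Omega by simp
    then show ?case by (simp add: Sfun_def poly_sl n_def)
  qed
qed

lemma is_PS_iff: "is_PS a N U V R P \<longleftrightarrow>
  pcompose P [:0, 2 * a + 1, 1:] - sh (- 1) (pcompose P [:0, 2 * a + 1, 1:]) = sl * R + sh (real m) (sl * R)" (is "_ \<longleftrightarrow> ?L = ?r")
proof -
  have L: "poly ?L x = poly P (theta a x) - poly P (theta a (x - 1))" for x
    by (simp add: poly_theta)
  have "MOST x. Sfun a N U V R (x + real m) * Omega a N U V (x + real m) = poly (sl * R) (x + real m)"
    by (rule MOST_shift[OF S_Omega])
  with S_Omega[of R] have r: "MOST x. Sfun a N U V R x * Omega a N U V x + Sfun a N U V R (x + real m) * Omega a N U V (x + real m) = poly ?r x"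
    by eventually_elim (simp only: poly_add poly_sh)
  show ?thesis
  proof
    assume "is_PS a N U V R P"
    then have "MOST x. poly ?L x = Sfun a N U V R x * Omega a N U V x + Sfun a N U V R (x + real m) * Omega a N U V (x + real m)"
      unfolding is_PS_def n_def[symmetric] L .
    with r have "MOST x. poly ?L x = poly ?r x" by eventually_elim simp
    then show "?L = ?r" by (rule poly_inf_eq)
  next
    assume *: "?L = ?r"
    show "is_PS a N U V R P"
      unfolding is_PS_def n_def[symmetric] L[symmetric] *
      using r by eventually_elim simp
  qed
qed

text \<open>The function g = S \<Omega> is antisymmetric about n - a and m = 2 n, so g(x) + g(x + m)
  is odd in x + a. Hence it is the central difference of an even function of x + a + 1/2, that is,
  of a polynomial in \<theta>(x).\<close>

lemma exists_PS:
  assumes "is_R a N U V c R"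
  shows "\<exists>P. is_PS a N U V R P"
proof -
  let ?g = "sl * R"
  have g: "?g + sh 1 ?g = HO c" using assms by (simp only: is_R_iff)
  define r where "r = sh (- a) (?g + sh (real m) ?g)"
  have r: "poly r y = poly ?g (y - a) + poly ?g (y - a + real m)" for y
    unfolding r_def poly_sh poly_add by simp
  have "oddp r" unfolding oddp_iff
  proof
    fix y
    have "poly ?g (- y - a) = - poly ?g (y - a + real m)" "poly ?g (- y - a + real m) = - poly ?g (y - a)"
    proof -
      have "2 * (real n - a) - (y - a + real m) = - y - a" "2 * (real n - a) - (y - a) = - y - a + real m" by simp_all
      then show "poly ?g (- y - a) = - poly ?g (y - a + real m)" "poly ?g (- y - a + real m) = - poly ?g (y - a)"
        using antisym_solution[OF g, of "y - a + real m"] antisym_solution[OF g, of "y - a"] by (simp_all only:)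
    qed
    then show "poly r (- y) = - poly r y" unfolding r by simp
  qed
  then obtain f where f: "evenp f" "\<And>y. poly f (y + 1/2) - poly f (y - 1/2) = poly r y"
    using odd_central_difference by blast
  obtain P where P: "\<And>z. poly f z = poly P (z\<^sup>2 - (a + 1/2)\<^sup>2)" using evenp_as_square[OF f(1)] by blast
  have "is_PS a N U V R P" unfolding is_PS_iff
  proof (rule poly_ext)
    fix x
    have "poly P (theta a x) - poly P (theta a (x - 1)) = poly f (x + a + 1/2) - poly f (x + a - 1/2)"
      unfolding theta_sq P by (simp add: algebra_simps)
    also have "\<dots> = poly ?g x + poly ?g (x + real m)"
      using f(2)[of "x + a"] r[of "x + a"] by simp
    finally show "poly (pcompose P [:0, 2 * a + 1, 1:] - sh (- 1) (pcompose P [:0, 2 * a + 1, 1:])) x = poly (?g + sh (real m) ?g) x"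
      by (simp only: poly_diff poly_add poly_sh poly_theta) simp
  qed
  then show ?thesis by blast
qed

text \<open>The two summands on the right have equal leading terms of degree 2 Dn + 1, while the
  difference on the left lowers the degree of the polynomial in \<open>x\<close>, twice that of
  \<open>P\<close>, by exactly one.\<close>

lemma degree_PS:
  assumes "is_R a N U V c R" "c \<noteq> 0" "is_PS a N U V R P"
  shows "degree P = Dn + 1" "P \<noteq> 0"
proof -
  let ?F = "pcompose P [:0, 2 * a + 1, 1:]"
  obtain L where L: "L \<noteq> 0" "lead (sl * R) (int (2 * Dn + 1)) L" using lead_g[OF assms(1,2)] by blast
  have r: "lead (?F - sh (- 1) ?F) (int (2 * Dn + 1)) (2 * L)"
    using lead_coeff_add_sh[OF L(2), of "real m"] assms(3) unfolding is_PS_iff by simp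
  then have dr: "degree (?F - sh (- 1) ?F) = 2 * Dn + 1" using lead_degree(1)[OF r] L(1) by simp
  have "degree P \<noteq> 0"
  proof
    assume "degree P = 0"
    then obtain p where "P = [:p:]" by (auto elim: degree_eq_zeroE)
    then show False using dr by (simp add: sh_def)
  qed
  then obtain q where q: "degree P = Suc q" by (cases "degree P") auto
  have dF: "degree ?F = Suc (2 * q + 1)" by (simp add: degree_theta q)
  then have lc: "coeff ?F (Suc (2 * q + 1)) \<noteq> 0" using leading_coeff_0_iff[of ?F] by auto
  have "degree (?F - sh (- 1) ?F) \<le> 2 * q + 1"
    by (rule degree_diff_sh) (simp add: dF)
  moreover have "coeff (?F - sh (- 1) ?F) (2 * q + 1) \<noteq> 0"
    using coeff_sh_top[of ?F "2 * q + 1" "- 1"] lc dF by simp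
  then have "2 * q + 1 \<le> degree (?F - sh (- 1) ?F)" by (rule le_degree)
  ultimately show "degree P = Dn + 1" using dr q by simp
  show "P \<noteq> 0" using q by auto
qed

lemma order_DS:
  assumes R: "is_R a N U V c R" and c: "c \<noteq> 0" and Mt: "is_Mtilde a N U V R Mt" and P: "is_PS a N U V R P"
  shows "diffop_has_order (DS_op a N U V Mt P) (2 * (int Dn + 1))"
proof -
  have "diffop_has_order (DS_op a N U V Mt P) (2 * int (Dn + 1))"
  proof (rule DS_order)
    show "P \<noteq> 0" "degree P = Dn + 1" using degree_PS[OF R c P] by auto
  next
    fix h' assume "h' \<in> {1..m1}"
    then obtain h where h: "h' = Suc h" "h < m1" by (cases h') auto
    have hm: "h < m" "h < n" using h by (auto simp: n_def)
    have e: "hb h = h" using h by (simp add: hb_def)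
    have "degree (Ypol a N (sorted_list_of_set U ! h)) = deg h"
      using degree_yz(1)[OF hm(2)] h by (simp add: yz_def deg_def)
    then show "Mt h' = 0 \<or> degree (Mt h') + degree (Ypol a N (sorted_list_of_set U ! (h' - 1))) + 1 \<le> Dn + 1"
      using degree_Mtilde[OF R Mt hm(1)] deg_le_Dn[OF hm(2)] unfolding e h(1) by auto
  next
    fix h' assume "h' \<in> {1..m3}"
    then obtain h where h: "h' = Suc h" "h < m3" by (cases h') auto
    have hm: "2 * m1 + h < m" "m1 + h < n" using h by (auto simp: n_def)
    have e: "hb (2 * m1 + h) = m1 + h" using h by (simp add: hb_def)
    have s: "2 * m1 + h' = Suc (2 * m1 + h)" by (simp add: h)
    have "degree (Zpol a N (sorted_list_of_set V ! h)) = deg (m1 + h)"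
      using degree_yz(1)[OF hm(2)] h by (simp add: yz_def deg_def)
    then show "Mt (2 * m1 + h') = 0 \<or> degree (Mt (2 * m1 + h')) + degree (Zpol a N (sorted_list_of_set V ! (h' - 1))) + 1 \<le> Dn + 1"
      using degree_Mtilde[OF R Mt hm(1)] deg_le_Dn[OF hm(2)] unfolding e s h(1) by auto
  qed
  moreover have "2 * int (Dn + 1) = 2 * (int Dn + 1)" by simp
  ultimately show ?thesis by (simp only:)
qed

end

text \<open>The set is the reflection of \<open>F\<close> in its maximum followed by the complement
  in \<open>{0..M}\<close>. Both steps change sum and cardinality in a known way, and the sum minus
  (card choose 2) is preserved.\<close>

lemma involution_sum:
  assumes "finite F" "0 \<notin> F"
  shows "finite (involution F)" "0 \<notin> involution F"
    "2 * (\<Sum>u\<in>involution F. int u) - int (card (involution F)) * (int (card (involution F)) - 1)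
      = 2 * ((\<Sum>f\<in>F. int f) - int (card F choose 2))"
proof -
  show "finite (involution F)" "0 \<notin> involution F" by (auto simp: involution_def)
  have ch: "2 * int (card F choose 2) = int (card F) * (int (card F) - 1)"
  proof -
    have "even (card F * (card F - 1))" by (cases "card F") auto
    then have "2 * (card F choose 2) = card F * (card F - 1)" by (simp add: choose_two)
    then have "2 * int (card F choose 2) = int (card F * (card F - 1))" by (metis of_nat_mult of_nat_numeral)
    then show ?thesis by (cases "card F") (auto simp: algebra_simps)
  qed
  show "2 * (\<Sum>u\<in>involution F. int u) - int (card (involution F)) * (int (card (involution F)) - 1)
      = 2 * ((\<Sum>f\<in>F. int f) - int (card F choose 2))"
  proof (cases "F = {}")
    case True
    then show ?thesis by (simp add: involution_def)
  next
    case False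
    define M where "M = Max F"
    have M: "M \<in> F" "\<And>f. f \<in> F \<Longrightarrow> f \<le> M" using assms False by (auto simp: M_def)
    define G where "G = (\<lambda>f. M - f) ` F"
    have inj: "inj_on (\<lambda>f. M - f) F" by (rule inj_onI) (metis M(2) diff_diff_cancel)
    have cG: "card G = card F" "finite G" "0 \<in> G" "G \<subseteq> {0..M}"
      using assms M by (auto simp: G_def card_image inj)
    \<comment> \<open>Since \<open>M\<close> belongs to \<open>F\<close>, the reflected set
      \<open>G\<close> contains 0, so the range may start at 0 instead of 1.\<close>
    have I: "involution F = {0..M} - G"
      using False cG(3) by (auto simp: involution_def M_def[symmetric] G_def[symmetric]) (metis not_less_eq_eq le0 not_less0 neq0_conv Suc_leI One_nat_def)
    have card: "int (card (involution F)) = int M + 1 - int (card F)"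
    proof -
      have "card ({0..M} - G) = card {0..M} - card G" by (rule card_Diff_subset) (use cG in auto)
      moreover have "card G \<le> card {0..M}" by (rule card_mono) (use cG in auto)
      ultimately show ?thesis unfolding I cG(1)[symmetric] by simp
    qed
    have sG: "(\<Sum>g\<in>G. int g) = int (card F) * int M - (\<Sum>f\<in>F. int f)"
    proof -
      have "(\<Sum>g\<in>G. int g) = (\<Sum>f\<in>F. int (M - f))" unfolding G_def by (simp add: sum.reindex[OF inj])
      also have "\<dots> = (\<Sum>f\<in>F. int M - int f)" by (intro sum.cong refl) (use M in \<open>simp add: of_nat_diff\<close>)
      finally show ?thesis by (simp add: sum_subtractf)
    qed
    have sM: "2 * (\<Sum>u\<in>{0..M}. int u) = int M * (int M + 1)"
      by (induction M) (auto simp: algebra_simps)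
    have "(\<Sum>u\<in>{0..M}. int u) = (\<Sum>u\<in>{0..M} - G. int u) + (\<Sum>g\<in>G. int g)"
      by (rule sum.subset_diff) (use cG in auto)
    then have "2 * (\<Sum>u\<in>involution F. int u) = int M * (int M + 1) - 2 * (int (card F) * int M - (\<Sum>f\<in>F. int f))"
      using sM sG unfolding I by simp
    then show ?thesis unfolding card using ch by (simp add: algebra_simps)
  qed
qed

theorem theorem3p2:
  fixes a N c :: real and F G U V :: "nat set"
  assumes "finite F" and "0 \<notin> F" and "finite G" and "0 \<notin> G"
    and U: "U = involution F" and V: "V = involution G"
    and Y_defined: "\<forall>u\<in>U. dual_hahn_defined u (- a) (2 * a + N)"
    and Z_defined: "\<forall>v\<in>V. dual_hahn_defined v (- a) (- 2 - N)"
    and Omega_nonzero: "\<not> (MOST x. Omega a N U V x = 0)"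
    and c: "c \<noteq> 0"
  shows "(\<exists>!R. is_R a N U V c R) \<and>
    (\<forall>R. is_R a N U V c R \<longrightarrow>
      (\<exists>p :: real poly. MOST x. Sfun a N U V R x * Omega a N U V x = poly p x) \<and>
      (\<exists>Mt. is_Mtilde a N U V R Mt) \<and>
      (\<exists>P. is_PS a N U V R P) \<and>
      (\<forall>Mt P. is_Mtilde a N U V R Mt \<and> is_PS a N U V R P \<longrightarrow>
        diffop_has_order (DS_op a N U V Mt P)
          (2 * ((\<Sum>f\<in>F. int f) + (\<Sum>f\<in>G. int f)
                - int (card F choose 2) - int (card G choose 2) + 1))))"
proof -
  note iF = involution_sum[OF assms(1,2), folded U] and iG = involution_sum[OF assms(3,4), folded V]
  interpret krall_generic a N U V
    by unfold_locales (use iF iG Y_defined Z_defined Omega_nonzero in auto)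
  have D: "int Dn + 1 = (\<Sum>f\<in>F. int f) + (\<Sum>f\<in>G. int f) - int (card F choose 2) - int (card G choose 2) + 1"
    using iF(3) iG(3) D2_Dn by (simp add: D2_def sum_deg)
  show ?thesis
    unfolding D[symmetric]
    using ex1_R[of c] S_Omega exists_Mtilde exists_PS order_DS[OF _ c] by blast
qed

end
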